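(* Let $T:S^1\to S^1$, $0<\eta<\rho$ and $\epsilon>0$ be such that: - $T$ is analytic and uniformly expanding; - $T$ admits an analytic extension onto $\mathfrak{U}_{e^{2\pi\eta}+\epsilon}$; and - $\mathfrak{U}_{e^{2\pi\rho}}\cap T(\partial\mathfrak{U}_{e^{2\pi\eta}})=\emptyset$. Let $\alpha\in(\eta,\rho)$, let $\mathfrak{r}>0$ be fixed, and set $$r=\left(\frac{1}{\mathfrak{r}}\right)^{\frac{\alpha}{\alpha-\eta}}\left(1+\frac{2}{e^{2\pi(\rho-\alpha)}-1}\right)^{\frac{\alpha}{\alpha-\eta}}.$$ Let $K\ge1$ be an integer and let $\delta>0$ satisfy $\delta\ge r\,\|\mathcal{L}_T-\mathcal{L}_{T,K}\|_{\mathcal{A}_\alpha\to\mathcal{A}_0}$. Let $\gamma_0$ be the circle of radius $\mathfrak{r}$ centered at $0$ (so $\mathcal{D}_{\gamma_0}=B_{\mathfrak{r}}(0)$), and let $\gamma_1,\dots,\gamma_k\subset\mathbb{C}$ be simple closed loops such that (1) the sets $\overline{\mathcal{D}_{\gamma_i}}$, $0\le i\le k$, are pairwise disjoint; and (2) $\sigma_\delta(\mathcal{L}_{T,K},\mathcal{A}_0)\subset\bigcup_{j=0}^k\mathcal{D}_{\gamma_j}$. Then $$\sigma(\mathcal{L}_T)\subset\bigcup_{j=0}^k\mathcal{D}_{\gamma_j},$$ and moreover $$\mathfrak{m}_{\mathcal{D}_{\gamma_j}}(\mathcal{L}_T)=\mathfrak{m}_{\mathcal{D}_{\gamma_j}}(\mathcal{L}_{T,K})\qquad\text{for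 all }1\le j\le k.$$
   Context: $S^1$ is the unit circle in $\mathbb{C}$. For $r>1$, $\mathfrak{U}_r=\{z\in\mathbb{C}: r^{-1}<|z|<r\}$. For complex-valued $f\in L^1(S^1)$ and $k\in\mathbb{Z}$, $c_k(f)=\frac{1}{2\pi i}\int_{S^1}\frac{f(z)}{z^{k+1}}\,dz$. For $\eta\ge0$, $\mathcal{A}_\eta$ is the Banach space of $f\in L^1(S^1)$ for which $\|f\|_{\mathcal{A}_\eta}=\sum_{k\in\mathbb{Z}}e^{2\pi|k|\eta}|c_k(f)|$ is finite. A $C^1$ map $T:S^1\to S^1$ is uniformly expanding if $|T'|>1$ on $S^1$; its transfer operator $\mathcal{L}_T:L^1(S^1)\to L^1(S^1)$ is $\mathcal{L}_T\varphi(x)=\sum_{y\in T^{-1}x}\frac{\varphi(y)}{|T'(y)|}$. The analytic extension of $T$ is also denoted $T$. For $K\ge1$ the Galerkin projection is $\Pi_Kf(z)=\sum_{k=-K}^{K}c_k(f)z^k$, and $\mathcal{L}_{T,K}=\Pi_K\circ\mathcal{L}_T\circ\Pi_K$, a finite-rank operator on each $\mathcal{A}_\alpha$, $\alpha\ge0$. $\|\cdot\|_{\mathcal{A}_\alpha\to\mathcal{A}_0}$ is the operator norm from $\mathcal{A}_\alpha$ to $\mathcal{A}_0$. Under the hypotheses on $T,\eta,\rho,\alpha$ in the claim, $\mathcal{L}_T$ is a compact operator on each of $\mathcal{A}_\eta$ and $\mathcal{A}_\alpha$, with the same spectrum on both, denoted $\sigma(\mathcal{L}_T)$. For $S\subset\mathbb{C}$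 whose intersection with the spectrum consists of discrete eigenvalues, $\mathfrak{m}_S(\mathcal{L}_T)$ and $\mathfrak{m}_S(\mathcal{L}_{T,K})$ are the sums of the algebraic multiplicities of the eigenvalues in $S$ of $\mathcal{L}_T$, respectively $\mathcal{L}_{T,K}$, acting on $\mathcal{A}_\alpha$. For a bounded operator $B$ on a Banach space $\mathcal{B}$ and $\delta>0$, $\sigma_\delta(B,\mathcal{B})$ is the union of the spectrum $\sigma(B,\mathcal{B})$ and the set of $z\in\mathbb{C}$ such that $z-B$ is boundedly invertible and $\|(z-B)^{-1}\|_{\mathcal{B}}\ge\delta^{-1}$. For a simple closed curve $\gamma\subset\mathbb{C}$, $\mathcal{D}_\gamma$ is its open interior (the bounded component of $\mathbb{C}\setminus\gamma$). $B_{\mathfrak{r}}(0)$ is the open disk of radius $\mathfrak{r}$ centered at $0$. *)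

theory Defs
  imports "HOL-Complex_Analysis.Complex_Analysis" "HOL-Library.Extended_Nat"
begin

section \<open>The space \<open>L\<^sup>1(S\<^sup>1)\<close>\<close>

text \<open>Arc length on the unit circle with total mass 1, pushed forward along
  \<^term>\<open>circlepath 0 1\<close>, that is \<open>t \<mapsto> exp (2 \<pi> i t)\<close> on \<open>[0, 1]\<close>.\<close>

definition circle_measure :: "complex measure" where
  "circle_measure =
     distr (restrict_space lborel {0..1}) (restrict_space borel (sphere 0 1)) (circlepath 0 1)"

text \<open>Values off the unit circle are irrelevant, since the space of the measure is the circle.\<close>

definition circle_L1_rel :: "(complex \<Rightarrow> complex) \<Rightarrow> (complex \<Rightarrow> complex) \<Rightarrow> bool" where
  "circle_L1_rel f g \<longleftrightarrow>
     integrable circle_measure f \<and> integrable circle_measure g \<and> (AE z in circle_measure. f z = g z)"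

quotient_type circle_L1 = "complex \<Rightarrow> complex" / partial: circle_L1_rel
proof (rule part_equivpI)
  show "\<exists>x. circle_L1_rel x x"
    by (intro exI[of _ "\<lambda>_. 0"]) (simp add: circle_L1_rel_def)
  show "symp circle_L1_rel"
    unfolding symp_def circle_L1_rel_def by (simp add: eq_commute)
  show "transp circle_L1_rel"
    unfolding transp_def circle_L1_rel_def by (auto elim: eventually_elim2)
qed

instantiation circle_L1 :: ab_group_add
begin

lift_definition zero_circle_L1 :: circle_L1 is "\<lambda>_. 0"
  by (simp add: circle_L1_rel_def)

lift_definition plus_circle_L1 :: "circle_L1 \<Rightarrow> circle_L1 \<Rightarrow> circle_L1" is "\<lambda>f g z. f z + g z"
  unfolding circle_L1_rel_def by (auto elim: eventually_elim2)

lift_definition minus_circle_L1 :: "circle_L1 \<Rightarrow> circle_L1 \<Rightarrow> circle_L1" is "\<lambda>f g z. f z - g z"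
  unfolding circle_L1_rel_def by (auto elim: eventually_elim2)

lift_definition uminus_circle_L1 :: "circle_L1 \<Rightarrow> circle_L1" is "\<lambda>f z. - f z"
  unfolding circle_L1_rel_def by (auto elim: eventually_elim2)

instance
  by standard (transfer, simp add: circle_L1_rel_def algebra_simps)+

end

lift_definition scaleC :: "complex \<Rightarrow> circle_L1 \<Rightarrow> circle_L1" (infixr "*\<^sub>C" 75) is "\<lambda>c f z. c * f z"
  unfolding circle_L1_rel_def by (auto elim: eventually_elim2)

interpretation circle_L1: vector_space scaleC
  by standard (transfer, simp add: circle_L1_rel_def algebra_simps)+

lemma circlepath_measurable:
  "circlepath 0 1 \<in> restrict_space lborel {0..1} \<rightarrow>\<^sub>M restrict_space borel (sphere 0 1)"
proof (rule measurable_restrict_space2)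
  show "circlepath 0 1 \<in> space (restrict_space lborel {0..1}) \<rightarrow> sphere 0 1"
    by (auto simp: circlepath space_restrict_space)
  have "circlepath 0 1 \<in> borel_measurable borel"
    unfolding circlepath by (intro borel_measurable_continuous_onI continuous_intros)
  then show "circlepath 0 1 \<in> borel_measurable (restrict_space lborel {0..1})"
    by (simp add: measurable_restrict_space1)
qed

section \<open>Fourier coefficients and the spaces \<open>\<A>\<^sub>\<eta>\<close>\<close>

lemma contour_integral_circle_L1_rel:
  assumes "circle_L1_rel f g"
  shows "contour_integral (circlepath 0 1) (\<lambda>z. f z * h z) = contour_integral (circlepath 0 1) (\<lambda>z. g z * h z)"
proof -
  have "AE z in circle_measure. f z = g z"
    using assms by (simp add: circle_L1_rel_def)
  then have "AE t in restrict_space lborel {0..1}. f (circlepath 0 1 t) = g (circlepath 0 1 t)"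
    unfolding circle_measure_def by (rule AE_distrD[OF circlepath_measurable])
  then have "AE t in lborel. t \<in> {0..1} \<longrightarrow> f (circlepath 0 1 t) = g (circlepath 0 1 t)"
    by (rule iffD1[OF AE_restrict_space_iff, rotated]) simp
  then obtain N where null: "N \<in> null_sets lborel"
    and N: "{t \<in> space lborel. \<not> (t \<in> {0..1} \<longrightarrow> f (circlepath 0 1 t) = g (circlepath 0 1 t))} \<subseteq> N"
    unfolding eventually_ae_filter by (elim bexE) (rule that)
  have neg: "negligible N"
    using null unfolding negligible_iff_null_sets by (rule null_sets_completionI)
  have "((\<lambda>z. f z * h z) has_contour_integral i) (circlepath 0 1) \<longleftrightarrow>
        ((\<lambda>z. g z * h z) has_contour_integral i) (circlepath 0 1)" for i
    unfolding has_contour_integral_def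
    by (rule has_integral_spike_eq[OF neg]) (use N in auto)
  then show ?thesis
    unfolding contour_integral_def contour_integrable_on_def by simp
qed

lift_definition fourier_coeff :: "circle_L1 \<Rightarrow> int \<Rightarrow> complex" is
  "\<lambda>f k. 1 / (2 * of_real pi * \<i>) * contour_integral (circlepath 0 1) (\<lambda>z. f z / z powi (k + 1))"
  unfolding divide_inverse by (intro ext arg_cong[OF contour_integral_circle_L1_rel])

definition fourier_norm :: "real \<Rightarrow> circle_L1 \<Rightarrow> ennreal" where
  "fourier_norm \<eta> f =
     (\<Sum>\<^sub>\<infinity>k\<in>UNIV. ennreal (exp (2 * pi * of_int \<bar>k\<bar> * \<eta>) * cmod (fourier_coeff f k)))"

definition fourier_space :: "real \<Rightarrow> circle_L1 set" where
  "fourier_space \<eta> = {f. fourier_norm \<eta> f < \<infinity>}"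

section \<open>Circle maps and transfer operators\<close>

text \<open>A circle map is a function on \<open>\<complex>\<close>, of which only the values on the circle matter here.
  The absolute derivative \<open>\<bar>T'\<bar>\<close> is taken along the circle; where \<open>T\<close> is holomorphic it is
  the modulus of the complex derivative.\<close>

definition circle_abs_deriv :: "(complex \<Rightarrow> complex) \<Rightarrow> complex \<Rightarrow> real" where
  "circle_abs_deriv T z = norm (vector_derivative (\<lambda>t. T (z * cis t)) (at 0))"

definition C1_circle_map :: "(complex \<Rightarrow> complex) \<Rightarrow> bool" where
  "C1_circle_map T \<longleftrightarrow>
     T \<in> sphere 0 1 \<rightarrow> sphere 0 1 \<and> (\<lambda>t. T (cis t)) C1_differentiable_on UNIV"

definition uniformly_expanding :: "(complex \<Rightarrow> complex) \<Rightarrow> bool" where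
  "uniformly_expanding T \<longleftrightarrow> C1_circle_map T \<and> (\<forall>z\<in>sphere 0 1. circle_abs_deriv T z > 1)"

text \<open>For uniformly expanding \<open>T\<close> the fibres are finite, \<open>T\<close> maps null sets to null sets,
  and the function below is integrable, so the class does not depend on the representative.\<close>

definition transfer_operator :: "(complex \<Rightarrow> complex) \<Rightarrow> circle_L1 \<Rightarrow> circle_L1" where
  "transfer_operator T \<phi> = abs_circle_L1
     (\<lambda>x. \<Sum>y\<in>{y \<in> sphere 0 1. T y = x}. rep_circle_L1 \<phi> y / of_real (circle_abs_deriv T y))"

definition galerkin_proj :: "nat \<Rightarrow> circle_L1 \<Rightarrow> circle_L1" where
  "galerkin_proj K f = abs_circle_L1 (\<lambda>z. \<Sum>k\<in>{- int K..int K}. fourier_coeff f k * z powi k)"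

definition galerkin_transfer :: "(complex \<Rightarrow> complex) \<Rightarrow> nat \<Rightarrow> circle_L1 \<Rightarrow> circle_L1" where
  "galerkin_transfer T K = galerkin_proj K \<circ> transfer_operator T \<circ> galerkin_proj K"

definition annulus :: "real \<Rightarrow> complex set" where
  "annulus r = {z. 1 / r < cmod z \<and> cmod z < r}"

section \<open>Spectral notions\<close>

text \<open>A normed space is given by a carrier \<open>V\<close> and a norm \<open>N\<close>, finite on \<open>V\<close>. The operator norm is
  \<open>\<infinity>\<close> for unbounded operators.\<close>

definition op_norm ::
    "circle_L1 set \<Rightarrow> (circle_L1 \<Rightarrow> ennreal) \<Rightarrow> (circle_L1 \<Rightarrow> ennreal) \<Rightarrow> (circle_L1 \<Rightarrow> circle_L1) \<Rightarrow> ennreal" where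
  "op_norm V N M B = (SUP f\<in>{f \<in> V. N f \<le> 1}. M (B f))"

definition boundedly_invertible ::
    "circle_L1 set \<Rightarrow> (circle_L1 \<Rightarrow> ennreal) \<Rightarrow> (circle_L1 \<Rightarrow> circle_L1) \<Rightarrow> bool" where
  "boundedly_invertible V N B \<longleftrightarrow> bij_betw B V V \<and> op_norm V N N (inv_into V B) < \<infinity>"

definition op_spectrum ::
    "circle_L1 set \<Rightarrow> (circle_L1 \<Rightarrow> ennreal) \<Rightarrow> (circle_L1 \<Rightarrow> circle_L1) \<Rightarrow> complex set" where
  "op_spectrum V N B = {z. \<not> boundedly_invertible V N (\<lambda>f. z *\<^sub>C f - B f)}"

definition pseudospectrum ::
    "real \<Rightarrow> circle_L1 set \<Rightarrow> (circle_L1 \<Rightarrow> ennreal) \<Rightarrow> (circle_L1 \<Rightarrow> circle_L1) \<Rightarrow> complex set" where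
  "pseudospectrum \<delta> V N B = op_spectrum V N B \<union>
     {z. boundedly_invertible V N (\<lambda>f. z *\<^sub>C f - B f) \<and>
         op_norm V N N (inv_into V (\<lambda>f. z *\<^sub>C f - B f)) \<ge> ennreal (1 / \<delta>)}"

definition eigenvalues :: "circle_L1 set \<Rightarrow> (circle_L1 \<Rightarrow> circle_L1) \<Rightarrow> complex set" where
  "eigenvalues V B = {z. \<exists>f\<in>V. f \<noteq> 0 \<and> B f = z *\<^sub>C f}"

definition gen_eigenspace :: "circle_L1 set \<Rightarrow> (circle_L1 \<Rightarrow> circle_L1) \<Rightarrow> complex \<Rightarrow> circle_L1 set" where
  "gen_eigenspace V B z = {f \<in> V. \<exists>n. ((\<lambda>g. z *\<^sub>C g - B g) ^^ n) f = 0}"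

text \<open>The library's dimension is 0 for infinite-dimensional spaces, hence the explicit \<open>\<infinity>\<close>;
  likewise for sums over infinite sets.\<close>

definition alg_mult :: "circle_L1 set \<Rightarrow> (circle_L1 \<Rightarrow> circle_L1) \<Rightarrow> complex \<Rightarrow> enat" where
  "alg_mult V B z =
     (if \<exists>F. finite F \<and> gen_eigenspace V B z \<subseteq> circle_L1.span F
      then enat (circle_L1.dim (gen_eigenspace V B z)) else \<infinity>)"

definition total_mult :: "circle_L1 set \<Rightarrow> (circle_L1 \<Rightarrow> circle_L1) \<Rightarrow> complex set \<Rightarrow> enat" where
  "total_mult V B S =
     (if finite (S \<inter> eigenvalues V B) then \<Sum>z\<in>S \<inter> eigenvalues V B. alg_mult V B z else \<infinity>)"

end

theory Submission
  imports Defs "Jordan_Normal_Form.Determinant"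
begin

text \<open>In weighted Fourier coordinates of \<open>\<A>\<^sub>\<alpha>\<close> the operators \<open>\<L>\<^sub>T\<close> and \<open>\<L>\<^sub>T\<^sub>,\<^sub>K\<close> are
  matrices with absolutely summable entries: by Schwarz reflection \<open>T\<close> maps one boundary circle of the
  annulus of radius \<open>exp (2 \<pi> \<eta>)\<close> into \<open>\<bar>w\<bar> \<ge> exp (2 \<pi> \<rho>)\<close> and the other one into
  \<open>\<bar>w\<bar> \<le> exp (- 2 \<pi> \<rho>)\<close>, so a contour shift bounds the integral of \<open>z\<^sup>n T(z)\<^sup>-\<^sup>k\<close> over the circle by
  \<open>exp (2 \<pi> \<eta> \<bar>n\<bar> - 2 \<pi> \<rho> \<bar>k\<bar>)\<close>. Hence the nonzero eigenvalues of such a matrix \<open>a\<close> are the zeros of the Fredholm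
  determinant of \<open>1 - a / z\<close>, and splitting off one eigenvector at a time shows that algebraic
  multiplicities are orders of zeros.

  Let \<open>\<L>\<^sub>s = \<L>\<^sub>T\<^sub>,\<^sub>K + s (\<L>\<^sub>T - \<L>\<^sub>T\<^sub>,\<^sub>K)\<close> with \<open>0 \<le> s \<le> 1\<close>. If \<open>\<L>\<^sub>s f = z f\<close> and \<open>\<bar>z\<bar> \<ge> \<rr>\<close>, then smoothing from
  \<open>\<A>\<^sub>\<eta>\<close> to \<open>\<A>\<^sub>\<alpha>\<close> and interpolation of \<open>\<A>\<^sub>\<eta>\<close> between \<open>\<A>\<^sub>0\<close> and \<open>\<A>\<^sub>\<alpha>\<close> bound the \<open>\<A>\<^sub>\<alpha>\<close> norm of \<open>f\<close> by \<open>r\<close> times its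
  \<open>\<A>\<^sub>0\<close> norm. So \<open>(z - \<L>\<^sub>T\<^sub>,\<^sub>K) f = s (\<L>\<^sub>T - \<L>\<^sub>T\<^sub>,\<^sub>K) f\<close> has \<open>\<A>\<^sub>0\<close> norm at most \<open>\<delta>\<close> times that of \<open>f\<close>, which puts \<open>z\<close>
  into the \<open>\<delta>\<close>-pseudospectrum. Therefore no determinant along the homotopy vanishes
  outside the regions enclosed by the curves, and by Rouche's theorem the number of zeros inside each
  \<open>\<gamma>\<^sub>j\<close> does not depend on \<open>s\<close>.\<close>

section \<open>Fourier coefficients on the circle\<close>

text \<open>The hypothesis lives on \<open>\<A>\<^sub>0\<close>, but the contour shift costs a
  factor \<open>exp (2 * pi * \<eta> * |n|)\<close>, so the entry bounds control \<L> only on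
  \<open>\<A>\<^sub>\<eta>\<close> and smoother spaces. The perturbation is small merely from
  \<open>\<A>\<^sub>\<alpha>\<close> to \<open>\<A>\<^sub>0\<close>, too weak for comparing
  resolvents by a Neumann series on one space. Eigenvectors, however, are smooth enough to pass
  between the two norms. Excluding eigenvalues gives no resolvent bound along the homotopy, which is
  why multiplicities are counted as zeros of a scalar holomorphic function. In \<open>r\<close>, the
  number \<open>1 + 2 / (exp (2 * pi * (\<rho> - \<alpha>)) - 1)\<close> is the sum of
  \<open>exp (- 2 * pi * |k| * (\<rho> - \<alpha>))\<close> over all integers, and the exponent
  inverts the interpolation exponent \<open>1 - \<eta> / \<alpha>\<close>. The weighted entries are
  summable over the column index by \<eta> < \<alpha> and over the row index by \<alpha> < \<rho>.
  On \<open>\<A>\<^sub>\<eta>\<close> the column estimate is lost, so the spectrum there is reached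
  from \<open>\<A>\<^sub>\<alpha>\<close> by smoothing.\<close>

lemma space_circle_measure [simp]: "space circle_measure = sphere 0 1"
  and sets_circle_measure: "sets circle_measure = sets (restrict_space borel (sphere 0 1))"
  by (simp_all add: circle_measure_def space_restrict_space)

lemma measurable_circle_measure [simp]:
  "f \<in> borel_measurable circle_measure \<longleftrightarrow> f \<in> borel_measurable (restrict_space borel (sphere 0 1))"
  by (rule iffI) (simp_all cong: measurable_cong_sets add: measurable_cong_sets[OF sets_circle_measure refl])

lemma integrable_circle_measure_iff:
  fixes f :: "complex \<Rightarrow> 'b::{banach, second_countable_topology}"
  assumes "f \<in> borel_measurable circle_measure"
  shows "integrable circle_measure f \<longleftrightarrow> set_integrable lborel {0..1} (\<lambda>t. f (circlepath 0 1 t))"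
  using assms unfolding circle_measure_def
  by (simp add: integrable_distr_eq[OF circlepath_measurable] integrable_restrict_space set_integrable_def)

lemma integral_circle_measure:
  fixes f :: "complex \<Rightarrow> 'b::{banach, second_countable_topology}"
  assumes "f \<in> borel_measurable circle_measure"
  shows "(\<integral>z. f z \<partial>circle_measure) = (LINT t:{0..1}|lborel. f (circlepath 0 1 t))"
  using assms unfolding circle_measure_def
  by (simp add: integral_distr[OF circlepath_measurable] integral_restrict_space set_lebesgue_integral_def)

interpretation circle_measure: finite_measure circle_measure
proof -
  have "finite_measure (restrict_space lborel {0..1::real})"
    by (rule finite_measureI) (simp add: space_restrict_space emeasure_restrict_space)
  then show "finite_measure circle_measure"
    unfolding circle_measure_def by (rule finite_measure.finite_measure_distr[OF _ circlepath_measurable])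
qed

lemma measurable_circle_continuous:
  assumes "continuous_on (sphere 0 1) f"
  shows "f \<in> borel_measurable circle_measure"
  using assms by (simp add: borel_measurable_continuous_on_restrict)

lemma integrable_mult_continuous:
  fixes f h :: "complex \<Rightarrow> complex"
  assumes f: "integrable circle_measure f" and h: "continuous_on (sphere 0 1) h"
  shows "integrable circle_measure (\<lambda>z. f z * h z)"
proof -
  have "compact (h ` sphere 0 1)" by (rule compact_continuous_image[OF h]) simp
  then obtain C where C: "\<And>z. z \<in> sphere 0 1 \<Longrightarrow> cmod (h z) \<le> C"
    using compact_imp_bounded bounded_iff by (metis imageI)
  show ?thesis
  proof (rule Bochner_Integration.integrable_bound)
    show "integrable circle_measure (\<lambda>z. of_real C * f z)" using f by simp
    show "(\<lambda>z. f z * h z) \<in> borel_measurable circle_measure"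
      using borel_measurable_integrable[OF f] measurable_circle_continuous[OF h]
      by (rule borel_measurable_times)
    show "AE z in circle_measure. cmod (f z * h z) \<le> cmod (of_real C * f z)"
    proof (rule AE_I2)
      fix z assume "z \<in> space circle_measure"
      then have "cmod (h z) \<le> \<bar>C\<bar>" using C[of z] by simp
      then show "cmod (f z * h z) \<le> cmod (of_real C * f z)"
        using mult_left_mono[of "cmod (h z)" "\<bar>C\<bar>" "cmod (f z)"] by (simp add: norm_mult mult.commute)
    qed
  qed
qed

lemma integrable_circle_continuous:
  fixes h :: "complex \<Rightarrow> complex"
  assumes "continuous_on (sphere 0 1) h" shows "integrable circle_measure h"
  using integrable_mult_continuous[OF _ assms, of "\<lambda>_. 1"] by simp

lemma continuous_on_circle_powi: "continuous_on (sphere 0 1) (\<lambda>z::complex. z powi k)"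
  by (intro continuous_intros) auto

text \<open>The functions \<open>g\<close> by which one may multiply without leaving the annihilator of \<open>f\<close> form a ring, so
  the Stone--Weierstrass theorem applies to them without any discussion of trigonometric polynomials.\<close>

lemma integral_continuous_eq_0:
  fixes f :: "complex \<Rightarrow> complex" and g :: "complex \<Rightarrow> real"
  assumes f: "integrable circle_measure f" and zero: "\<And>k::int. (\<integral>z. f z * z powi k \<partial>circle_measure) = 0"
    and g: "continuous_on (sphere 0 1) g"
  shows "(\<integral>z. f z * of_real (g z) \<partial>circle_measure) = 0"
proof -
  \<comment> \<open>\<open>P\<close> demands that all moments of \<open>f * h\<close> vanish, not
    just one, which makes it stable under multiplication by powers of \<open>z\<close>. Since
    \<open>cnj z\<close> is \<open>z powi (- 1)\<close> on the circle, \<open>Re\<close> and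
    \<open>Im\<close> then belong to the multipliers \<open>R\<close>, and they separate
    points.\<close>
  define P where "P h \<longleftrightarrow> continuous_on (sphere 0 1) h \<and> (\<forall>k::int. (\<integral>z. f z * h z * z powi k \<partial>circle_measure) = 0)"
    for h :: "complex \<Rightarrow> complex"
  define R where "R u \<longleftrightarrow> continuous_on (sphere 0 1) u \<and> (\<forall>h. P h \<longrightarrow> P (\<lambda>z. of_real (u z) * h z))"
    for u :: "complex \<Rightarrow> real"
  have int: "integrable circle_measure (\<lambda>z. f z * h z * z powi k)" if "continuous_on (sphere 0 1) h" for h and k :: int
    using integrable_mult_continuous[OF integrable_mult_continuous[OF f that] continuous_on_circle_powi] .
  have Padd: "P (\<lambda>z. h z + h' z)" if "P h" "P h'" for h h'
    using that int[of h] int[of h'] unfolding P_def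
    by (auto simp: distrib_left distrib_right intro!: continuous_intros)
  have Pscale: "P (\<lambda>z. c * h z)" if "P h" for h c
  proof -
    have "(\<integral>z. f z * (c * h z) * z powi k \<partial>circle_measure) = c * (\<integral>z. f z * h z * z powi k \<partial>circle_measure)" for k :: int
      by (subst Bochner_Integration.integral_mult_right_zero[symmetric]) (simp add: mult_ac)
    then show ?thesis using that unfolding P_def by (auto intro!: continuous_intros)
  qed
  have Pcong: "P h'" if "P h" "\<And>z. z \<in> sphere 0 1 \<Longrightarrow> h z = h' z" for h h'
  proof -
    have "(\<integral>z. f z * h' z * z powi k \<partial>circle_measure) = (\<integral>z. f z * h z * z powi k \<partial>circle_measure)" for k :: int
      by (rule Bochner_Integration.integral_cong) (use that(2) in auto)
    moreover have "continuous_on (sphere 0 1) h'"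
      using that continuous_on_cong[of "sphere 0 1" "sphere 0 1" h h'] unfolding P_def by auto
    ultimately show ?thesis using that(1) unfolding P_def by auto
  qed
  have Pshift: "P (\<lambda>z. z powi j * h z)" if "P h" for h and j :: int
    unfolding P_def
  proof (intro conjI allI)
    show "continuous_on (sphere 0 1) (\<lambda>z. z powi j * h z)"
      using that continuous_on_circle_powi unfolding P_def by (intro continuous_on_mult) auto
    fix k :: int
    have "(\<integral>z. f z * (z powi j * h z) * z powi k \<partial>circle_measure) = (\<integral>z. f z * h z * z powi (j + k) \<partial>circle_measure)"
    proof (rule Bochner_Integration.integral_cong)
      fix z assume "z \<in> space circle_measure"
      then have "z \<noteq> 0" by auto
      then show "f z * (z powi j * h z) * z powi k = f z * h z * z powi (j + k)"
        by (simp add: power_int_add mult_ac)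
    qed simp
    then show "(\<integral>z. f z * (z powi j * h z) * z powi k \<partial>circle_measure) = 0"
      using that unfolding P_def by simp
  qed
  have cnj: "cnj z = z powi (- 1)" if "z \<in> sphere 0 1" for z
  proof -
    have "z \<noteq> 0" using that by auto
    moreover have "cnj z * z = 1"
      using that complex_norm_square[of z] by (simp add: mult.commute)
    ultimately show ?thesis by (simp add: power_int_minus field_simps)
  qed
  have RRe: "R Re"
    unfolding R_def
  proof (intro conjI allI impI)
    fix h assume h: "P h"
    have "P (\<lambda>z. (1/2) * (z powi 1 * h z + z powi (- 1) * h z))"
      by (intro Pscale Padd Pshift h)
    then show "P (\<lambda>z. of_real (Re z) * h z)"
    proof (rule Pcong)
      fix z assume z: "z \<in> sphere (0::complex) 1"
      have "(1/2) * (z + cnj z) = of_real (Re z)" by (simp add: complex_add_cnj)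
      then show "(1/2) * (z powi 1 * h z + z powi (- 1) * h z) = of_real (Re z) * h z"
        unfolding cnj[OF z, symmetric] by (simp flip: distrib_right)
    qed
  qed (intro continuous_intros)
  have RIm: "R Im"
    unfolding R_def
  proof (intro conjI allI impI)
    fix h assume h: "P h"
    have "P (\<lambda>z. (- \<i>/2) * (z powi 1 * h z + (-1) * (z powi (- 1) * h z)))"
      by (intro Pscale Padd Pshift h)
    then show "P (\<lambda>z. of_real (Im z) * h z)"
    proof (rule Pcong)
      fix z assume z: "z \<in> sphere (0::complex) 1"
      have "(- \<i>/2) * (z - cnj z) = of_real (Im z)" by (simp add: complex_eq_iff)
      then have eq: "of_real (Im z) * h z = (- \<i>/2) * (z - cnj z) * h z" by (simp only:)
      have e2: "z * h z + (-1) * (cnj z * h z) = (z - cnj z) * h z" by (simp add: algebra_simps)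
      show "(- \<i>/2) * (z powi 1 * h z + (-1) * (z powi (- 1) * h z)) = of_real (Im z) * h z"
        unfolding cnj[OF z, symmetric] power_int_1_right e2 eq by (simp only: mult.assoc)
    qed
  qed (intro continuous_intros)
  have P1: "P (\<lambda>_. 1)" using zero by (simp add: P_def)
  have Rint: "(\<integral>z. f z * of_real (u z) \<partial>circle_measure) = 0" if "R u" for u
  proof -
    have Ru: "\<And>h. P h \<Longrightarrow> P (\<lambda>z. complex_of_real (u z) * h z)" using that unfolding R_def by blast
    have "\<And>k::int. (\<integral>z. f z * (complex_of_real (u z) * 1) * z powi k \<partial>circle_measure) = 0"
      using Ru[OF P1] unfolding P_def by simp
    from this[of 0] show ?thesis by simp
  qed
  have approx: "\<exists>u. R u \<and> (\<forall>z\<in>sphere 0 1. \<bar>g z - u z\<bar> < e)" if "e > 0" for e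
  proof (rule Stone_Weierstrass_HOL[where P = R])
    show "R (\<lambda>_. c)" for c using Pscale[of _ "of_real c"] by (simp add: R_def)
    show "R (\<lambda>z. u z + v z)" if "R u \<and> R v" for u v
      using that Padd unfolding R_def by (auto simp: distrib_right intro!: continuous_intros)
    show "R (\<lambda>z. u z * v z)" if "R u \<and> R v" for u v
      using that unfolding R_def by (auto simp: mult.assoc intro!: continuous_intros)
    show "\<exists>f. R f \<and> f x \<noteq> f y" if "x \<in> sphere 0 1 \<and> y \<in> sphere 0 1 \<and> x \<noteq> y" for x y
    proof (cases "Re x = Re y")
      case True
      then have "Im x \<noteq> Im y" using that by (simp add: complex_eq_iff)
      then show ?thesis using RIm by (intro exI[of _ Im]) simp
    next
      case False
      then show ?thesis using RRe by (intro exI[of _ Re]) simp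
    qed
  qed (use g that in \<open>auto simp: R_def\<close>)
  define I where "I = (\<integral>z. cmod (f z) \<partial>circle_measure)"
  have I0: "I \<ge> 0" by (simp add: I_def)
  have small: "cmod (\<integral>z. f z * of_real (g z) \<partial>circle_measure) \<le> e * I" if e: "e > 0" for e
  proof -
    obtain u where u: "R u" "\<And>z. z \<in> sphere 0 1 \<Longrightarrow> \<bar>g z - u z\<bar> < e" using approx[OF e] by blast
    have uc: "continuous_on (sphere 0 1) u" using u(1) by (simp add: R_def)
    have i1: "integrable circle_measure (\<lambda>z. f z * of_real (g z))" "integrable circle_measure (\<lambda>z. f z * of_real (u z))"
      by (intro integrable_mult_continuous[OF f] continuous_intros g uc)+
    have "(\<integral>z. f z * of_real (g z) \<partial>circle_measure) = (\<integral>z. f z * of_real (g z) - f z * of_real (u z) \<partial>circle_measure)"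
      using Rint[OF u(1)] i1 by simp
    also have "cmod \<dots> \<le> (\<integral>z. e * cmod (f z) \<partial>circle_measure)"
    proof (rule order_trans[OF Bochner_Integration.integral_norm_bound Bochner_Integration.integral_mono])
      show "integrable circle_measure (\<lambda>z. cmod (f z * of_real (g z) - f z * of_real (u z)))" using i1 by simp
      show "integrable circle_measure (\<lambda>z. e * cmod (f z))" using f by simp
      fix z assume "z \<in> space circle_measure"
      then have "\<bar>g z - u z\<bar> \<le> e" using u(2)[of z] by simp
      moreover have "f z * of_real (g z) - f z * of_real (u z) = f z * of_real (g z - u z)"
        by (simp add: algebra_simps)
      ultimately show "cmod (f z * of_real (g z) - f z * of_real (u z)) \<le> e * cmod (f z)"
        by (simp only: norm_mult norm_of_real mult.commute[of e] mult_left_mono norm_ge_zero)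
    qed
    finally show ?thesis by (simp add: I_def)
  qed
  have "cmod (\<integral>z. f z * of_real (g z) \<partial>circle_measure) \<le> 0 + e" if e: "e > 0" for e
  proof -
    \<comment> \<open>The denominator \<open>I + 1\<close> instead of \<open>I\<close> covers the
      case that \<open>f\<close> vanishes almost everywhere.\<close>
    have "e / (I + 1) * I \<le> e" using e I0 by (simp add: field_simps)
    then show ?thesis using small[of "e / (I + 1)"] e I0 by simp
  qed
  then have "cmod (\<integral>z. f z * of_real (g z) \<partial>circle_measure) \<le> 0" by (rule field_le_epsilon)
  then show ?thesis by simp
qed

text \<open>Integrals of \<open>f\<close> against continuous functions vanish, hence also those over
  closed sets, by dominated convergence with the cutoffs \<open>\<phi>\<close>. Closed sets form an
  intersection-stable generator of the Borel sets, so Dynkin's argument reaches every measurable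
  set, and \<open>f\<close> and 0 are densities of the same measure. Through this result, equality
  in \<open>circle_L1\<close> becomes equality of Fourier coefficients.\<close>

lemma circle_fourier_uniqueness:
  fixes f :: "complex \<Rightarrow> complex"
  assumes f: "integrable circle_measure f" and zero: "\<And>k::int. (\<integral>z. f z * z powi k \<partial>circle_measure) = 0"
  shows "AE z in circle_measure. f z = 0"
proof -
  let ?M = circle_measure
  let ?S = "sphere (0::complex) 1"
  define E where "E = ((\<inter>) ?S) ` Collect closed"
  have sets: "sets ?M = sigma_sets ?S E"
  proof -
    have "sets ?M = (\<inter>) ?S ` sigma_sets UNIV (Collect closed)"
      unfolding sets_circle_measure sets_restrict_space borel_eq_closed by simp
    also have "\<dots> = sigma_sets ?S E"
      unfolding E_def by (rule sigma_sets_Int) auto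
    finally show ?thesis .
  qed
  have closed_zero: "(LINT z:?S \<inter> C|?M. f z) = 0" if C: "closed C" for C
  \<comment> \<open>The empty set is separate because \<open>infdist\<close> to it is 0 by
    convention, which would make the cutoffs constantly 1.\<close>
  proof (cases "C = {}")
    case False
    define \<phi> where "\<phi> n z = max 0 (1 - real n * infdist z C)" for n and z :: complex
    have meas: "?S \<inter> C \<in> sets ?M"
      unfolding sets_circle_measure sets_restrict_space using C by auto
    have "(\<lambda>n. \<integral>z. f z * of_real (\<phi> n z) \<partial>?M) \<longlonglongrightarrow> (\<integral>z. indicator (?S \<inter> C) z *\<^sub>R f z \<partial>?M)"
    proof (rule integral_dominated_convergence[where w = "\<lambda>z. cmod (f z)"])
      show "(\<lambda>z. indicator (?S \<inter> C) z *\<^sub>R f z) \<in> borel_measurable ?M"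
        using borel_measurable_indicator[OF meas] borel_measurable_integrable[OF f] by (rule borel_measurable_scaleR)
      have phic: "continuous_on ?S (\<lambda>z. complex_of_real (\<phi> n z))" for n
        unfolding \<phi>_def by (intro continuous_intros)
      show "(\<lambda>z. f z * of_real (\<phi> n z)) \<in> borel_measurable ?M" for n
        by (rule borel_measurable_integrable[OF integrable_mult_continuous[OF f phic]])
      show "integrable ?M (\<lambda>z. cmod (f z))" using f by simp
      show "AE z in ?M. (\<lambda>n. f z * of_real (\<phi> n z)) \<longlonglongrightarrow> indicator (?S \<inter> C) z *\<^sub>R f z"
      proof (rule AE_I2)
        fix z assume z: "z \<in> space ?M"
        have "(\<lambda>n. \<phi> n z) \<longlonglongrightarrow> indicator (?S \<inter> C) z"
        proof (cases "z \<in> C")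
          case True
          then have "\<phi> n z = 1" for n by (simp add: \<phi>_def)
          then show ?thesis using True z by simp
        next
          case nC: False
          then have d: "infdist z C > 0"
            using in_closed_iff_infdist_zero[OF C False, of z] infdist_nonneg[of z C] by linarith
          obtain N where N: "1 / infdist z C < real N" using reals_Archimedean2 by blast
          have "\<phi> n z = 0" if "n \<ge> N" for n
          proof -
            have "1 < real N * infdist z C" using N d by (simp add: field_simps)
            also have "\<dots> \<le> real n * infdist z C" using that d by (simp add: mult_right_mono)
            finally show ?thesis by (simp add: \<phi>_def)
          qed
          then have "(\<lambda>n. \<phi> n z) \<longlonglongrightarrow> 0"
            by (intro tendsto_eventually eventually_sequentiallyI[of N]) auto
          then show ?thesis using nC by simp
        qed
        then have "(\<lambda>n. f z * of_real (\<phi> n z)) \<longlonglongrightarrow> f z * of_real (indicator (?S \<inter> C) z)"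
          by (intro tendsto_intros)
        then show "(\<lambda>n. f z * of_real (\<phi> n z)) \<longlonglongrightarrow> indicator (?S \<inter> C) z *\<^sub>R f z"
          by (simp add: scaleR_conv_of_real mult.commute)
      qed
      show "AE z in ?M. cmod (f z * of_real (\<phi> n z)) \<le> cmod (f z)" for n
      proof (rule AE_I2)
        fix z
        have "0 \<le> \<phi> n z" "\<phi> n z \<le> 1" by (auto simp: \<phi>_def infdist_nonneg)
        then show "cmod (f z * of_real (\<phi> n z)) \<le> cmod (f z)" by (simp add: norm_mult mult_left_le)
      qed
    qed
    moreover have "(\<integral>z. f z * of_real (\<phi> n z) \<partial>?M) = 0" for n
      by (rule integral_continuous_eq_0[OF f zero]) (auto simp: \<phi>_def intro!: continuous_intros)
    ultimately have "(\<lambda>n. 0) \<longlonglongrightarrow> (\<integral>z. indicator (?S \<inter> C) z *\<^sub>R f z \<partial>?M)" by simp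
    then show ?thesis unfolding set_lebesgue_integral_def tendsto_const_iff[OF sequentially_bot] by simp
  qed (simp add: set_lebesgue_integral_def)
  have fS: "set_integrable ?M A f" if "A \<in> sets ?M" for A
    unfolding set_integrable_def using f that by (rule integrable_mult_indicator[rotated])
  have tot: "(\<integral>z. f z \<partial>?M) = 0" using zero[of 0] by simp
  have all: "(LINT z:A|?M. f z) = 0" if "A \<in> sigma_sets ?S E" for A
    using _ _ that
  proof (rule sigma_sets_induct_disjoint)
    show "Int_stable E" unfolding Int_stable_def E_def
    proof safe
      fix C D :: "complex set" assume "closed C" "closed D"
      then have "?S \<inter> C \<inter> (?S \<inter> D) = ?S \<inter> (C \<inter> D)" "closed (C \<inter> D)" by auto
      then show "?S \<inter> C \<inter> (?S \<inter> D) \<in> (\<inter>) ?S ` Collect closed" by blast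
    qed
    show "E \<subseteq> Pow ?S" by (auto simp: E_def)
    show "(LINT z:A|?M. f z) = 0" if "A \<in> E" for A using that closed_zero by (auto simp: E_def)
    show "(LINT z:{}|?M. f z) = 0" by (simp add: set_lebesgue_integral_def)
    show "(LINT z:?S - A|?M. f z) = 0" if "A \<in> sigma_sets ?S E" "(LINT z:A|?M. f z) = 0" for A
    proof -
      have A: "A \<in> sets ?M" using that(1) sets by simp
      then have SA: "?S - A \<in> sets ?M" using sets.compl_sets[OF A] by simp
      have "(LINT z:A \<union> (?S - A)|?M. f z) = (LINT z:A|?M. f z) + (LINT z:?S - A|?M. f z)"
        by (rule set_integral_Un[OF _ fS[OF A] fS[OF SA]]) auto
      moreover have "A \<subseteq> ?S" using sets.sets_into_space[OF A] by simp
      then have "A \<union> (?S - A) = space ?M" unfolding Un_Diff_cancel space_circle_measure by (rule Un_absorb1)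
      then have "(LINT z:A \<union> (?S - A)|?M. f z) = 0"
        using tot set_integral_space[OF f] by simp
      ultimately show ?thesis using that(2) by simp
    qed
    show "(LINT z:(\<Union>i. A i)|?M. f z) = 0" if A: "disjoint_family A" "range A \<subseteq> sigma_sets ?S E"
      "\<And>i. (LINT z:A i|?M. f z) = 0" for A :: "nat \<Rightarrow> complex set"
    proof -
      have As: "A i \<in> sets ?M" for i using A(2) sets by auto
      have "(LINT z:(\<Union>i. A i)|?M. f z) = (\<Sum>i. (LINT z:A i|?M. f z))"
        by (rule lebesgue_integral_countable_add[OF As])
           (use A(1) fS As in \<open>auto simp: disjoint_family_on_def\<close>)
      then show ?thesis using A(3) by simp
    qed
  qed
  show ?thesis
    by (rule circle_measure.density_unique_banach[of f "\<lambda>_. 0"]) (use f all sets in \<open>auto simp: set_lebesgue_integral_def\<close>)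
qed

text \<open>The derivative of the parametrised circle is \<open>2 * of_real pi * \<i>\<close> times
  the point itself, so division by \<open>z\<close> leaves the plain average over the parameter.
  This links the contour integrals in \<open>fourier_coeff\<close> with the measure behind
  \<open>circle_L1\<close>.\<close>

lemma contour_integral_circle:
  assumes g: "integrable circle_measure g"
  shows "1 / (2 * of_real pi * \<i>) * contour_integral (circlepath 0 1) (\<lambda>z. g z / z) = (\<integral>z. g z \<partial>circle_measure)"
proof -
  have m: "g \<in> borel_measurable circle_measure" by (rule borel_measurable_integrable[OF g])
  have "contour_integral (circlepath 0 1) (\<lambda>z. g z / z) =
     integral {0..1} (\<lambda>t. g (circlepath 0 1 t) / circlepath 0 1 t * vector_derivative (circlepath 0 1) (at t))"
    by (rule contour_integral_integral)
  also have "\<dots> = integral {0..1} (\<lambda>t. g (circlepath 0 1 t) * (2 * of_real pi * \<i>))"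
  proof (rule Henstock_Kurzweil_Integration.integral_cong)
    fix t :: real
    have "circlepath 0 1 t \<noteq> 0" "vector_derivative (circlepath 0 1) (at t) = 2 * of_real pi * \<i> * circlepath 0 1 t"
      unfolding vector_derivative_circlepath by (simp_all add: circlepath)
    then show "g (circlepath 0 1 t) / circlepath 0 1 t * vector_derivative (circlepath 0 1) (at t) =
        g (circlepath 0 1 t) * (2 * of_real pi * \<i>)"
      by simp
  qed
  also have "\<dots> = integral {0..1} (\<lambda>t. g (circlepath 0 1 t)) * (2 * of_real pi * \<i>)"
    by (rule integral_mult_left)
  also have "integral {0..1} (\<lambda>t. g (circlepath 0 1 t)) = (\<integral>z. g z \<partial>circle_measure)"
    using set_borel_integral_eq_integral(2)[OF iffD1[OF integrable_circle_measure_iff[OF m] g]]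
    unfolding integral_circle_measure[OF m] by simp
  finally show ?thesis by simp
qed

lemma circle_L1_rel_refl: "integrable circle_measure f \<Longrightarrow> circle_L1_rel f f"
  by (simp add: circle_L1_rel_def)

lemma fourier_coeff_abs:
  assumes f: "integrable circle_measure f"
  shows "fourier_coeff (abs_circle_L1 f) k = (\<integral>z. f z * z powi (- k) \<partial>circle_measure)"
proof -
  have "contour_integral (circlepath 0 1) (\<lambda>z. f z / z powi (k + 1)) =
      contour_integral (circlepath 0 1) (\<lambda>z. f z * z powi (- k) / z)"
  proof (rule contour_integral_cong)
    fix z assume "z \<in> path_image (circlepath 0 (1::real))"
    then have "z \<noteq> 0" by (auto simp: path_image_circlepath)
    then show "f z / z powi (k + 1) = f z * z powi (- k) / z"
      by (simp add: power_int_add power_int_minus field_simps)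
  qed simp
  then show ?thesis
    unfolding fourier_coeff.abs_eq[OF circle_L1_rel_refl[OF f]]
    using contour_integral_circle[OF integrable_mult_continuous[OF f continuous_on_circle_powi]] by (simp only:)
qed

lemma rep_circle_L1:
  "integrable circle_measure (rep_circle_L1 f)" "abs_circle_L1 (rep_circle_L1 f) = f"
  using Quotient3_rep_reflp[OF Quotient3_circle_L1, of f] Quotient3_abs_rep[OF Quotient3_circle_L1, of f]
  by (auto simp: circle_L1_rel_def)

lemma rep_abs_circle_L1:
  assumes "integrable circle_measure f"
  shows "AE z in circle_measure. rep_circle_L1 (abs_circle_L1 f) z = f z"
proof -
  have "circle_L1_rel (rep_circle_L1 (abs_circle_L1 f)) f"
    using Quotient3_rel[OF Quotient3_circle_L1, of "rep_circle_L1 (abs_circle_L1 f)" f]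
    by (simp add: rep_circle_L1 circle_L1_rel_refl assms)
  then show ?thesis by (simp add: circle_L1_rel_def)
qed

lemma abs_circle_L1_eqI:
  assumes "integrable circle_measure f" "integrable circle_measure g" "AE z in circle_measure. f z = g z"
  shows "abs_circle_L1 f = abs_circle_L1 g"
  using Quotient3_rel_abs[OF Quotient3_circle_L1] assms by (simp add: circle_L1_rel_def)

lemma fourier_coeff_eq: "fourier_coeff f k = (\<integral>z. rep_circle_L1 f z * z powi (- k) \<partial>circle_measure)"
  using fourier_coeff_abs[OF rep_circle_L1(1)[of f]] by (simp add: rep_circle_L1(2))

lemma circle_L1_eqI:
  assumes "\<And>k. fourier_coeff f k = fourier_coeff g k"
  shows "f = g"
proof -
  let ?f = "rep_circle_L1 f" and ?g = "rep_circle_L1 g"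
  have d: "integrable circle_measure (\<lambda>z. ?f z - ?g z)" by (simp add: rep_circle_L1)
  have "(\<integral>z. (?f z - ?g z) * z powi k \<partial>circle_measure) = 0" for k :: int
  proof -
    have "(\<integral>z. (?f z - ?g z) * z powi k \<partial>circle_measure) = fourier_coeff f (- k) - fourier_coeff g (- k)"
      unfolding fourier_coeff_eq
      using integrable_mult_continuous[OF rep_circle_L1(1)[of f] continuous_on_circle_powi[of k]]
        integrable_mult_continuous[OF rep_circle_L1(1)[of g] continuous_on_circle_powi[of k]]
      by (simp add: left_diff_distrib)
    then show ?thesis using assms by simp
  qed
  then have "AE z in circle_measure. ?f z - ?g z = 0"
    by (rule circle_fourier_uniqueness[OF d])
  then have "AE z in circle_measure. ?f z = ?g z" by simp
  then have "abs_circle_L1 ?f = abs_circle_L1 ?g"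
    by (intro abs_circle_L1_eqI rep_circle_L1)
  then show ?thesis by (simp add: rep_circle_L1)
qed

lemma plus_circle_L1_abs:
  "integrable circle_measure f \<Longrightarrow> integrable circle_measure g \<Longrightarrow>
    abs_circle_L1 f + abs_circle_L1 g = abs_circle_L1 (\<lambda>z. f z + g z)"
  by (intro plus_circle_L1.abs_eq circle_L1_rel_refl)

lemma fourier_coeff_add: "fourier_coeff (f + g) k = fourier_coeff f k + fourier_coeff g k"
proof -
  have "fourier_coeff (abs_circle_L1 (rep_circle_L1 f) + abs_circle_L1 (rep_circle_L1 g)) k
     = fourier_coeff f k + fourier_coeff g k"
    unfolding plus_circle_L1_abs[OF rep_circle_L1(1) rep_circle_L1(1)]
    by (subst fourier_coeff_abs)
       (simp_all add: rep_circle_L1 fourier_coeff_eq distrib_right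
          integrable_mult_continuous[OF rep_circle_L1(1) continuous_on_circle_powi])
  then show ?thesis by (simp add: rep_circle_L1)
qed

lemma fourier_coeff_scaleC: "fourier_coeff (c *\<^sub>C f) k = c * fourier_coeff f k"
proof -
  have "c *\<^sub>C abs_circle_L1 (rep_circle_L1 f) = abs_circle_L1 (\<lambda>z. c * rep_circle_L1 f z)"
    by (rule scaleC.abs_eq[OF circle_L1_rel_refl[OF rep_circle_L1(1)]])
  then have "fourier_coeff (c *\<^sub>C f) k = fourier_coeff (abs_circle_L1 (\<lambda>z. c * rep_circle_L1 f z)) k"
    by (simp add: rep_circle_L1)
  also have "\<dots> = c * fourier_coeff f k"
    by (subst fourier_coeff_abs) (simp_all add: rep_circle_L1 fourier_coeff_eq mult.assoc)
  finally show ?thesis .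
qed

lemma fourier_coeff_0: "fourier_coeff 0 k = 0"
  using fourier_coeff_scaleC[of 0 0 k] by simp

lemma fourier_coeff_diff: "fourier_coeff (f - g) k = fourier_coeff f k - fourier_coeff g k"
  using fourier_coeff_add[of "f - g" g k] by simp

lemma integral_circle_powi: "(\<integral>z. z powi k \<partial>circle_measure) = (if k = 0 then 1 else (0::complex))"
proof -
  have "(\<integral>z. z powi k \<partial>circle_measure) =
    1 / (2 * of_real pi * \<i>) * contour_integral (circlepath 0 1) (\<lambda>z. z powi k / z)"
    by (rule contour_integral_circle[symmetric]) (intro integrable_circle_continuous continuous_on_circle_powi)
  also have "contour_integral (circlepath 0 1) (\<lambda>z. z powi k / z) = (if k = 0 then 2 * of_real pi * \<i> else 0)"
  proof (cases "k = 0")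
    case True
    have "((\<lambda>z. 1 / (z - 0)) has_contour_integral (2 * of_real pi * \<i> * 1)) (circlepath 0 1)"
      using Cauchy_integral_circlepath_simple[of "\<lambda>_. 1" 0 1 0] by simp
    then show ?thesis using True contour_integral_unique by simp
  next
    case False
    have "((\<lambda>z. z powi k / z) has_contour_integral 0) (circlepath 0 1)"
    proof (rule Cauchy_theorem_primitive)
      fix z :: complex assume "z \<in> sphere 0 1"
      then have z: "z \<noteq> 0" by auto
      have "((\<lambda>z. z powi k / of_int k) has_field_derivative (of_int k * z powi (k - 1) * 1) / of_int k) (at z within sphere 0 1)"
        by (intro DERIV_cdivide DERIV_power_int DERIV_ident) (simp add: z)
      then show "((\<lambda>z. z powi k / of_int k) has_field_derivative z powi k / z) (at z within sphere 0 1)"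
        using False z by (simp add: power_int_diff)
    qed (auto simp: path_image_circlepath)
    then show ?thesis using False contour_integral_unique by simp
  qed
  finally show ?thesis by simp
qed

text \<open>Allows an unordered sum over the integers to be read as the limit of its symmetric
  partial sums, a sequence to which dominated convergence applies.\<close>

lemma int_intervals_cofinal:
  "filterlim (\<lambda>N. {- int N..int N}) (finite_subsets_at_top UNIV) sequentially"
  unfolding filterlim_finite_subsets_at_top
proof safe
  fix X :: "int set" assume X: "finite X"
  define m where "m = Max (insert 0 ((\<lambda>k. nat \<bar>k\<bar>) ` X))"
  have m: "nat \<bar>k\<bar> \<le> m" if "k \<in> X" for k
    unfolding m_def using X that by (intro Max_ge) auto
  show "\<forall>\<^sub>F N in sequentially. finite {- int N..int N} \<and> X \<subseteq> {- int N..int N} \<and> {- int N..int N} \<subseteq> UNIV"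
    using eventually_ge_at_top[of m]
  proof eventually_elim
    case (elim N)
    have "k \<in> {- int N..int N}" if "k \<in> X" for k using m[OF that] elim by auto
    then show ?case by auto
  qed
qed

section \<open>Absolutely convergent Fourier series\<close>

definition fourier_series :: "(int \<Rightarrow> complex) \<Rightarrow> complex \<Rightarrow> complex" where
  "fourier_series c z = (\<Sum>\<^sub>\<infinity>k. c k * z powi k)"

text \<open>The four facts share the partial sums \<open>s N\<close>. These are continuous on the
  circle and bounded by the sum of the \<open>cmod (c k)\<close>, a constant that is integrable
  because the circle has finite measure and that dominates the passage to the limit.\<close>

lemma fourier_series_aux:
  assumes c: "(\<lambda>k. cmod (c k)) summable_on UNIV"
  defines "s \<equiv> \<lambda>N z. \<Sum>k\<in>{- int N..int N}. c k * z powi k"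
  shows "z \<in> sphere 0 1 \<Longrightarrow> (\<lambda>N. s N z) \<longlonglongrightarrow> fourier_series c z"
    and "z \<in> sphere 0 1 \<Longrightarrow> cmod (s N z) \<le> (\<Sum>\<^sub>\<infinity>k. cmod (c k))"
    and "integrable circle_measure (fourier_series c)"
    and "continuous_on (sphere 0 1) h \<Longrightarrow>
      (\<lambda>N. \<integral>z. s N z * h z \<partial>circle_measure) \<longlonglongrightarrow> (\<integral>z. fourier_series c z * h z \<partial>circle_measure)"
proof -
  define C where "C = (\<Sum>\<^sub>\<infinity>k. cmod (c k))"
  have C0: "C \<ge> 0" by (simp add: C_def infsum_nonneg)
  have nz: "cmod (c k * z powi k) = cmod (c k)" if "z \<in> sphere 0 1" for z k
    using that by (simp add: norm_mult norm_power_int)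
  show lim: "(\<lambda>N. s N z) \<longlonglongrightarrow> fourier_series c z" if z: "z \<in> sphere 0 1" for z
  proof -
    have "(\<lambda>k. cmod (c k * z powi k)) summable_on UNIV" using c by (simp only: nz[OF z])
    then have "(\<lambda>k. c k * z powi k) summable_on UNIV" by (rule Infinite_Sum.abs_summable_summable)
    from filterlim_compose[OF infsum_tendsto[OF this] int_intervals_cofinal]
    show ?thesis unfolding s_def fourier_series_def .
  qed
  show bd: "cmod (s N z) \<le> (\<Sum>\<^sub>\<infinity>k. cmod (c k))" if z: "z \<in> sphere 0 1" for z N
  proof -
    have "cmod (s N z) \<le> (\<Sum>k\<in>{- int N..int N}. cmod (c k))"
      unfolding s_def by (rule order_trans[OF norm_sum]) (simp only: nz[OF z] order_refl)
    also have "\<dots> \<le> C" unfolding C_def by (rule finite_sum_le_infsum[OF c]) auto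
    finally show ?thesis unfolding C_def .
  qed
  have sc: "continuous_on (sphere 0 1) (s N)" for N
    unfolding s_def by (intro continuous_intros continuous_on_circle_powi)
  have sm: "s N \<in> borel_measurable circle_measure" for N
    by (rule measurable_circle_continuous[OF sc])
  have fm: "fourier_series c \<in> borel_measurable circle_measure"
    by (rule borel_measurable_LIMSEQ_metric[OF sm]) (use lim in simp)
  have fbd: "cmod (fourier_series c z) \<le> C" if z: "z \<in> sphere 0 1" for z
    unfolding C_def by (rule LIMSEQ_le_const2[OF tendsto_norm[OF lim[OF z]]]) (use bd[OF z] in auto)
  show fi: "integrable circle_measure (fourier_series c)"
    by (rule circle_measure.integrable_const_bound[of _ C]) (use fbd fm in auto)
  show "(\<lambda>N. \<integral>z. s N z * h z \<partial>circle_measure) \<longlonglongrightarrow> (\<integral>z. fourier_series c z * h z \<partial>circle_measure)"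
    if h: "continuous_on (sphere 0 1) h" for h
  proof (rule integral_dominated_convergence[where w = "\<lambda>z. C * cmod (h z)"])
    show "(\<lambda>z. fourier_series c z * h z) \<in> borel_measurable circle_measure"
      "\<And>N. (\<lambda>z. s N z * h z) \<in> borel_measurable circle_measure"
      using fm sm measurable_circle_continuous[OF h] by (auto intro!: borel_measurable_times simp del: measurable_circle_measure)
    show "integrable circle_measure (\<lambda>z. C * cmod (h z))"
      using integrable_circle_continuous[OF h] by simp
    show "AE z in circle_measure. (\<lambda>N. s N z * h z) \<longlonglongrightarrow> fourier_series c z * h z"
      by (rule AE_I2) (use lim in \<open>auto intro!: tendsto_intros\<close>)
    show "AE z in circle_measure. cmod (s N z * h z) \<le> C * cmod (h z)" for N
      by (rule AE_I2) (use bd in \<open>auto simp: norm_mult C_def intro!: mult_right_mono\<close>)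
  qed
qed

lemma integrable_fourier_series:
  "(\<lambda>k. cmod (c k)) summable_on UNIV \<Longrightarrow> integrable circle_measure (fourier_series c)"
  by (rule fourier_series_aux(3))

text \<open>Both sides are limits of the same sequence of symmetric partial sums: by dominated
  convergence on the left, and on the right by absolute summability, since the moments
  \<open>H k\<close> are bounded by \<open>B\<close>.\<close>

lemma integral_fourier_series:
  assumes c: "(\<lambda>k. cmod (c k)) summable_on UNIV" and h: "continuous_on (sphere 0 1) h"
  shows "(\<integral>z. fourier_series c z * h z \<partial>circle_measure) = (\<Sum>\<^sub>\<infinity>k. c k * (\<integral>z. z powi k * h z \<partial>circle_measure))"
proof -
  define H where "H k = (\<integral>z. z powi k * h z \<partial>circle_measure)" for k
  define B where "B = (\<integral>z. cmod (h z) \<partial>circle_measure)"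
  have hi: "integrable circle_measure (\<lambda>z. z powi k * h z)" for k :: int
    by (rule integrable_mult_continuous[OF integrable_circle_continuous[OF continuous_on_circle_powi] h])
  have HB: "cmod (H k) \<le> B" for k
  proof -
    have "cmod (H k) \<le> (\<integral>z. cmod (z powi k * h z) \<partial>circle_measure)"
      unfolding H_def by (rule Bochner_Integration.integral_norm_bound)
    also have "\<dots> = B"
      unfolding B_def by (rule Bochner_Integration.integral_cong) (simp_all add: norm_mult norm_power_int)
    finally show ?thesis .
  qed
  have "(\<lambda>k. cmod (c k * H k)) summable_on UNIV"
    by (rule Infinite_Sum.abs_summable_on_comparison_test'[OF summable_on_cmult_left[OF c, of B]])
       (simp add: norm_mult mult_left_mono HB)
  then have "(\<lambda>k. c k * H k) summable_on UNIV" by (rule Infinite_Sum.abs_summable_summable)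
  from filterlim_compose[OF infsum_tendsto[OF this] int_intervals_cofinal]
  have 1: "(\<lambda>N. \<Sum>k\<in>{- int N..int N}. c k * H k) \<longlonglongrightarrow> (\<Sum>\<^sub>\<infinity>k. c k * H k)" .
  have "(\<integral>z. (\<Sum>k\<in>{- int N..int N}. c k * z powi k) * h z \<partial>circle_measure) = (\<Sum>k\<in>{- int N..int N}. c k * H k)" for N
  proof -
    have "(\<integral>z. (\<Sum>k\<in>{- int N..int N}. c k * z powi k) * h z \<partial>circle_measure) =
      (\<integral>z. (\<Sum>k\<in>{- int N..int N}. c k * (z powi k * h z)) \<partial>circle_measure)"
      by (simp add: sum_distrib_right mult.assoc)
    also have "\<dots> = (\<Sum>k\<in>{- int N..int N}. \<integral>z. c k * (z powi k * h z) \<partial>circle_measure)"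
      by (rule Bochner_Integration.integral_sum) (simp add: hi)
    finally show ?thesis by (simp add: H_def)
  qed
  then have 2: "(\<lambda>N. \<Sum>k\<in>{- int N..int N}. c k * H k) \<longlonglongrightarrow> (\<integral>z. fourier_series c z * h z \<partial>circle_measure)"
    using fourier_series_aux(4)[OF c h] by simp
  show ?thesis using LIMSEQ_unique[OF 1 2] by (simp add: H_def)
qed

lemma fourier_coeff_series:
  assumes c: "(\<lambda>k. cmod (c k)) summable_on UNIV"
  shows "fourier_coeff (abs_circle_L1 (fourier_series c)) k = c k"
proof -
  have "fourier_coeff (abs_circle_L1 (fourier_series c)) k = (\<Sum>\<^sub>\<infinity>n. c n * (\<integral>z. z powi n * z powi (- k) \<partial>circle_measure))"
    unfolding fourier_coeff_abs[OF integrable_fourier_series[OF c]]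
    by (rule integral_fourier_series[OF c continuous_on_circle_powi])
  also have "\<dots> = (\<Sum>\<^sub>\<infinity>n. c n * (if n = k then 1 else 0))"
  proof (rule infsum_cong)
    fix n
    have eq: "(\<integral>z. z powi n * z powi (- k) \<partial>circle_measure) = (\<integral>z. z powi (n - k) \<partial>circle_measure)"
    proof (rule Bochner_Integration.integral_cong)
      fix z assume "z \<in> space circle_measure"
      then have "z \<noteq> 0" by auto
      then show "z powi n * z powi (- k) = z powi (n - k)"
        by (simp add: power_int_diff power_int_minus field_simps)
    qed simp
    show "c n * (\<integral>z. z powi n * z powi (- k) \<partial>circle_measure) = c n * (if n = k then 1 else 0)"
      unfolding eq integral_circle_powi by simp
  qed
  also have "\<dots> = (\<Sum>\<^sub>\<infinity>n\<in>{k}. c n)"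
    by (rule infsum_cong_neutral) auto
  finally show ?thesis by simp
qed

lemma eq_fourier_series:
  assumes c: "(\<lambda>k. cmod (fourier_coeff f k)) summable_on UNIV"
  shows "AE z in circle_measure. rep_circle_L1 f z = fourier_series (fourier_coeff f) z"
proof -
  have "f = abs_circle_L1 (fourier_series (fourier_coeff f))"
    by (rule circle_L1_eqI) (simp add: fourier_coeff_series[OF c])
  then show ?thesis using rep_abs_circle_L1[OF integrable_fourier_series[OF c]] by simp
qed

lemma fourier_coeff_galerkin_proj:
  "fourier_coeff (galerkin_proj K f) k = (if \<bar>k\<bar> \<le> int K then fourier_coeff f k else 0)"
proof -
  define c where "c k = (if \<bar>k\<bar> \<le> int K then fourier_coeff f k else 0)" for k
  have mem: "k \<in> {- int K..int K} \<longleftrightarrow> \<bar>k\<bar> \<le> int K" for k by auto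
  have s: "(\<lambda>k. cmod (c k)) summable_on UNIV"
    by (rule summable_on_cong_neutral[THEN iffD1, OF _ _ _ summable_on_finite[of "{- int K..int K}" "\<lambda>k. cmod (c k)"]])
       (auto simp: c_def)
  have fs: "fourier_series c = (\<lambda>z. \<Sum>k\<in>{- int K..int K}. fourier_coeff f k * z powi k)"
  proof
    fix z
    have "fourier_series c z = (\<Sum>\<^sub>\<infinity>k\<in>{- int K..int K}. fourier_coeff f k * z powi k)"
      unfolding fourier_series_def by (rule infsum_cong_neutral) (auto simp: c_def)
    then show "fourier_series c z = (\<Sum>k\<in>{- int K..int K}. fourier_coeff f k * z powi k)" by simp
  qed
  have gp: "galerkin_proj K f = abs_circle_L1 (fourier_series c)"
    unfolding galerkin_proj_def fs ..
  show ?thesis unfolding gp fourier_coeff_series[OF s] by (rule c_def)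
qed

section \<open>Fourier coefficients of the transfer operator\<close>

text \<open>Differentiating \<open>g t * cnj (g t) = 1\<close> shows that the velocity of
  \<open>g t = T (cis t)\<close> is \<open>\<i> * \<omega> t * g t\<close> with \<omega> real.
  Expansion gives \<open>\<bar>\<omega> t\<bar> > 1\<close>, so the continuous function \<omega>
  keeps its sign, and an antiderivative of \<omega> is an angle function up to an additive constant.
  The sign \<open>e\<close> absorbs the orientation, so that \<psi> always increases.\<close>

lemma uniformly_expanding_lift:
  assumes T: "uniformly_expanding T"
  obtains e :: real and \<psi> \<psi>' :: "real \<Rightarrow> real" where "e = 1 \<or> e = - 1" "\<And>t. T (cis t) = cis (e * \<psi> t)"
    "\<And>t. (\<psi> has_real_derivative \<psi>' t) (at t)" "continuous_on UNIV \<psi>'" "\<And>t. \<psi>' t > 1"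
    "\<And>t. circle_abs_deriv T (cis t) = \<psi>' t"
proof -
  define g where "g t = T (cis t)" for t
  obtain G where G: "\<And>t. (g has_vector_derivative G t) (at t)" and Gc: "continuous_on UNIV G"
    using T unfolding uniformly_expanding_def C1_circle_map_def C1_differentiable_on_def g_def by auto
  have gn: "cmod (g t) = 1" for t
    using T unfolding uniformly_expanding_def C1_circle_map_def g_def by (auto simp: Pi_iff)
  have gg: "g t * cnj (g t) = 1" for t using complex_norm_square[of "g t"] gn by simp
  have gc: "continuous_on UNIV g"
    using G by (auto intro!: continuous_at_imp_continuous_on has_vector_derivative_continuous)
  have abs: "circle_abs_deriv T (cis t) = cmod (G t)" for t
  proof -
    have "((\<lambda>s. t + s) has_vector_derivative 1) (at 0)" by (auto intro!: derivative_eq_intros)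
    moreover have "(g has_vector_derivative G t) (at (t + 0))" using G by simp
    ultimately have "((g \<circ> (\<lambda>s. t + s)) has_vector_derivative 1 *\<^sub>R G t) (at 0)"
      by (rule vector_diff_chain_at)
    then have "((\<lambda>s. T (cis t * cis s)) has_vector_derivative G t) (at 0)"
      by (simp add: o_def g_def cis_mult)
    then show ?thesis unfolding circle_abs_deriv_def by (simp add: vector_derivative_at)
  qed
  define \<omega> where "\<omega> t = Im (G t * cnj (g t))" for t
  have Re0: "Re (G t * cnj (g t)) = 0" for t
  proof -
    have "((\<lambda>t. g t * cnj (g t)) has_vector_derivative (g t * cnj (G t) + G t * cnj (g t))) (at t)"
      by (intro has_vector_derivative_mult has_vector_derivative_cnj G)
    then have "((\<lambda>t. 1 :: complex) has_vector_derivative (g t * cnj (G t) + G t * cnj (g t))) (at t)"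
      by (simp add: gg)
    moreover have "((\<lambda>t. 1 :: complex) has_vector_derivative 0) (at t)" by simp
    ultimately have "g t * cnj (G t) + G t * cnj (g t) = 0" by (rule vector_derivative_unique_at)
    then have "Re (g t * cnj (G t) + G t * cnj (g t)) = 0" by simp
    then show ?thesis by simp
  qed
  have G_eq: "G t = \<i> * of_real (\<omega> t) * g t" for t
  proof -
    have "G t * cnj (g t) = \<i> * of_real (\<omega> t)" using Re0 by (simp add: complex_eq_iff \<omega>_def)
    then have "G t * (g t * cnj (g t)) = \<i> * of_real (\<omega> t) * g t" by (simp add: mult_ac)
    then show ?thesis by (simp add: gg)
  qed
  have \<omega>1: "\<bar>\<omega> t\<bar> > 1" for t
  proof -
    have "\<bar>\<omega> t\<bar> = cmod (G t)" unfolding G_eq by (simp add: norm_mult gn)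
    moreover have "cis t \<in> sphere 0 1" by simp
    then have "circle_abs_deriv T (cis t) > 1" using T unfolding uniformly_expanding_def by blast
    ultimately show ?thesis by (simp only: abs)
  qed
  have \<omega>c: "continuous_on UNIV \<omega>" unfolding \<omega>_def by (intro continuous_intros Gc gc)
  define e :: real where "e = (if \<omega> 0 > 0 then 1 else - 1)"
  have e: "e = 1 \<or> e = - 1" by (simp add: e_def)
  have pos: "e * \<omega> t > 1" for t
  proof (rule ccontr)
    assume "\<not> e * \<omega> t > 1"
    then have le: "e * \<omega> t \<le> 0" using \<omega>1[of t] by (auto simp: e_def split: if_splits)
    have ge: "e * \<omega> 0 \<ge> 0" by (simp add: e_def)
    have "connected ((\<lambda>t. e * \<omega> t) ` UNIV)"
      by (intro connected_continuous_image continuous_intros \<omega>c) auto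
    then have "{e * \<omega> t..e * \<omega> 0} \<subseteq> range (\<lambda>t. e * \<omega> t)"
      by (rule connected_contains_Icc) auto
    moreover have "0 \<in> {e * \<omega> t..e * \<omega> 0}" using le ge by simp
    ultimately obtain s where "e * \<omega> s = 0" by auto
    then show False using \<omega>1[of s] by (auto simp: e_def split: if_splits)
  qed
  have "\<exists>F. \<forall>x::real. (-\<infinity>::ereal) < ereal x \<longrightarrow> ereal x < \<infinity> \<longrightarrow> (F has_vector_derivative \<omega> x) (at x)"
    using \<omega>c by (intro einterval_antiderivative) (auto simp: continuous_on_eq_continuous_at)
  then obtain F where F: "\<And>x. (F has_real_derivative \<omega> x) (at x)"
    by (auto simp: has_real_derivative_iff_has_vector_derivative)
  \<comment> \<open>The quotient of \<open>g\<close> by \<open>exp (\<i> * F t)\<close> has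
    derivative 0. Its constant value has modulus 1 and therefore contributes only the angle
    \<open>Arg c\<close>.\<close>
  define h where "h t = g t * exp (- \<i> * of_real (F t))" for t
  have "(h has_vector_derivative 0) (at t)" for t
  proof -
    have "((\<lambda>t. complex_of_real (F t)) has_vector_derivative of_real (\<omega> t)) (at t)"
      using F by (rule has_vector_derivative_of_real)
    then have "((\<lambda>t. - \<i> * complex_of_real (F t)) has_vector_derivative - \<i> * of_real (\<omega> t)) (at t)"
      by (rule has_vector_derivative_mult_right)
    from field_vector_diff_chain_at[OF this DERIV_exp]
    have E: "((\<lambda>t. exp (- \<i> * complex_of_real (F t))) has_vector_derivative
        - \<i> * of_real (\<omega> t) * exp (- \<i> * complex_of_real (F t))) (at t)"
      by (simp add: o_def)
    from has_vector_derivative_mult[OF G this]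
    show ?thesis unfolding h_def by (simp add: G_eq)
  qed
  then obtain c where c: "\<And>t. h t = c"
    using has_vector_derivative_zero_constant[of UNIV h] by auto
  have "cmod c = 1"
    using c[of 0, symmetric] by (simp add: h_def norm_mult gn)
  then have cc: "cis (Arg c) = c" using cis_Arg[of c] by (cases "c = 0") (auto simp: sgn_div_norm)
  have g_cis: "g t = cis (Arg c + F t)" for t
  proof -
    have "g t = h t * cis (F t)"
      unfolding h_def cis_conv_exp by (simp add: mult.assoc flip: exp_add)
    then show ?thesis by (simp add: c cc cis_mult[symmetric])
  qed
  show thesis
  proof
    show "e = 1 \<or> e = - 1" by (rule e)
    show "T (cis t) = cis (e * (e * (Arg c + F t)))" for t
    proof -
      have ee: "e * (e * x) = x" for x using e by auto
      show ?thesis using g_cis[of t] unfolding g_def ee .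
    qed
    show "((\<lambda>t. e * (Arg c + F t)) has_real_derivative e * \<omega> t) (at t)" for t
      by (auto intro!: derivative_eq_intros F)
    show "continuous_on UNIV (\<lambda>t. e * \<omega> t)" by (intro continuous_intros \<omega>c)
    show "e * \<omega> t > 1" for t by (rule pos)
    show "circle_abs_deriv T (cis t) = e * \<omega> t" for t
    proof -
      have "cmod (G t) = \<bar>\<omega> t\<bar>" unfolding G_eq by (simp add: norm_mult gn)
      then show ?thesis using pos[of t] e by (auto simp: abs)
    qed
  qed
qed

section \<open>Change of variables along the lift\<close>

locale expanding_lift =
  fixes \<psi> \<psi>' :: "real \<Rightarrow> real"
  assumes deriv: "(\<psi> has_real_derivative \<psi>' t) (at t)" and cont: "continuous_on UNIV \<psi>'" and gt1: "\<psi>' t > 1"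
begin

lemma increasing:
  assumes "s < t" shows "\<psi> s < \<psi> t"
proof (rule DERIV_pos_imp_increasing[OF assms])
  fix x
  have "0 < \<psi>' x" using gt1[of x] by linarith
  then show "\<exists>y. (\<psi> has_real_derivative y) (at x) \<and> 0 < y" using deriv by (intro exI conjI)
qed

lemma eq_iff: "\<psi> s = \<psi> t \<longleftrightarrow> s = t"
  using increasing[of s t] increasing[of t s] by (cases s t rule: linorder_cases) auto

lemma le_iff: "\<psi> s \<le> \<psi> t \<longleftrightarrow> s \<le> t"
  using increasing[of s t] increasing[of t s] by (cases s t rule: linorder_cases) auto

lemma less_iff: "\<psi> s < \<psi> t \<longleftrightarrow> s < t"
  using increasing[of s t] increasing[of t s] by (cases s t rule: linorder_cases) auto

lemma continuous: "continuous_on S \<psi>"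
  using deriv by (intro continuous_at_imp_continuous_on) (auto intro: DERIV_isCont)

text \<open>Since \<open>\<psi>' t > 1\<close>, the function \<open>\<psi> t - t\<close> is
  nondecreasing: \<psi> moves at least as fast as the identity in both directions. Hence it is
  enough to move from 0 by the distance \<open>\<bar>y - \<psi> 0\<bar>\<close>, on the appropriate
  side, to bracket \<open>y\<close>.\<close>

lemma surj: "\<exists>t. \<psi> t = y"
proof -
  have incr: "\<psi> s - s \<le> \<psi> t - t" if "s \<le> t" for s t
  proof (rule DERIV_nonneg_imp_nondecreasing[OF that])
    fix x
    have "((\<lambda>t. \<psi> t - t) has_real_derivative \<psi>' x - 1) (at x)" by (auto intro!: derivative_eq_intros deriv)
    then show "\<exists>y. ((\<lambda>t. \<psi> t - t) has_real_derivative y) (at x) \<and> 0 \<le> y" using gt1[of x] by force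
  qed
  define a where "a = min 0 (y - \<psi> 0)"
  define b where "b = max 0 (y - \<psi> 0)"
  have "\<psi> a \<le> y" using incr[of a 0] by (auto simp: a_def)
  moreover have "y \<le> \<psi> b" using incr[of 0 b] by (auto simp: b_def)
  moreover have "a \<le> b" by (simp add: a_def b_def)
  ultimately show ?thesis using IVT'[of \<psi> a y b] continuous by blast
qed

definition \<sigma> :: "real \<Rightarrow> real" where "\<sigma> y = (THE t. \<psi> t = y)"

lemma \<psi>_\<sigma> [simp]: "\<psi> (\<sigma> y) = y"
proof -
  obtain t where t: "\<psi> t = y" using surj by blast
  then have "\<sigma> y = t" unfolding \<sigma>_def using eq_iff by (intro the_equality) auto
  then show ?thesis using t by simp
qed

lemma \<sigma>_\<psi> [simp]: "\<sigma> (\<psi> t) = t"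
  using \<psi>_\<sigma>[of "\<psi> t"] by (simp only: eq_iff)

lemma \<sigma>_measurable [measurable]: "\<sigma> \<in> borel_measurable borel"
proof (rule borel_measurable_mono, rule monoI)
  fix x y :: real assume "x \<le> y"
  then show "\<sigma> x \<le> \<sigma> y" using le_iff[of "\<sigma> x" "\<sigma> y"] by simp
qed

lemma \<psi>_measurable [measurable]: "\<psi> \<in> borel_measurable borel"
  by (rule borel_measurable_continuous_onI[OF continuous])

lemma \<psi>'_measurable [measurable]: "\<psi>' \<in> borel_measurable borel"
  by (rule borel_measurable_continuous_onI[OF cont])

lemma \<psi>'_nonneg: "0 \<le> \<psi>' t" using gt1[of t] by simp

text \<open>The fundamental theorem of calculus gives the mass of each interval, and these masses
  determine Lebesgue measure. The boxes are open while the theorem is applied on a closed interval,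
  so the two endpoints are discarded as null sets.\<close>

lemma distr_density_lift: "distr (density lborel (\<lambda>t. ennreal (\<psi>' t))) borel \<psi> = lborel"
proof (rule lborel_eqI[symmetric])
  fix l u :: real assume "\<And>b. b \<in> Basis \<Longrightarrow> l \<bullet> b \<le> u \<bullet> b"
  then have lu: "l \<le> u" by simp
  have vim: "\<psi> -` {l<..<u} = {\<sigma> l<..<\<sigma> u}"
    using less_iff[of "\<sigma> l"] less_iff[of _ "\<sigma> u"] by auto
  have "emeasure (distr (density lborel (\<lambda>t. ennreal (\<psi>' t))) borel \<psi>) (box l u) =
      (\<integral>\<^sup>+ t. ennreal (\<psi>' t) * indicator {\<sigma> l<..<\<sigma> u} t \<partial>lborel)"
    by (subst emeasure_distr) (auto simp: vim emeasure_density)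
  also have "\<dots> = (\<integral>\<^sup>+ t. ennreal (\<psi>' t) * indicator {\<sigma> l..\<sigma> u} t \<partial>lborel)"
  proof (rule nn_integral_cong_AE)
    show "AE t in lborel. ennreal (\<psi>' t) * indicator {\<sigma> l<..<\<sigma> u} t = ennreal (\<psi>' t) * indicator {\<sigma> l..\<sigma> u} t"
      using AE_lborel_singleton[of "\<sigma> l"] AE_lborel_singleton[of "\<sigma> u"]
      by eventually_elim (auto split: split_indicator)
  qed
  also have "\<dots> = \<psi> (\<sigma> u) - \<psi> (\<sigma> l)"
    by (rule nn_integral_FTC_Icc) (use lu le_iff[of "\<sigma> l" "\<sigma> u"] in \<open>simp_all add: deriv \<psi>'_nonneg\<close>)
  finally show "emeasure (distr (density lborel (\<lambda>t. ennreal (\<psi>' t))) borel \<psi>) (box l u) = ennreal (\<Prod>b\<in>Basis. (u - l) \<bullet> b)"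
    by simp
qed simp

lemma integrable_lift_iff:
  fixes W :: "real \<Rightarrow> complex"
  assumes [measurable]: "W \<in> borel_measurable borel"
  shows "integrable lborel W \<longleftrightarrow> integrable lborel (\<lambda>t. \<psi>' t *\<^sub>R W (\<psi> t))"
    and "(\<integral>s. W s \<partial>lborel) = (\<integral>t. \<psi>' t *\<^sub>R W (\<psi> t) \<partial>lborel)"
proof -
  let ?N = "distr (density lborel (\<lambda>t. ennreal (\<psi>' t))) borel \<psi>"
  have "integrable ?N W \<longleftrightarrow> integrable lborel (\<lambda>t. \<psi>' t *\<^sub>R W (\<psi> t))"
    by (subst integrable_distr_eq) (auto simp: integrable_density \<psi>'_nonneg)
  then show "integrable lborel W \<longleftrightarrow> integrable lborel (\<lambda>t. \<psi>' t *\<^sub>R W (\<psi> t))"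
    unfolding distr_density_lift .
  have "(\<integral>s. W s \<partial>?N) = (\<integral>t. \<psi>' t *\<^sub>R W (\<psi> t) \<partial>lborel)"
    by (subst integral_distr) (auto simp: integral_density \<psi>'_nonneg)
  then show "(\<integral>s. W s \<partial>lborel) = (\<integral>t. \<psi>' t *\<^sub>R W (\<psi> t) \<partial>lborel)"
    unfolding distr_density_lift .
qed

end

text \<open>The translates of \<open>[0, 2 pi)\<close> tile the line, and \<open>s\<close> lies in
  the tile with number \<open>\<lfloor>s / (2 * pi)\<rfloor>\<close>. So \<open>W\<close> is the sum
  of its restrictions \<open>P j\<close>, each of which is moved to the base tile by a
  translation.\<close>

lemma tiling_integral:
  fixes W :: "real \<Rightarrow> complex"
  assumes W: "integrable lborel W" and J: "finite J" and supp: "\<And>s. W s \<noteq> 0 \<Longrightarrow> \<lfloor>s / (2 * pi)\<rfloor> \<in> J"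
  shows "integrable lborel (\<lambda>s. \<Sum>j\<in>J. indicator {0..<2 * pi} s *\<^sub>R W (s + 2 * pi * of_int j))"
    and "(\<integral>s. (\<Sum>j\<in>J. indicator {0..<2 * pi} s *\<^sub>R W (s + 2 * pi * of_int j)) \<partial>lborel) = (\<integral>s. W s \<partial>lborel)"
proof -
  define P where "P j s = indicator {0..<2 * pi} (s - 2 * pi * of_int j) *\<^sub>R W s" for j :: int and s
  have Pi: "integrable lborel (P j)" for j
    unfolding P_def
  proof (rule integrable_mult_indicator[where M = lborel and A = "{2 * pi * of_int j..<2 * pi * of_int j + 2 * pi}" and f = W, THEN iffD1[OF Bochner_Integration.integrable_cong, rotated -1]])
  qed (use W in \<open>auto split: split_indicator\<close>)
  have ind: "indicator {0..<2 * pi} (s - 2 * pi * of_int j) = (if j = \<lfloor>s / (2 * pi)\<rfloor> then 1 else (0::real))" for s j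
  proof -
    have "s - 2 * pi * of_int j \<in> {0..<2 * pi} \<longleftrightarrow> of_int j \<le> s / (2 * pi) \<and> s / (2 * pi) < of_int j + 1"
      by (auto simp: field_simps)
    also have "\<dots> \<longleftrightarrow> j = \<lfloor>s / (2 * pi)\<rfloor>" by linarith
    finally show ?thesis by (simp add: indicator_def)
  qed
  have Wsum: "W s = (\<Sum>j\<in>J. P j s)" for s
  proof -
    have "(\<Sum>j\<in>J. P j s) = (\<Sum>j\<in>J. if j = \<lfloor>s / (2 * pi)\<rfloor> then W s else 0)"
      unfolding P_def ind by (rule sum.cong) auto
    also have "\<dots> = (if \<lfloor>s / (2 * pi)\<rfloor> \<in> J then W s else 0)" using J by simp
    also have "\<dots> = W s" using supp[of s] by auto
    finally show ?thesis by simp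
  qed
  have shift: "P j (2 * pi * of_int j + 1 * s) = indicator {0..<2 * pi} s *\<^sub>R W (s + 2 * pi * of_int j)" for j s
    by (simp add: P_def add.commute)
  have int: "integrable lborel (\<lambda>s. indicator {0..<2 * pi} s *\<^sub>R W (s + 2 * pi * of_int j))" for j
    using lborel_integrable_real_affine[OF Pi, of 1 j "2 * pi * of_int j"] unfolding shift by simp
  show "integrable lborel (\<lambda>s. \<Sum>j\<in>J. indicator {0..<2 * pi} s *\<^sub>R W (s + 2 * pi * of_int j))"
    by (intro Bochner_Integration.integrable_sum int)
  have "(\<integral>s. (\<Sum>j\<in>J. indicator {0..<2 * pi} s *\<^sub>R W (s + 2 * pi * of_int j)) \<partial>lborel)
    = (\<Sum>j\<in>J. \<integral>s. indicator {0..<2 * pi} s *\<^sub>R W (s + 2 * pi * of_int j) \<partial>lborel)"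
    by (intro Bochner_Integration.integral_sum int)
  also have "\<dots> = (\<Sum>j\<in>J. \<integral>s. P j s \<partial>lborel)"
  proof (rule sum.cong)
    fix j
    show "(\<integral>s. indicator {0..<2 * pi} s *\<^sub>R W (s + 2 * pi * of_int j) \<partial>lborel) = (\<integral>s. P j s \<partial>lborel)"
      using lborel_integral_real_affine[of 1 "P j" "2 * pi * of_int j"] unfolding shift by simp
  qed simp
  also have "\<dots> = (\<integral>s. (\<Sum>j\<in>J. P j s) \<partial>lborel)"
    by (rule Bochner_Integration.integral_sum[symmetric]) (rule Pi)
  finally show "(\<integral>s. (\<Sum>j\<in>J. indicator {0..<2 * pi} s *\<^sub>R W (s + 2 * pi * of_int j)) \<partial>lborel) = (\<integral>s. W s \<partial>lborel)"
    by (simp flip: Wsum)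
qed

lemma circle_integral_cis:
  fixes f :: "complex \<Rightarrow> complex"
  assumes f: "f \<in> borel_measurable circle_measure" and e: "e = 1 \<or> e = - 1"
  shows "integrable circle_measure f \<longleftrightarrow> integrable lborel (\<lambda>s. indicator {0..<2 * pi} s *\<^sub>R f (cis (e * s)))"
    and "(\<integral>z. f z \<partial>circle_measure) = (1 / (2 * pi)) *\<^sub>R (\<integral>s. indicator {0..<2 * pi} s *\<^sub>R f (cis (e * s)) \<partial>lborel)"
proof -
  define G where "G s = indicator {0..2 * pi} s *\<^sub>R f (cis (e * s))" for s :: real
  \<comment> \<open>The affine substitution \<open>s = t + c * x\<close> maps \<open>[0, 1]\<close>
    onto \<open>[0, 2 pi]\<close>. For \<open>e = - 1\<close> the interval is run through backwards
    from \<open>2 * pi\<close>, so that \<open>cis (e * s)\<close> is still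
    \<open>circlepath 0 1 x\<close>.\<close>
  define t c :: real where "t = (if e = 1 then 0 else 2 * pi)" and "c = e * (2 * pi)"
  have c0: "c \<noteq> 0" "\<bar>c\<bar> = 2 * pi" using e by (auto simp: c_def abs_mult)
  have shift: "G (t + c * x) = indicator {0..1} x *\<^sub>R f (circlepath 0 1 x)" for x
  proof -
    have "t + c * x \<in> {0..2 * pi} \<longleftrightarrow> x \<in> {0..1}"
    proof -
      have "\<not> pi \<le> 0" using pi_gt_zero by linarith
      then show ?thesis using e by (auto simp: t_def c_def field_simps zero_le_mult_iff)
    qed
    then have "indicator {0..2 * pi} (t + c * x) = (indicator {0..1} x :: real)" by (simp add: indicator_def)
    moreover have "cis (e * (t + c * x)) = circlepath 0 1 x"
    proof -
      have "circlepath 0 1 x = cis (2 * pi * x)" by (simp add: circlepath cis_conv_exp mult_ac)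
      moreover have "cis (e * (t + c * x)) = cis (2 * pi * x)"
      proof (cases "e = 1")
        case False
        then have "cis (e * (t + c * x)) = cis (2 * pi * x - 2 * pi)" using e by (simp add: t_def c_def)
        then show ?thesis by (simp add: cis_divide[symmetric])
      qed (simp add: t_def c_def)
      ultimately show ?thesis by simp
    qed
    ultimately show ?thesis by (simp add: G_def)
  qed
  \<comment> \<open>Half-open intervals are what the tiling uses; the endpoint \<open>2 * pi\<close>
    is a null set.\<close>
  have AE: "AE s in lborel. G s = indicator {0..<2 * pi} s *\<^sub>R f (cis (e * s))"
    using AE_lborel_singleton[of "2 * pi"] by eventually_elim (auto simp: G_def split: split_indicator)
  have cism: "(\<lambda>s. cis (e * s)) \<in> borel \<rightarrow>\<^sub>M restrict_space borel (sphere 0 1)"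
    by (rule measurable_restrict_space2) (auto intro!: borel_measurable_continuous_onI continuous_intros)
  have fm: "(\<lambda>s. f (cis (e * s))) \<in> borel_measurable borel"
    using measurable_compose[OF cism, of f borel] f by simp
  have m: "G \<in> borel_measurable lborel" "(\<lambda>s. indicator {0..<2 * pi} s *\<^sub>R f (cis (e * s))) \<in> borel_measurable lborel"
    unfolding G_def using fm by simp_all
  have "integrable circle_measure f \<longleftrightarrow> integrable lborel G"
    unfolding integrable_circle_measure_iff[OF f] set_integrable_def shift[symmetric]
    by (rule lborel_integrable_real_affine_iff[OF c0(1)])
  also have "\<dots> \<longleftrightarrow> integrable lborel (\<lambda>s. indicator {0..<2 * pi} s *\<^sub>R f (cis (e * s)))"
    by (rule integrable_cong_AE[OF m AE])
  finally show "integrable circle_measure f \<longleftrightarrow> integrable lborel (\<lambda>s. indicator {0..<2 * pi} s *\<^sub>R f (cis (e * s)))" .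
  have "(\<integral>s. G s \<partial>lborel) = (2 * pi) *\<^sub>R (\<integral>z. f z \<partial>circle_measure)"
    unfolding integral_circle_measure[OF f] set_lebesgue_integral_def shift[symmetric] c0(2)[symmetric]
    by (rule lborel_integral_real_affine[OF c0(1)])
  moreover have "(\<integral>s. G s \<partial>lborel) = (\<integral>s. indicator {0..<2 * pi} s *\<^sub>R f (cis (e * s)) \<partial>lborel)"
    by (rule integral_cong_AE[OF m AE])
  ultimately show "(\<integral>z. f z \<partial>circle_measure) = (1 / (2 * pi)) *\<^sub>R (\<integral>s. indicator {0..<2 * pi} s *\<^sub>R f (cis (e * s)) \<partial>lborel)"
    by simp
qed

text \<open>The argument with values in \<open>[0, 2 pi)\<close> on the circle, expressed through
  \<open>Ln\<close> so that Borel measurability is immediate.\<close>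

definition arg2pi :: "complex \<Rightarrow> real" where
  "arg2pi z = (if 0 \<le> Im (Ln z) then Im (Ln z) else Im (Ln z) + 2 * pi)"

lemma arg2pi_measurable [measurable]: "arg2pi \<in> borel_measurable borel"
  unfolding arg2pi_def by measurable

lemma cis_arg2pi:
  assumes z: "z \<in> sphere 0 1"
  shows "cis (arg2pi z) = z" "arg2pi z \<in> {0..<2 * pi}"
proof -
  have nz: "z \<noteq> 0" using z by auto
  have "Ln z = \<i> * of_real (Im (Ln z))" using z nz by (simp add: complex_eq_iff)
  then have "cis (Im (Ln z)) = z" unfolding cis_conv_exp using exp_Ln[OF nz] by simp
  moreover have "cis (Im (Ln z) + 2 * pi) = cis (Im (Ln z))" by (simp flip: cis_mult)
  ultimately show "cis (arg2pi z) = z" by (simp add: arg2pi_def)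
  show "arg2pi z \<in> {0..<2 * pi}"
    using mpi_less_Im_Ln[OF nz] Im_Ln_le_pi[OF nz] pi_gt_zero by (auto simp: arg2pi_def)
qed

lemma cis_eq_cis_iff: "cis a = cis b \<longleftrightarrow> (\<exists>n::int. a = b + 2 * pi * of_int n)"
  using sin_cos_eq_iff[of a b] by (auto simp: complex_eq_iff)

lemma circle_compose_cis_measurable:
  assumes "f \<in> borel_measurable circle_measure"
  shows "(\<lambda>t. f (cis t)) \<in> borel_measurable borel"
proof -
  have "cis \<in> borel \<rightarrow>\<^sub>M restrict_space borel (sphere 0 1)"
    by (rule measurable_restrict_space2) (auto intro!: borel_measurable_continuous_onI continuous_intros)
  from measurable_compose[OF this] show ?thesis using assms by simp
qed

text \<open>In the coordinate \<open>x = cis (e * s)\<close> the preimages of \<open>x\<close> are the points \<open>cis t\<close> with \<open>0 \<le> t < 2 \<pi>\<close> and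
  \<open>\<psi> t = s + 2 \<pi> j\<close> for some integer \<open>j\<close>, so the fibre sum is a periodisation of a function on the line.\<close>

lemma transfer_fibre_sum:
  fixes f :: "complex \<Rightarrow> complex"
  assumes T: "uniformly_expanding T" and Tc: "continuous_on (sphere 0 1) T" and f: "integrable circle_measure f"
  defines "F \<equiv> \<lambda>x. \<Sum>y\<in>{y \<in> sphere 0 1. T y = x}. f y / of_real (circle_abs_deriv T y)"
  shows "integrable circle_measure F"
    and "continuous_on (sphere 0 1) h \<Longrightarrow> (\<integral>z. F z * h z \<partial>circle_measure) = (\<integral>z. f z * h (T z) \<partial>circle_measure)"
proof -
  obtain e :: real and \<psi> \<psi>' where e: "e = 1 \<or> e = - 1" and lift: "\<And>t. T (cis t) = cis (e * \<psi> t)"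
    and l: "\<And>t. (\<psi> has_real_derivative \<psi>' t) (at t)" "continuous_on UNIV \<psi>'" "\<And>t. \<psi>' t > 1"
    and abs: "\<And>t. circle_abs_deriv T (cis t) = \<psi>' t"
    using uniformly_expanding_lift[OF T] by metis
  interpret expanding_lift \<psi> \<psi>' by unfold_locales (fact l)+
  define D where "D = {0..<2 * pi}"
  \<comment> \<open>Numbers of the tiles that \<psi> can meet on \<open>[0, 2 pi]\<close>; all other
    sheets contain no preimage.\<close>
  define J where "J = {\<lfloor>\<psi> 0 / (2 * pi)\<rfloor>..\<lfloor>\<psi> (2 * pi) / (2 * pi)\<rfloor>}"
  define u where "u t = f (cis t) / of_real (\<psi>' t)" for t
  \<comment> \<open>Contribution of the preimage \<open>cis (\<sigma> y)\<close> to the fibre sum,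
    as a function of the lifted image \<open>y\<close>. The indicator admits a single lift of each
    preimage, so no point of a fibre is counted twice.\<close>
  define v where "v y = indicator D (\<sigma> y) *\<^sub>R u (\<sigma> y)" for y
  have fm: "f \<in> borel_measurable circle_measure" by (rule borel_measurable_integrable[OF f])
  have [measurable]: "(\<lambda>t. f (cis t)) \<in> borel_measurable borel" by (rule circle_compose_cis_measurable[OF fm])
  have [measurable]: "u \<in> borel_measurable borel" unfolding u_def by measurable
  have [measurable]: "D \<in> sets borel" by (simp add: D_def)
  have vm [measurable]: "v \<in> borel_measurable borel" unfolding v_def by measurable
  have J: "finite J" by (simp add: J_def)
  have inJ: "\<lfloor>\<psi> t / (2 * pi)\<rfloor> \<in> J" if "t \<in> D" for t
    using that le_iff[of 0 t] le_iff[of t "2 * pi"] pi_gt_zero unfolding D_def J_def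
    by (auto intro!: floor_mono divide_right_mono)
  have per: "cis (e * (s + 2 * pi * of_int j)) = cis (e * s)" for s j
  proof -
    have "e * (s + 2 * pi * of_int j) = e * s + 2 * pi * of_int (if e = 1 then j else - j)"
      using e by (auto simp: algebra_simps)
    then show ?thesis unfolding cis_eq_cis_iff by blast
  qed
  have Dinj: "s = t" if "cis s = cis t" "s \<in> D" "t \<in> D" for s t
  proof -
    obtain n :: int where n: "s = t + 2 * pi * of_int n" using \<open>cis s = cis t\<close> unfolding cis_eq_cis_iff by blast
    then have "\<bar>2 * pi * of_int n\<bar> < 2 * pi" using that(2,3) by (auto simp: D_def)
    then have "\<bar>of_int n :: real\<bar> < 1" by (simp add: abs_mult)
    then have "n = 0" by linarith
    then show ?thesis using n by simp
  qed
  have Fsum: "F (cis (e * s)) = (\<Sum>j\<in>J. v (s + 2 * pi * of_int j))" if s: "s \<in> D" for s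
  proof -
    define c where "c j = cis (\<sigma> (s + 2 * pi * of_int j))" for j :: int
    define I where "I = {j \<in> J. \<sigma> (s + 2 * pi * of_int j) \<in> D}"
    have "bij_betw c I {y \<in> sphere 0 1. T y = cis (e * s)}"
      unfolding bij_betw_def
    proof
      show "inj_on c I"
      proof (rule inj_onI)
        fix i j assume ij: "i \<in> I" "j \<in> I" "c i = c j"
        then have "\<sigma> (s + 2 * pi * of_int i) = \<sigma> (s + 2 * pi * of_int j)"
          unfolding c_def I_def by (intro Dinj) auto
        then have "\<psi> (\<sigma> (s + 2 * pi * of_int i)) = \<psi> (\<sigma> (s + 2 * pi * of_int j))" by (rule arg_cong)
        then show "i = j" by simp
      qed
      show "c ` I = {y \<in> sphere 0 1. T y = cis (e * s)}"
      proof (intro equalityI subsetI)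
        fix y assume "y \<in> c ` I"
        then show "y \<in> {y \<in> sphere 0 1. T y = cis (e * s)}"
          by (auto simp: c_def lift per)
      next
        fix y assume y: "y \<in> {y \<in> sphere 0 1. T y = cis (e * s)}"
        define t where "t = arg2pi y"
        have t: "cis t = y" "t \<in> D" using cis_arg2pi[of y] y by (auto simp: t_def D_def)
        have "cis (e * \<psi> t) = cis (e * s)" using y lift[of t] t by simp
        then obtain n :: int where n: "e * \<psi> t = e * s + 2 * pi * of_int n" unfolding cis_eq_cis_iff by blast
        define j where "j = (if e = 1 then n else - n)"
        have j: "\<psi> t = s + 2 * pi * of_int j" using n e by (auto simp: j_def)
        have "\<lfloor>\<psi> t / (2 * pi)\<rfloor> = j"
        proof (rule floor_unique)
          show "of_int j \<le> \<psi> t / (2 * pi)" "\<psi> t / (2 * pi) < of_int j + 1"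
            using s unfolding j D_def by (auto simp: add_divide_distrib)
        qed
        then have "j \<in> J" using inJ[OF t(2)] by simp
        moreover have "\<sigma> (s + 2 * pi * of_int j) = t" unfolding j[symmetric] by simp
        ultimately show "y \<in> c ` I" using t by (intro image_eqI[of _ _ j]) (auto simp: c_def I_def)
      qed
    qed
    then have "F (cis (e * s)) = (\<Sum>j\<in>I. f (c j) / of_real (circle_abs_deriv T (c j)))"
      unfolding F_def by (rule sum.reindex_bij_betw[symmetric])
    also have "\<dots> = (\<Sum>j\<in>I. v (s + 2 * pi * of_int j))"
      by (rule sum.cong) (auto simp: c_def abs v_def u_def I_def)
    also have "\<dots> = (\<Sum>j\<in>J. v (s + 2 * pi * of_int j))"
      by (rule sum.mono_neutral_left) (auto simp: J I_def v_def)
    finally show ?thesis .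
  qed
  \<comment> \<open>A Borel choice of the angle of \<open>x\<close> in the coordinate
    \<open>cis (e * s)\<close>. It rewrites the pointwise fibre sum as a measurable
    expression.\<close>
  define \<theta> where "\<theta> x = arg2pi (if e = 1 then x else cnj x)" for x
  have \<theta>: "cis (e * \<theta> x) = x" "\<theta> x \<in> D" if x: "x \<in> sphere 0 1" for x
  proof -
    have x': "(if e = 1 then x else cnj x) \<in> sphere 0 1" using x by auto
    show "\<theta> x \<in> D" unfolding \<theta>_def D_def by (rule cis_arg2pi(2)[OF x'])
    have 1: "cis (\<theta> x) = (if e = 1 then x else cnj x)" unfolding \<theta>_def by (rule cis_arg2pi(1)[OF x'])
    show "cis (e * \<theta> x) = x"
    proof (cases "e = 1")
      case False
      then have "cis (e * \<theta> x) = cnj (cis (\<theta> x))" using e by (simp add: cis_cnj)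
      then show ?thesis using 1 False by simp
    qed (use 1 in simp)
  qed
  have "(\<lambda>x. \<Sum>j\<in>J. v (\<theta> x + 2 * pi * of_int j)) \<in> borel_measurable borel"
  proof -
    have "(\<lambda>x. if e = 1 then x else cnj x) \<in> borel_measurable borel"
      by (cases "e = 1") (auto intro!: borel_measurable_continuous_onI continuous_intros)
    then have [measurable]: "\<theta> \<in> borel_measurable borel"
      unfolding \<theta>_def by (rule measurable_compose[OF _ arg2pi_measurable])
    show ?thesis by measurable
  qed
  then have "(\<lambda>x. \<Sum>j\<in>J. v (\<theta> x + 2 * pi * of_int j)) \<in> borel_measurable circle_measure"
    by (simp add: measurable_restrict_space1)
  moreover have "(\<Sum>j\<in>J. v (\<theta> x + 2 * pi * of_int j)) = F x" if "x \<in> space circle_measure" for x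
    using Fsum[OF \<theta>(2)[of x]] \<theta>(1)[of x] that by simp
  ultimately have Fm: "F \<in> borel_measurable circle_measure"
    by (subst measurable_cong[of circle_measure F "\<lambda>x. \<Sum>j\<in>J. v (\<theta> x + 2 * pi * of_int j)"]) auto
  have main: "integrable circle_measure (\<lambda>z. F z * h z) \<and>
      (\<integral>z. F z * h z \<partial>circle_measure) = (\<integral>z. f z * h (T z) \<partial>circle_measure)"
    if h: "continuous_on (sphere 0 1) h" for h
  proof -
    define W where "W y = v y * h (cis (e * y))" for y
    have "continuous_on UNIV (\<lambda>y. h (cis (e * y)))"
      by (rule continuous_on_compose2[OF h]) (auto intro!: continuous_intros)
    then have hm [measurable]: "(\<lambda>y. h (cis (e * y))) \<in> borel_measurable borel"
      by (rule borel_measurable_continuous_onI)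
    have Wm: "W \<in> borel_measurable borel" unfolding W_def by measurable
    have Tsub: "T ` sphere 0 1 \<subseteq> sphere 0 1"
      using T unfolding uniformly_expanding_def C1_circle_map_def by auto
    have hT: "continuous_on (sphere 0 1) (\<lambda>z. h (T z))"
      by (rule continuous_on_compose2[OF h Tc Tsub])
    have fh: "integrable circle_measure (\<lambda>z. f z * h (T z))"
      by (rule integrable_mult_continuous[OF f hT])
    \<comment> \<open>The Jacobian \<open>\<psi>'\<close> of the lift cancels the weight in
      \<open>u\<close>, which leaves the integrand \<open>f z * h (T z)\<close> over one
      period.\<close>
    have pull: "\<psi>' t *\<^sub>R W (\<psi> t) = indicator {0..<2 * pi} t *\<^sub>R (f (cis (1 * t)) * h (T (cis (1 * t))))" for t
      using gt1[of t] by (auto simp: W_def v_def u_def lift D_def scaleR_conv_of_real)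
    have int_pull: "integrable lborel (\<lambda>t. \<psi>' t *\<^sub>R W (\<psi> t))"
      unfolding pull using circle_integral_cis(1)[OF borel_measurable_integrable[OF fh], of 1] fh by simp
    have Wi: "integrable lborel W" using int_pull integrable_lift_iff(1)[OF Wm] by simp
    have supp: "\<lfloor>s / (2 * pi)\<rfloor> \<in> J" if "W s \<noteq> 0" for s
    proof -
      have "\<sigma> s \<in> D" using that by (auto simp: W_def v_def split: split_indicator_asm)
      from inJ[OF this] show ?thesis by simp
    qed
    have tile: "(\<Sum>j\<in>J. indicator {0..<2 * pi} s *\<^sub>R W (s + 2 * pi * of_int j)) =
        indicator {0..<2 * pi} s *\<^sub>R (F (cis (e * s)) * h (cis (e * s)))" for s
    proof (cases "s \<in> D")
      case True
      then show ?thesis unfolding Fsum[OF True]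
        by (simp add: W_def per sum_distrib_right scaleR_sum_right)
    qed (simp add: D_def)
    have til1: "integrable lborel (\<lambda>s. indicator {0..<2 * pi} s *\<^sub>R (F (cis (e * s)) * h (cis (e * s))))"
      by (rule tiling_integral(1)[OF Wi J, unfolded tile]) (rule supp)
    have til2: "(\<integral>s. indicator {0..<2 * pi} s *\<^sub>R (F (cis (e * s)) * h (cis (e * s))) \<partial>lborel) = (\<integral>s. W s \<partial>lborel)"
      by (rule tiling_integral(2)[OF Wi J, unfolded tile]) (rule supp)
    have Fhm: "(\<lambda>z. F z * h z) \<in> borel_measurable circle_measure"
      using Fm measurable_circle_continuous[OF h] by (rule borel_measurable_times)
    have 1: "integrable circle_measure (\<lambda>z. F z * h z)"
      using circle_integral_cis(1)[OF Fhm e] til1 by simp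
    have "(\<integral>z. F z * h z \<partial>circle_measure) = (1 / (2 * pi)) *\<^sub>R (\<integral>s. W s \<partial>lborel)"
      unfolding circle_integral_cis(2)[OF Fhm e] til2 by (rule refl)
    also have "(\<integral>s. W s \<partial>lborel) = (\<integral>t. indicator {0..<2 * pi} t *\<^sub>R (f (cis (1 * t)) * h (T (cis (1 * t)))) \<partial>lborel)"
      unfolding integrable_lift_iff(2)[OF Wm] pull by (rule refl)
    also have "(1 / (2 * pi)) *\<^sub>R \<dots> = (\<integral>z. f z * h (T z) \<partial>circle_measure)"
      by (rule circle_integral_cis(2)[OF borel_measurable_integrable[OF fh], symmetric]) simp
    finally show ?thesis using 1 by simp
  qed
  show "integrable circle_measure F" using main[of "\<lambda>_. 1"] by simp
  show "(\<integral>z. F z * h z \<partial>circle_measure) = (\<integral>z. f z * h (T z) \<partial>circle_measure)"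
    if "continuous_on (sphere 0 1) h" for h
    using main[OF that] by simp
qed

lemma fourier_coeff_transfer_operator:
  assumes T: "uniformly_expanding T" and Tc: "continuous_on (sphere 0 1) T"
  shows "fourier_coeff (transfer_operator T \<phi>) k = (\<integral>z. rep_circle_L1 \<phi> z * T z powi (- k) \<partial>circle_measure)"
  unfolding transfer_operator_def
    fourier_coeff_abs[OF transfer_fibre_sum(1)[OF T Tc rep_circle_L1(1)]]
  by (rule transfer_fibre_sum(2)[OF T Tc rep_circle_L1(1) continuous_on_circle_powi])

text \<open>Absolute summability permits replacing the representative by its Fourier series and
  integrating term by term. The integral is the matrix entry with row \<open>k\<close> and column
  \<open>n\<close>.\<close>

lemma fourier_coeff_transfer_operator_series:
  assumes T: "uniformly_expanding T" and Tc: "continuous_on (sphere 0 1) T"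
    and c: "(\<lambda>n. cmod (fourier_coeff \<phi> n)) summable_on UNIV"
  shows "fourier_coeff (transfer_operator T \<phi>) k =
    (\<Sum>\<^sub>\<infinity>n. fourier_coeff \<phi> n * (\<integral>z. z powi n * T z powi (- k) \<partial>circle_measure))"
proof -
  have "T z \<noteq> 0" if "z \<in> sphere 0 1" for z
  proof -
    have "T \<in> sphere 0 1 \<rightarrow> sphere 0 1"
      using T unfolding uniformly_expanding_def C1_circle_map_def by (elim conjE)
    then have "T z \<in> sphere 0 1" using that by (rule funcset_mem)
    then show ?thesis by auto
  qed
  then have h: "continuous_on (sphere 0 1) (\<lambda>z. T z powi (- k))"
    by (intro continuous_intros Tc) auto
  have "(\<integral>z. rep_circle_L1 \<phi> z * T z powi (- k) \<partial>circle_measure) =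
      (\<integral>z. fourier_series (fourier_coeff \<phi>) z * T z powi (- k) \<partial>circle_measure)"
  proof (rule integral_cong_AE)
    show "AE z in circle_measure. rep_circle_L1 \<phi> z * T z powi (- k) = fourier_series (fourier_coeff \<phi>) z * T z powi (- k)"
      using eq_fourier_series[OF c] by eventually_elim simp
    show "(\<lambda>z. rep_circle_L1 \<phi> z * T z powi (- k)) \<in> borel_measurable circle_measure"
      "(\<lambda>z. fourier_series (fourier_coeff \<phi>) z * T z powi (- k)) \<in> borel_measurable circle_measure"
      by (rule borel_measurable_integrable[OF integrable_mult_continuous[OF rep_circle_L1(1) h]]
        borel_measurable_integrable[OF integrable_mult_continuous[OF integrable_fourier_series[OF c] h]])+
  qed
  then show ?thesis
    unfolding fourier_coeff_transfer_operator[OF T Tc] integral_fourier_series[OF c h] .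
qed

section \<open>Exponential decay of the matrix entries\<close>

lemma open_annulus: "open (annulus q)"
  unfolding annulus_def by (intro open_Collect_conj open_Collect_less continuous_intros)

lemma connected_annulus_set: "connected (annulus q)"
  using connected_annulus(1)[of "1 / q" "0::complex" q] unfolding annulus_def by simp

lemma circle_subset_annulus: "q > 1 \<Longrightarrow> sphere 0 1 \<subseteq> annulus q"
  by (auto simp: annulus_def)

lemma annulus_nonzero: "z \<in> annulus q \<Longrightarrow> q > 1 \<Longrightarrow> z \<noteq> 0"
  by (auto simp: annulus_def)

lemma annulus_inverse:
  assumes "z \<in> annulus q" "q > 1" shows "1 / z \<in> annulus q"
  using assms annulus_nonzero[OF assms] by (auto simp: annulus_def norm_divide field_simps)

lemma annulus_cnj: "cnj z \<in> annulus q \<longleftrightarrow> z \<in> annulus q"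
  by (simp add: annulus_def)

text \<open>Schwarz reflection in the unit circle, which also shows that \<open>T\<close> has no zeros.\<close>

lemma circle_map_reflection:
  assumes q: "q > 1" and hol: "T holomorphic_on annulus q" and T: "T \<in> sphere 0 1 \<rightarrow> sphere 0 1"
    and z: "z \<in> annulus q"
  shows "T z * cnj (T (1 / cnj z)) = 1"
proof -
  define h where "h z = T z * cnj (T (1 / cnj z)) - 1" for z
  have "(\<lambda>w. T (1 / w)) holomorphic_on annulus q"
  proof -
    have "(T \<circ> (\<lambda>w. 1 / w)) holomorphic_on annulus q"
      by (rule holomorphic_on_compose_gen[OF _ hol])
         (use annulus_inverse[OF _ q] annulus_nonzero[OF _ q] in \<open>auto intro!: holomorphic_intros\<close>)
    then show ?thesis by (simp add: o_def)
  qed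
  moreover have "cnj ` annulus q = annulus q"
  proof (intro Set.set_eqI iffI)
    fix x assume "x \<in> annulus q"
    then have "cnj x \<in> annulus q" by (simp only: annulus_cnj)
    then show "x \<in> cnj ` annulus q" by (intro image_eqI[of _ _ "cnj x"]) auto
  qed (auto simp: annulus_cnj)
  ultimately have "(cnj \<circ> (\<lambda>w. T (1 / w)) \<circ> cnj) holomorphic_on annulus q"
    using holomorphic_on_compose_cnj_cnj[of "\<lambda>w. T (1 / w)" "annulus q"] open_annulus by simp
  then have "(\<lambda>z. cnj (T (1 / cnj z))) holomorphic_on annulus q" by (simp add: o_def)
  then have hh: "h holomorphic_on annulus q"
    unfolding h_def by (intro holomorphic_intros hol)
  have "h z = 0"
  proof (rule analytic_continuation[OF hh open_annulus connected_annulus_set circle_subset_annulus[OF q] _ _ _ z])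
    show "1 \<in> annulus q" using q by (simp add: annulus_def)
    have "connected (sphere (0::complex) 1)" by (rule connected_sphere) simp
    moreover have "\<nexists>x. sphere (0::complex) 1 = {x}"
    proof
      assume "\<exists>x. sphere (0::complex) 1 = {x}"
      then obtain x where "sphere (0::complex) 1 = {x}" by blast
      moreover have "1 \<in> sphere (0::complex) 1" "- 1 \<in> sphere (0::complex) 1" by auto
      ultimately have "(1::complex) = - 1" by (metis singletonD)
      then show False by simp
    qed
    ultimately show "1 islimpt sphere (0::complex) 1"
      by (intro connected_imp_perfect) auto
    fix w :: complex assume w: "w \<in> sphere 0 1"
    then have nz: "w \<noteq> 0" by auto
    have cnj1: "x * cnj x = 1" if "x \<in> sphere 0 1" for x
      using that complex_norm_square[of x] by simp
    have "1 / cnj w = w" using cnj1[OF w] nz by (simp add: field_simps)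
    moreover have "T w \<in> sphere 0 1" using T w by auto
    ultimately show "h w = 0" using cnj1[of "T w"] by (simp add: h_def)
  qed
  then show ?thesis by (simp add: h_def)
qed

lemma circle_map_norm_reflection:
  assumes "q > 1" "T holomorphic_on annulus q" "T \<in> sphere 0 1 \<rightarrow> sphere 0 1" "z \<in> annulus q"
  shows "cmod (T z) * cmod (T (1 / cnj z)) = 1"
  using arg_cong[OF circle_map_reflection[OF assms], of cmod] by (simp add: norm_mult)

section \<open>Boundary circles of the annulus and the contour shift\<close>

lemma sphere_subset_frontier_annulus:
  assumes "R > 1"
  shows "sphere 0 R \<subseteq> frontier (annulus R)" "sphere 0 (1 / R) \<subseteq> frontier (annulus R)"
proof -
  \<comment> \<open>Boundary points are approached along the radius. The increment \<open>d\<close>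
    is such that \<open>t = 1\<close> would land on the unit circle: \<open>1 / R - 1\<close> for
    the outer circle and \<open>R - 1\<close> for the inner one.\<close>
  have *: "z \<in> frontier (annulus R)" if z: "z \<noteq> 0" "z \<notin> annulus R"
    and seq: "\<And>t. t \<in> {0<..<1} \<Longrightarrow> of_real (1 + t * d) * z \<in> annulus R" for z d
  proof -
    have "z \<in> closure (annulus R)"
    proof (rule Lim_in_closed_set)
      show "\<forall>\<^sub>F t in at_right 0. complex_of_real (1 + t * d) * z \<in> closure (annulus R)"
      proof -
        have "\<forall>\<^sub>F t in at_right (0::real). t \<in> {0<..<1}" by (rule eventually_at_right_real) simp
        then show ?thesis
        proof eventually_elim
          case (elim t)
          show ?case using seq[OF elim] closure_subset by blast
        qed
      qed
      have "((\<lambda>t. complex_of_real (1 + t * d) * z) \<longlongrightarrow> complex_of_real (1 + 0 * d) * z) (at_right 0)"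
        by (intro tendsto_intros)
      then show "((\<lambda>t. complex_of_real (1 + t * d) * z) \<longlongrightarrow> z) (at_right 0)" by simp
    qed auto
    then show ?thesis using z(2) open_annulus by (simp add: frontier_def interior_open)
  qed
  show "sphere 0 R \<subseteq> frontier (annulus R)"
  proof
    fix z assume z: "z \<in> sphere (0::complex) R"
    show "z \<in> frontier (annulus R)"
    proof (rule *[of _ "1 / R - 1"])
      fix t :: real assume t: "t \<in> {0<..<1}"
      have "1 + t * (1 / R - 1) > 1 / R"
      proof -
        have "(1 - t) * (1 - 1 / R) > 0" using t assms by (intro mult_pos_pos) auto
        moreover have "(1 - t) * (1 - y) = 1 + t * (y - 1) - y" for y by (simp add: algebra_simps)
        ultimately show ?thesis by simp
      qed
      moreover have "1 / R > 0" using assms by simp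
      moreover have "t * (1 / R - 1) < 0" using t assms by (intro mult_pos_neg) auto
      ultimately have b: "1 / R < 1 + t * (1 / R - 1)" "1 + t * (1 / R - 1) < 1" "0 < 1 + t * (1 / R - 1)" by linarith+
      have "1 / R \<le> 1" using assms by simp
      have "1 < (1 + t * (1 / R - 1)) * R" using b(1) assms by (simp add: pos_divide_less_eq)
      then have "1 / R < (1 + t * (1 / R - 1)) * R" using \<open>1 / R \<le> 1\<close> by linarith
      moreover have "(1 + t * (1 / R - 1)) * R < 1 * R" using b(2) assms by (intro mult_strict_right_mono) auto
      moreover have "cmod (of_real (1 + t * (1 / R - 1)) * z) = (1 + t * (1 / R - 1)) * R"
        using z b(3) by (simp only: norm_mult norm_of_real) simp
      ultimately show "of_real (1 + t * (1 / R - 1)) * z \<in> annulus R" by (simp only: annulus_def mem_Collect_eq) simp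
    qed (use z assms in \<open>auto simp: annulus_def\<close>)
  qed
  show "sphere 0 (1 / R) \<subseteq> frontier (annulus R)"
  proof
    fix z assume z: "z \<in> sphere (0::complex) (1 / R)"
    show "z \<in> frontier (annulus R)"
    proof (rule *[of _ "R - 1"])
      fix t :: real assume t: "t \<in> {0<..<1}"
      have p: "0 < t * (R - 1)" using t assms by (intro mult_pos_pos) auto
      have "t * (R - 1) < 1 * (R - 1)" using t assms by (intro mult_strict_right_mono) auto
      then have "1 + t * (R - 1) < R" by simp
      then have "(1 + t * (R - 1)) * (1 / R) < R * (1 / R)" using assms by (intro mult_strict_right_mono) auto
      moreover have "R * (1 / R) = 1" using assms by simp
      ultimately have "(1 + t * (R - 1)) * (1 / R) < R" using assms by linarith
      moreover have "1 * (1 / R) < (1 + t * (R - 1)) * (1 / R)" using assms p by (intro mult_strict_right_mono) auto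
      moreover have "cmod (of_real (1 + t * (R - 1)) * z) = (1 + t * (R - 1)) * (1 / R)"
        using z p by (simp only: norm_mult norm_of_real) simp
      ultimately show "of_real (1 + t * (R - 1)) * z \<in> annulus R" by (simp only: annulus_def mem_Collect_eq) simp
    qed (use z assms in \<open>auto simp: annulus_def\<close>)
  qed
qed

text \<open>On the circle of radius \<open>R\<close> the continuous function
  \<open>cmod (T z)\<close> avoids the open interval from \<open>1 / R'\<close> to
  \<open>R'\<close>, so by connectedness it stays on one side of it. Reflection transfers the result
  to the inner circle. Both alternatives occur: \<open>s = R\<close> for maps like
  \<open>z ^ 2\<close>, \<open>s = 1 / R\<close> for maps like \<open>1 / z ^ 2\<close>.\<close>

lemma circle_map_dichotomy:
  assumes R: "R > 1" "R < q" and R': "R' > 1"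
    and hol: "T holomorphic_on annulus q" and T: "T \<in> sphere 0 1 \<rightarrow> sphere 0 1"
    and dis: "annulus R' \<inter> T ` frontier (annulus R) = {}"
  obtains s where "s = R \<or> s = 1 / R"
    "\<And>z. z \<in> sphere 0 s \<Longrightarrow> cmod (T z) \<ge> R'" "\<And>z. z \<in> sphere 0 (1 / s) \<Longrightarrow> cmod (T z) \<le> 1 / R'"
proof -
  have q: "q > 1" using R by simp
  have refl: "cmod (T z) * cmod (T (1 / cnj z)) = 1" if "z \<in> sphere 0 R \<or> z \<in> sphere 0 (1 / R)" for z
  proof (rule circle_map_norm_reflection[OF q hol T])
    have "1 / q < 1 / R" using R by (simp add: frac_less2)
    moreover have "1 / R < 1" using R by simp
    moreover have "cmod z = R \<or> cmod z = 1 / R" using that by auto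
    ultimately have "1 / q < cmod z" "cmod z < q" using R by linarith+
    then show "z \<in> annulus q" by (simp add: annulus_def)
  qed
  have alt: "cmod (T z) \<ge> R' \<or> cmod (T z) \<le> 1 / R'" if "z \<in> sphere 0 R" for z
  proof -
    have "T z \<notin> annulus R'" using dis sphere_subset_frontier_annulus(1)[OF R(1)] that by blast
    then show ?thesis by (auto simp: annulus_def)
  qed
  have sub: "sphere 0 R \<subseteq> annulus q"
  proof -
    have "1 / q < 1" using q by simp
    then have "1 / q < R" using R by linarith
    then show ?thesis using R by (auto simp: annulus_def)
  qed
  have conn: "connected ((\<lambda>z. cmod (T z)) ` sphere 0 R)"
  proof (rule connected_continuous_image)
    show "continuous_on (sphere 0 R) (\<lambda>z. cmod (T z))"
      by (intro continuous_intros continuous_on_subset[OF holomorphic_on_imp_continuous_on[OF hol] sub])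
    show "connected (sphere (0::complex) R)" by (rule connected_sphere) simp
  qed
  have inv_sphere: "1 / cnj z \<in> sphere 0 (1 / s)" if "z \<in> sphere 0 s" for z s
    using that by (simp add: norm_divide)
  have inv_le: "y \<le> 1 / R'" if "x * y = 1" "x \<ge> R'" for x y :: real
  proof -
    have x: "x > 0" using that R' by simp
    then have "y = 1 / x" using that by (simp add: field_simps)
    then show ?thesis using that R' by (simp add: frac_le)
  qed
  have inv_ge: "y \<ge> R'" if "x * y = 1" "x \<le> 1 / R'" "x \<ge> 0" for x y :: real
  proof -
    have x: "x > 0" using that by (cases "x = 0") auto
    then have "y = 1 / x" using that by (simp add: field_simps)
    moreover have "x * R' \<le> 1" using that R' by (simp add: field_simps)
    then have "R' \<le> 1 / x" using x by (simp add: field_simps)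
    ultimately show ?thesis by simp
  qed
  show thesis
  proof (cases "\<forall>z\<in>sphere 0 R. cmod (T z) \<ge> R'")
    case True
    show thesis
    proof (rule that[of R])
      show "cmod (T z) \<le> 1 / R'" if z: "z \<in> sphere 0 (1 / R)" for z
      proof (rule inv_le)
        show "cmod (T (1 / cnj z)) * cmod (T z) = 1" using refl[of z] z by (simp add: mult.commute)
        show "cmod (T (1 / cnj z)) \<ge> R'" using True inv_sphere[OF z] by simp
      qed
    qed (use True in auto)
  next
    case False
    then obtain z0 where z0: "z0 \<in> sphere 0 R" "cmod (T z0) \<le> 1 / R'" using alt by fastforce
    have le: "cmod (T z) \<le> 1 / R'" if z: "z \<in> sphere 0 R" for z
    proof (rule ccontr)
      assume "\<not> cmod (T z) \<le> 1 / R'"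
      then have ge: "cmod (T z) \<ge> R'" using alt[OF z] by simp
      have "1 / R' < 1" using R' by simp
      then have "1 \<in> {cmod (T z0)..cmod (T z)}" using z0(2) ge R' by (simp only: atLeastAtMost_iff) linarith
      moreover have "{cmod (T z0)..cmod (T z)} \<subseteq> (\<lambda>z. cmod (T z)) ` sphere 0 R"
        by (rule connected_contains_Icc[OF conn imageI[OF z0(1), of "\<lambda>z. cmod (T z)"] imageI[OF z, of "\<lambda>z. cmod (T z)"]])
      ultimately have "1 \<in> (\<lambda>z. cmod (T z)) ` sphere 0 R" by (rule subsetD[rotated])
      then have "\<exists>w\<in>sphere 0 R. 1 = cmod (T w)" unfolding image_iff .
      then obtain w where w: "w \<in> sphere 0 R" "1 = cmod (T w)" by (rule bexE)
      show False using alt[OF w(1)] w(2) R' \<open>1 / R' < 1\<close> by linarith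
    qed
    show thesis
    proof (rule that[of "1 / R"])
      show "cmod (T z) \<ge> R'" if z: "z \<in> sphere 0 (1 / R)" for z
      proof (rule inv_ge)
        show "cmod (T (1 / cnj z)) * cmod (T z) = 1" using refl[of z] z by (simp add: mult.commute)
        show "cmod (T (1 / cnj z)) \<le> 1 / R'" using le inv_sphere[OF z] by simp
      qed simp
    qed (use le in auto)
  qed
qed

text \<open>By Cauchy's theorem for \<open>g z / z\<close>, the mean of \<open>g\<close> over a
  concentric circle does not depend on the radius. The homotopy is radial: moduli along its segments
  are convex combinations of 1 and \<open>s\<close>, hence stay inside the annulus.\<close>

lemma integral_circle_shift_bound:
  assumes s: "s > 0" "s = 1 \<or> s < q" "1 / q < s" and q: "q > 1" and g: "g holomorphic_on annulus q"
    and B: "\<And>z. z \<in> sphere 0 s \<Longrightarrow> cmod (g z) \<le> B"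
  shows "cmod (\<integral>z. g z \<partial>circle_measure) \<le> B"
proof -
  have sq: "s < q" using s q by auto
  have B0: "0 \<le> B" using B[of "of_real s"] s(1) norm_ge_zero order_trans by (metis abs_of_pos mem_sphere_0 norm_of_real)
  have "continuous_on (sphere 0 1) g"
    by (rule continuous_on_subset[OF holomorphic_on_imp_continuous_on[OF g] circle_subset_annulus[OF q]])
  then have gi: "integrable circle_measure g" by (rule integrable_circle_continuous)
  have hol: "(\<lambda>z. g z / z) holomorphic_on annulus q"
    using annulus_nonzero[OF _ q] by (intro holomorphic_intros g) auto
  have "contour_integral (circlepath 0 1) (\<lambda>z. g z / z) = contour_integral (circlepath 0 s) (\<lambda>z. g z / z)"
  proof (rule Cauchy_theorem_homotopic_loops[OF _ open_annulus hol])
    show "homotopic_loops (annulus q) (circlepath 0 1) (circlepath 0 s)"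
    proof (rule homotopic_loops_linear)
      fix t :: real
      show "closed_segment (circlepath 0 1 t) (circlepath 0 s t) \<subseteq> annulus q"
      proof
        fix w assume "w \<in> closed_segment (circlepath 0 1 t) (circlepath 0 s t)"
        then obtain u where u: "0 \<le> u" "u \<le> 1" "w = (1 - u) *\<^sub>R circlepath 0 1 t + u *\<^sub>R circlepath 0 s t"
          by (auto simp: closed_segment_def)
        have "w = of_real ((1 - u) + u * s) * exp (2 * of_real pi * \<i> * of_real t)"
          unfolding u(3) by (simp add: circlepath scaleR_conv_of_real algebra_simps)
        moreover have pos: "(1 - u) + u * s > 0"
          using u s(1) by (cases "u = 0") (auto intro: add_nonneg_pos)
        ultimately have nw: "cmod w = (1 - u) * 1 + u * s" by (simp only: norm_mult norm_of_real) simp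
        have "1 / q < 1" using q by simp
        then have "(1 - u) * 1 + u * s > 1 / q"
          using convex_bound_lt[of "- 1" "- (1 / q)" "- s" "1 - u" u] u s(3) by simp
        moreover have "(1 - u) * 1 + u * s < q"
          using convex_bound_lt[of 1 q s "1 - u" u] u sq q by simp
        ultimately show "w \<in> annulus q" by (simp add: annulus_def nw)
      qed
    qed (auto simp: path_circlepath)
  qed auto
  moreover have "cmod (contour_integral (circlepath 0 s) (\<lambda>z. g z / z)) \<le> B / s * (2 * pi * s)"
  proof (rule has_contour_integral_bound_circlepath)
    have "path_image (circlepath 0 s) \<subseteq> annulus q" using s sq by (auto simp: annulus_def)
    then have "(\<lambda>z. g z / z) contour_integrable_on circlepath 0 s"
      by (intro contour_integrable_holomorphic_simple[OF hol open_annulus]) auto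
    then show "((\<lambda>z. g z / z) has_contour_integral contour_integral (circlepath 0 s) (\<lambda>z. g z / z)) (circlepath 0 s)"
      by (rule has_contour_integral_integral)
    show "cmod (g z / z) \<le> B / s" if "cmod (z - 0) = s" for z
      using that s(1) B[of z] by (simp add: norm_divide divide_right_mono)
  qed (use s B0 in auto)
  then have "cmod (contour_integral (circlepath 0 s) (\<lambda>z. g z / z)) \<le> B * (2 * pi)" using s(1) by simp
  ultimately show ?thesis
    unfolding contour_integral_circle[OF gi, symmetric] by (simp add: norm_mult norm_divide field_simps)
qed

lemma transfer_matrix_bound:
  assumes \<eta>: "0 < \<eta>" and \<rho>: "0 < \<rho>" and q: "q > exp (2 * pi * \<eta>)"
    and hol: "T holomorphic_on annulus q" and T: "T \<in> sphere 0 1 \<rightarrow> sphere 0 1"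
    and dis: "annulus (exp (2 * pi * \<rho>)) \<inter> T ` frontier (annulus (exp (2 * pi * \<eta>))) = {}"
  shows "cmod (\<integral>z. z powi n * T z powi (- k) \<partial>circle_measure) \<le>
    exp (2 * pi * of_int \<bar>n\<bar> * \<eta>) * exp (- (2 * pi * of_int \<bar>k\<bar> * \<rho>))"
proof -
  define R where "R = exp (2 * pi * \<eta>)"
  define R' where "R' = exp (2 * pi * \<rho>)"
  have R: "R > 1" "R < q" "R' > 1" using \<eta> \<rho> q by (auto simp: R_def R'_def)
  have q1: "q > 1" using R by simp
  have qR: "1 / q < 1 / R" "1 / R < 1" using R by (auto simp: frac_less2)
  obtain s where s: "s = R \<or> s = 1 / R"
    and ge: "\<And>z. z \<in> sphere 0 s \<Longrightarrow> cmod (T z) \<ge> R'" and le: "\<And>z. z \<in> sphere 0 (1 / s) \<Longrightarrow> cmod (T z) \<le> 1 / R'"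
    using circle_map_dichotomy[OF R(1,2,3) hol T dis[folded R_def R'_def]] by metis
  \<comment> \<open>The sign of \<open>k\<close> decides which circle makes
    \<open>T z powi (- k)\<close> small: the one where \<open>T\<close> is large if
    \<open>k \<ge> 0\<close>, the one where \<open>T\<close> is small otherwise. Their radii are
    reciprocal, so both lead to the same bound for \<open>z powi n\<close>.\<close>
  define t where "t = (if k \<ge> 0 then s else 1 / s)"
  have t: "t = R \<or> t = 1 / R" using s R by (auto simp: t_def)
  have t0: "t > 0" using t R by auto
  have tq: "t < q" "1 / q < t" using t R qR by linarith+
  have Tnz: "T z \<noteq> 0" if "z \<in> annulus q" for z
    using circle_map_reflection[OF q1 hol T that] by auto
  have "(\<lambda>z. z powi n * T z powi (- k)) holomorphic_on annulus q"
    using annulus_nonzero[OF _ q1] Tnz by (intro holomorphic_intros hol) auto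
  then show ?thesis
  proof (rule integral_circle_shift_bound[where s = t and q = q, rotated 4])
    show "t > 0" "t = 1 \<or> t < q" "1 / q < t" using t0 tq by auto
    fix z :: complex assume z: "z \<in> sphere 0 t"
    have zq: "z \<in> annulus q" using z tq by (simp add: annulus_def)
    have "cmod (z powi n) \<le> exp (2 * pi * of_int \<bar>n\<bar> * \<eta>)"
    proof -
      have tz: "cmod z = t" using z by simp
      have "t = exp (2 * pi * \<eta>) \<or> t = exp (- (2 * pi * \<eta>))" using t by (auto simp: R_def exp_minus field_simps)
      then have "t powi n = exp (of_int n * (2 * pi * \<eta>)) \<or> t powi n = exp (of_int n * (- (2 * pi * \<eta>)))"
        by (auto simp: exp_power_int)
      moreover have "of_int n * (2 * pi * \<eta>) \<le> of_int \<bar>n\<bar> * (2 * pi * \<eta>)" "of_int (- n) * (2 * pi * \<eta>) \<le> of_int \<bar>n\<bar> * (2 * pi * \<eta>)"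
        using \<eta> by (intro mult_right_mono; simp)+
      ultimately have "t powi n \<le> exp (of_int \<bar>n\<bar> * (2 * pi * \<eta>))" by auto
      then show ?thesis by (simp add: norm_power_int tz mult_ac)
    qed
    moreover have "cmod (T z powi (- k)) \<le> exp (- (2 * pi * of_int \<bar>k\<bar> * \<rho>))"
    proof (cases "k \<ge> 0")
      case True
      have "R' ^ nat k \<le> cmod (T z) ^ nat k"
        using ge[of z] z True R by (intro power_mono) (auto simp: t_def)
      then have "inverse (cmod (T z) ^ nat k) \<le> inverse (R' ^ nat k)"
        using R by (intro le_imp_inverse_le) auto
      moreover have "cmod (T z powi (- k)) = inverse (cmod (T z) ^ nat k)"
        using True by (simp add: power_int_minus norm_inverse norm_power_int) (simp add: power_int_def)
      moreover have "inverse (R' ^ nat k) = exp (- (2 * pi * of_int \<bar>k\<bar> * \<rho>))"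
        using True unfolding R'_def exp_of_nat_mult[symmetric] by (simp add: exp_minus mult_ac)
      ultimately show ?thesis by simp
    next
      case False
      have "cmod (T z) ^ nat (- k) \<le> (1 / R') ^ nat (- k)"
        using le[of z] z False by (intro power_mono) (auto simp: t_def)
      moreover have "cmod (T z powi (- k)) = cmod (T z) ^ nat (- k)"
        using False by (simp add: norm_power power_int_def del: norm_power_int)
      moreover have "(1 / R') ^ nat (- k) = exp (- (2 * pi * of_int \<bar>k\<bar> * \<rho>))"
      proof -
        have "1 / R' = exp (- (2 * pi * \<rho>))" by (simp add: R'_def exp_minus field_simps)
        then have "(1 / R') ^ nat (- k) = exp (of_nat (nat (- k)) * - (2 * pi * \<rho>))"
          by (simp only: exp_of_nat_mult)
        also have "real (nat (- k)) = of_int \<bar>k\<bar>" using False by simp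
        finally show ?thesis by (simp add: mult_ac)
      qed
      ultimately show ?thesis by simp
    qed
    ultimately show "cmod (z powi n * T z powi (- k)) \<le>
      exp (2 * pi * of_int \<bar>n\<bar> * \<eta>) * exp (- (2 * pi * of_int \<bar>k\<bar> * \<rho>))"
      unfolding norm_mult by (intro mult_mono) auto
  qed (rule q1)
qed

section \<open>Fredholm determinants of nuclear matrices\<close>

text \<open>After expansion the difference consists of the monomials with at least one factor
  \<open>d i\<close>, and the right-hand side is the same expansion with every factor replaced by
  its bound. In this form absolute values pass through the Leibniz formula without destroying the
  product structure.\<close>

lemma norm_prod_diff_le:
  fixes y d :: "'i \<Rightarrow> complex" and u :: "'i \<Rightarrow> real"
  assumes "finite A" "\<And>i. i \<in> A \<Longrightarrow> cmod (y i) \<le> u i"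
  shows "cmod ((\<Prod>i\<in>A. y i + d i) - (\<Prod>i\<in>A. y i)) \<le> (\<Prod>i\<in>A. u i + cmod (d i)) - (\<Prod>i\<in>A. u i)"
  using assms
proof (induction A rule: finite_induct)
  case (insert x F)
  let ?P = "\<Prod>i\<in>F. y i" and ?P' = "\<Prod>i\<in>F. y i + d i"
  let ?U = "\<Prod>i\<in>F. u i" and ?U' = "\<Prod>i\<in>F. u i + cmod (d i)"
  have IH: "cmod (?P' - ?P) \<le> ?U' - ?U" using insert by auto
  have P': "cmod ?P' \<le> ?U'"
    unfolding prod_norm[symmetric]
    by (rule prod_mono) (use insert.prems in \<open>auto intro: norm_triangle_le\<close>)
  have ux: "cmod (y x) \<le> u x" using insert by auto
  have "(y x + d x) * ?P' - y x * ?P = y x * (?P' - ?P) + d x * ?P'" by (simp add: algebra_simps)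
  also have "cmod \<dots> \<le> cmod (y x) * cmod (?P' - ?P) + cmod (d x) * cmod ?P'"
    using norm_triangle_ineq[of "y x * (?P' - ?P)" "d x * ?P'"] by (simp only: norm_mult)
  also have "\<dots> \<le> u x * (?U' - ?U) + cmod (d x) * ?U'"
    by (intro add_mono mult_mono IH P' ux) (use ux order_trans[OF norm_ge_zero ux] in auto)
  finally show ?case using insert.hyps by (simp add: algebra_simps)
qed simp

lemma prod_le_exp_sum:
  fixes f :: "'i \<Rightarrow> real"
  assumes "\<And>i. i \<in> A \<Longrightarrow> 0 \<le> f i"
  shows "(\<Prod>i\<in>A. 1 + f i) \<le> exp (\<Sum>i\<in>A. f i)"
proof (cases "finite A")
  case True
  have "(\<Prod>i\<in>A. 1 + f i) \<le> (\<Prod>i\<in>A. exp (f i))"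
    by (rule prod_mono) (use assms exp_ge_add_one_self in \<open>auto intro: add_nonneg_nonneg\<close>)
  then show ?thesis using True by (simp add: exp_sum)
qed simp

definition fdet :: "nat \<Rightarrow> (nat \<Rightarrow> nat \<Rightarrow> complex) \<Rightarrow> complex" where
  "fdet N a = Determinant.det (Matrix.mat N N (\<lambda>(i, j). (if i = j then 1 else 0) - a i j))"

definition block_norm :: "nat \<Rightarrow> (nat \<Rightarrow> nat \<Rightarrow> complex) \<Rightarrow> real" where
  "block_norm N a = (\<Sum>i<N. \<Sum>j<N. cmod (a i j))"

lemma fdet_leibniz:
  "fdet N a = (\<Sum>p | p permutes {0..<N}. signof p * (\<Prod>i=0..<N. (if i = p i then 1 else 0) - a i (p i)))"
  unfolding fdet_def
  by (subst det_def'[of _ N]) (auto intro!: sum.cong prod.cong simp: permutes_in_image)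

lemma norm_signof: "cmod (signof p) = 1"
  by (auto simp: sign_def)

text \<open>The Leibniz sum over permutations is dominated by a nonnegative sum over all maps of the
  index set, which factors into a product of row sums. Exponentials then absorb the row sums, so the
  size \<open>N\<close> enters only through \<open>block_norm\<close>, a quantity that stays bounded
  for summable entries.\<close>

lemma fdet_diff_le:
  "cmod (fdet N a - fdet N b) \<le> exp (block_norm N b) * (exp (block_norm N (\<lambda>i j. a i j - b i j)) - 1)"
proof -
  define u where "u i j = (if i = j then 1 else 0) + cmod (b i j)" for i j :: nat
  define e where "e i j = cmod (a i j - b i j)" for i j
  define P where "P = {p. p permutes {0..<N}}"
  define Q where "Q = ({0..<N} \<rightarrow>\<^sub>E {0..<N})"
  define F where "F p = (\<Prod>i=0..<N. u i (p i) + e i (p i)) - (\<Prod>i=0..<N. u i (p i))" for p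
  have u0: "0 \<le> u i j" and e0: "0 \<le> e i j" for i j by (auto simp: u_def e_def)
  have finP: "finite P" unfolding P_def by (rule finite_permutations) simp
  have F0: "0 \<le> F p" for p unfolding F_def
    using u0 e0 by (simp add: prod_mono)
  have "cmod (fdet N a - fdet N b) = cmod (\<Sum>p\<in>P. signof p *
     ((\<Prod>i=0..<N. (if i = p i then 1 else 0) - a i (p i)) - (\<Prod>i=0..<N. (if i = p i then 1 else 0) - b i (p i))))"
    unfolding fdet_leibniz P_def by (simp add: sum_subtractf algebra_simps)
  also have "\<dots> \<le> (\<Sum>p\<in>P. F p)"
  proof (rule order_trans[OF norm_sum], rule sum_mono)
    fix p
    have "cmod ((\<Prod>i=0..<N. ((if i = p i then 1 else 0) - b i (p i)) + (b i (p i) - a i (p i)))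
       - (\<Prod>i=0..<N. (if i = p i then 1 else 0) - b i (p i)))
       \<le> (\<Prod>i=0..<N. u i (p i) + cmod (b i (p i) - a i (p i))) - (\<Prod>i=0..<N. u i (p i))"
      by (rule norm_prod_diff_le) (auto simp: u_def intro: order_trans[OF norm_triangle_ineq4])
    then show "cmod (signof p * ((\<Prod>i=0..<N. (if i = p i then 1 else 0) - a i (p i)) -
        (\<Prod>i=0..<N. (if i = p i then 1 else 0) - b i (p i)))) \<le> F p"
      by (simp add: norm_mult norm_signof F_def e_def norm_minus_commute[of "b _ _"] del: norm_of_int)
  qed
  \<comment> \<open>The product-of-sums identity ranges over extensional functions on
    \<open>{0..<N}\<close>, so permutations are restricted to that set. Restriction is injective on
    \<open>P\<close> because permutations fix everything outside.\<close>
  also have "(\<Sum>p\<in>P. F p) = (\<Sum>q\<in>(\<lambda>p. restrict p {0..<N}) ` P. F q)"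
  proof (subst sum.reindex)
    show "inj_on (\<lambda>p. restrict p {0..<N}) P"
    proof (rule inj_onI)
      fix p q assume pq: "p \<in> P" "q \<in> P" and eq: "restrict p {0..<N} = restrict q {0..<N}"
      show "p = q"
      proof
        fix x show "p x = q x"
          using pq fun_cong[OF eq, of x] by (cases "x \<in> {0..<N}") (auto simp: P_def permutes_not_in)
      qed
    qed
    show "sum F P = sum (F \<circ> (\<lambda>p. restrict p {0..<N})) P"
      unfolding F_def o_def by (auto intro!: sum.cong prod.cong arg_cong2[of _ _ _ _ "(-)"])
  qed
  also have "\<dots> \<le> (\<Sum>q\<in>Q. F q)"
    by (rule sum_mono2) (use F0 in \<open>auto simp: Q_def P_def finite_PiE permutes_in_image\<close>)
  also have "\<dots> = (\<Prod>i=0..<N. \<Sum>j=0..<N. u i j + e i j) - (\<Prod>i=0..<N. \<Sum>j=0..<N. u i j)"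
    unfolding F_def Q_def by (simp add: sum_subtractf prod_sum_PiE)
  also have "\<dots> = (\<Prod>i=0..<N. (1 + (\<Sum>j=0..<N. cmod (b i j))) + (\<Sum>j=0..<N. e i j))
      - (\<Prod>i=0..<N. 1 + (\<Sum>j=0..<N. cmod (b i j)))"
    unfolding u_def by (simp add: sum.distrib sum.delta')
  also have "\<dots> \<le> (\<Prod>i=0..<N. 1 + (\<Sum>j=0..<N. cmod (b i j))) * ((\<Prod>i=0..<N. 1 + (\<Sum>j=0..<N. e i j)) - 1)"
  proof -
    have "(\<Prod>i=0..<N. (1 + (\<Sum>j=0..<N. cmod (b i j))) + (\<Sum>j=0..<N. e i j))
      \<le> (\<Prod>i=0..<N. (1 + (\<Sum>j=0..<N. cmod (b i j))) * (1 + (\<Sum>j=0..<N. e i j)))"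
    proof (intro prod_mono conjI)
      fix i
      have le: "1 + x + y \<le> (1 + x) * (1 + y)" "0 \<le> 1 + x + y" if "0 \<le> x" "0 \<le> y" for x y :: real
        using that by (auto simp: distrib_left distrib_right)
      have s: "0 \<le> (\<Sum>j=0..<N. cmod (b i j))" "0 \<le> (\<Sum>j=0..<N. e i j)"
        by (auto intro!: sum_nonneg e0)
      show "1 + (\<Sum>j=0..<N. cmod (b i j)) + (\<Sum>j=0..<N. e i j)
        \<le> (1 + (\<Sum>j=0..<N. cmod (b i j))) * (1 + (\<Sum>j=0..<N. e i j))"
        "0 \<le> 1 + (\<Sum>j=0..<N. cmod (b i j)) + (\<Sum>j=0..<N. e i j)"
        using le[OF s] by auto
    qed
    then show ?thesis unfolding prod.distrib by (simp add: right_diff_distrib)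
  qed
  also have "\<dots> \<le> exp (\<Sum>i=0..<N. \<Sum>j=0..<N. cmod (b i j)) * (exp (\<Sum>i=0..<N. \<Sum>j=0..<N. e i j) - 1)"
  proof (rule mult_mono)
    show "(\<Prod>i=0..<N. 1 + (\<Sum>j=0..<N. cmod (b i j))) \<le> exp (\<Sum>i=0..<N. \<Sum>j=0..<N. cmod (b i j))"
      by (rule prod_le_exp_sum) (simp add: sum_nonneg)
    show "(\<Prod>i=0..<N. 1 + (\<Sum>j=0..<N. e i j)) - 1 \<le> exp (\<Sum>i=0..<N. \<Sum>j=0..<N. e i j) - 1"
      using prod_le_exp_sum[of "{0..<N}" "\<lambda>i. \<Sum>j=0..<N. e i j"] e0 by (simp add: sum_nonneg)
    have "1 \<le> (\<Prod>i=0..<N. 1 + (\<Sum>j=0..<N. e i j))"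
      by (rule prod_ge_1) (simp add: e0 sum_nonneg)
    then show "0 \<le> (\<Prod>i=0..<N. 1 + (\<Sum>j=0..<N. e i j)) - 1" by simp
  qed simp
  finally show ?thesis
    by (simp add: block_norm_def e_def atLeast0LessThan)
qed

lemma fdet_0 [simp]: "fdet N (\<lambda>_ _. 0) = 1"
proof -
  have "Matrix.mat N N (\<lambda>(i, j). (if i = j then 1 else 0) - 0) = (1\<^sub>m N :: complex mat)"
    by (auto intro!: eq_matI)
  then show ?thesis unfolding fdet_def by simp
qed

lemma fdet_minus_1_le: "cmod (fdet N a - 1) \<le> exp (block_norm N a) - 1"
  using fdet_diff_le[of N a "\<lambda>_ _. 0"] by (simp add: block_norm_def)

lemma norm_fdet_le: "cmod (fdet N a) \<le> exp (block_norm N a)"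
proof -
  have "cmod (fdet N a) \<le> cmod (fdet N a - 1) + 1"
    using norm_triangle_ineq[of "fdet N a - 1" 1] by simp
  then show ?thesis using fdet_minus_1_le[of N a] by simp
qed

lemma fdet_Suc_zero_row:
  assumes "\<And>j. j \<le> N \<Longrightarrow> a N j = 0"
  shows "fdet (Suc N) a = fdet N a"
proof -
  let ?f = "\<lambda>(i, j). (if i = j then 1 else 0) - a i j"
  have "Matrix.mat (Suc N) (Suc N) ?f = four_block_mat (Matrix.mat N N ?f)
     (Matrix.mat N 1 (\<lambda>(i, j). - a i N)) (0\<^sub>m 1 N) (1\<^sub>m 1)"
    using assms by (intro eq_matI) (auto simp: less_Suc_eq)
  then show ?thesis
    unfolding fdet_def by (simp add: det_four_block_mat_lower_left_zero[of _ N _ 1])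
qed

definition trunc :: "nat \<Rightarrow> (nat \<Rightarrow> nat \<Rightarrow> complex) \<Rightarrow> nat \<Rightarrow> nat \<Rightarrow> complex" where
  "trunc N a i j = (if i < N \<and> j < N then a i j else 0)"

text \<open>Every row added to \<open>1 - trunc N a\<close> is a unit row. This puts sections of
  sizes \<open>N \<le> M\<close> into one matrix space, where \<open>fdet_diff_le\<close> compares
  them.\<close>

lemma fdet_trunc:
  assumes "N \<le> M" shows "fdet M (trunc N a) = fdet N a"
  using assms
proof (induction M rule: dec_induct)
  case base
  show ?case unfolding fdet_def trunc_def
    by (rule arg_cong[of _ _ Determinant.det]) (auto intro!: eq_matI)
next
  case (step M)
  have "fdet (Suc M) (trunc N a) = fdet M (trunc N a)"
    by (rule fdet_Suc_zero_row) (use step.hyps in \<open>auto simp: trunc_def\<close>)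
  then show ?case using step.IH by simp
qed

lemma block_norm_nonneg: "0 \<le> block_norm N a"
  by (auto simp: block_norm_def intro!: sum_nonneg)

lemma block_norm_diff_trunc:
  assumes "N \<le> M"
  shows "block_norm M (\<lambda>i j. a i j - trunc N a i j) = block_norm M a - block_norm N a"
proof -
  have "block_norm N a = (\<Sum>(i,j)\<in>{..<M}\<times>{..<M}. if (i,j) \<in> {..<N}\<times>{..<N} then cmod (a i j) else 0)"
    unfolding block_norm_def sum.cartesian_product
    by (rule sum.mono_neutral_cong_left) (use assms in \<open>auto split: if_splits\<close>)
  also have "\<dots> = block_norm M (trunc N a)"
    unfolding block_norm_def sum.cartesian_product
    by (rule sum.cong) (auto simp: trunc_def)
  finally have 1: "block_norm M (trunc N a) = block_norm N a" by simp
  have "block_norm M a = block_norm M (\<lambda>i j. a i j - trunc N a i j) + block_norm M (trunc N a)"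
    unfolding block_norm_def sum.distrib[symmetric] by (intro sum.cong refl) (auto simp: trunc_def)
  then show ?thesis using 1 by simp
qed

lemma fdet_diff_block:
  assumes "N \<le> M"
  shows "cmod (fdet M a - fdet N a) \<le> exp (block_norm M a) * (exp (block_norm M a - block_norm N a) - 1)"
proof -
  have "block_norm M (trunc N a) \<le> block_norm M a"
    unfolding block_norm_def by (intro sum_mono) (auto simp: trunc_def)
  then have "exp (block_norm M (trunc N a)) * (exp (block_norm M a - block_norm N a) - 1)
    \<le> exp (block_norm M a) * (exp (block_norm M a - block_norm N a) - 1)"
    using block_norm_nonneg[of M "\<lambda>i j. a i j - trunc N a i j"] block_norm_diff_trunc[OF assms, of a]
    by (intro mult_right_mono) auto
  with fdet_diff_le[of M a "trunc N a"] show ?thesis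
    by (simp add: fdet_trunc[OF assms] block_norm_diff_trunc[OF assms])
qed

section \<open>Passage to infinite matrices with summable entries\<close>

definition nuclear :: "(nat \<Rightarrow> nat \<Rightarrow> complex) \<Rightarrow> bool" where
  "nuclear a \<longleftrightarrow> (\<lambda>(i, j). cmod (a i j)) summable_on UNIV"

definition nuclear_norm :: "(nat \<Rightarrow> nat \<Rightarrow> complex) \<Rightarrow> real" where
  "nuclear_norm a = (\<Sum>\<^sub>\<infinity>(i, j). cmod (a i j))"

text \<open>Finite partial sums converge termwise, and the majorant \<open>h\<close> makes the
  partial sums converge uniformly in \<open>n\<close>, so the two limits may be exchanged.\<close>

lemma infsum_dominated_tendsto:
  fixes f :: "nat \<Rightarrow> 'x \<Rightarrow> 'c::banach"
  assumes bd: "\<And>n x. x \<in> A \<Longrightarrow> norm (f n x) \<le> h x" and h: "h summable_on A"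
    and lim: "\<And>x. x \<in> A \<Longrightarrow> (\<lambda>n. f n x) \<longlonglongrightarrow> g x"
  shows "(\<lambda>n. \<Sum>\<^sub>\<infinity>x\<in>A. f n x) \<longlonglongrightarrow> (\<Sum>\<^sub>\<infinity>x\<in>A. g x)"
proof (rule swap_uniform_limit')
  show "\<forall>\<^sub>F X in finite_subsets_at_top A. (\<lambda>n. \<Sum>x\<in>X. f n x) \<longlonglongrightarrow> (\<Sum>x\<in>X. g x)"
    by (rule eventually_finite_subsets_at_top_weakI) (auto intro!: tendsto_sum lim)
  have "norm (g x) \<le> h x" if "x \<in> A" for x
    by (rule LIMSEQ_le_const2[OF tendsto_norm[OF lim[OF that]]]) (use bd[OF that] in auto)
  then have "(\<lambda>x. norm (g x)) summable_on A"
    by (rule Infinite_Sum.abs_summable_on_comparison_test'[OF h])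
  then show "(sum g \<longlongrightarrow> (\<Sum>\<^sub>\<infinity>x\<in>A. g x)) (finite_subsets_at_top A)"
    by (rule infsum_tendsto[OF Infinite_Sum.abs_summable_summable])
  show "uniform_limit UNIV (\<lambda>X n. \<Sum>x\<in>X. f n x) (\<lambda>n. \<Sum>\<^sub>\<infinity>x\<in>A. f n x) (finite_subsets_at_top A)"
    by (rule Weierstrass_m_test_general[OF _ h]) (use bd in auto)
qed auto

lemma block_norm_eq_sum: "block_norm N a = (\<Sum>(i, j)\<in>{..<N} \<times> {..<N}. cmod (a i j))"
  by (simp add: block_norm_def sum.cartesian_product)

lemma block_norm_le_nuclear: "nuclear a \<Longrightarrow> block_norm N a \<le> nuclear_norm a"
  unfolding block_norm_eq_sum nuclear_norm_def nuclear_def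
  by (rule finite_sum_le_infsum) auto

lemma nuclear_norm_nonneg: "0 \<le> nuclear_norm a"
  unfolding nuclear_norm_def by (auto intro: infsum_nonneg)

lemma squares_cofinal:
  "filterlim (\<lambda>N::nat. {..<N} \<times> {..<N}) (finite_subsets_at_top UNIV) sequentially"
  unfolding filterlim_finite_subsets_at_top
proof safe
  fix X :: "(nat \<times> nat) set" assume "finite X"
  then obtain m n where m: "\<And>p. p \<in> X \<Longrightarrow> fst p < m" and n: "\<And>p. p \<in> X \<Longrightarrow> snd p < n"
    using finite_nat_set_iff_bounded[of "fst ` X"] finite_nat_set_iff_bounded[of "snd ` X"] by auto
  show "\<forall>\<^sub>F N in sequentially. finite ({..<N} \<times> {..<N}) \<and> X \<subseteq> {..<N} \<times> {..<N} \<and> {..<N} \<times> {..<N} \<subseteq> UNIV"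
    using eventually_ge_at_top[of "max m n"]
    by eventually_elim (use m n in \<open>force simp: subset_iff\<close>)
qed

lemma block_norm_tendsto:
  assumes "nuclear a" shows "(\<lambda>N. block_norm N a) \<longlonglongrightarrow> nuclear_norm a"
  unfolding block_norm_eq_sum nuclear_norm_def
  using filterlim_compose[OF infsum_tendsto squares_cofinal] assms unfolding nuclear_def by blast

definition fredholm :: "(nat \<Rightarrow> nat \<Rightarrow> complex) \<Rightarrow> complex" where
  "fredholm a = lim (\<lambda>N. fdet N a)"

lemma fdet_diff_nuclear:
  assumes "nuclear a" "N \<le> M"
  shows "cmod (fdet M a - fdet N a) \<le> exp (nuclear_norm a) * (exp (nuclear_norm a - block_norm N a) - 1)"
proof -
  have "0 \<le> block_norm M a - block_norm N a"
    using block_norm_diff_trunc[OF assms(2), of a] block_norm_nonneg by metis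
  then have "exp (block_norm M a) * (exp (block_norm M a - block_norm N a) - 1)
     \<le> exp (nuclear_norm a) * (exp (nuclear_norm a - block_norm N a) - 1)"
    using block_norm_le_nuclear[OF assms(1), of M] by (intro mult_mono) auto
  with fdet_diff_block[OF assms(2), of a] show ?thesis by simp
qed

lemma fdet_LIMSEQ:
  assumes "nuclear a" shows "(\<lambda>N. fdet N a) \<longlonglongrightarrow> fredholm a"
proof -
  let ?b = "\<lambda>N. exp (nuclear_norm a) * (exp (nuclear_norm a - block_norm N a) - 1)"
  have "?b \<longlonglongrightarrow> exp (nuclear_norm a) * (exp (nuclear_norm a - nuclear_norm a) - 1)"
    by (intro tendsto_intros block_norm_tendsto assms)
  then have b0: "?b \<longlonglongrightarrow> 0" by simp
  have "Cauchy (\<lambda>N. fdet N a)"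
  proof (rule CauchyI)
    fix e :: real assume "0 < e"
    then have "eventually (\<lambda>N. ?b N < e / 2) sequentially"
      by (intro order_tendstoD(2)[OF b0]) simp
    then obtain N where N: "?b N < e / 2" unfolding eventually_sequentially by blast
    have *: "cmod (fdet m a - fdet N a) < e / 2" if "N \<le> m" for m
      using fdet_diff_nuclear[OF assms that] N by simp
    have "cmod (fdet m a - fdet n a) < e" if "N \<le> m" "N \<le> n" for m n
      using norm_triangle_ineq4[of "fdet m a - fdet N a" "fdet n a - fdet N a"] *[of m] *[of n] that by simp
    then show "\<exists>M. \<forall>m\<ge>M. \<forall>n\<ge>M. cmod (fdet m a - fdet n a) < e" by blast
  qed
  then show ?thesis
    unfolding fredholm_def by (simp add: Cauchy_convergent_iff convergent_LIMSEQ_iff)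
qed

text \<open>Letting the larger of two section sizes tend to infinity keeps an error bound that sees
  \<open>a\<close> only through its norm and its mass outside the block. Applied to
  \<open>a / z\<close>, the bound is uniform for \<open>z\<close> away from 0.\<close>

lemma fredholm_approx:
  assumes "nuclear a"
  shows "cmod (fredholm a - fdet N a) \<le> exp (nuclear_norm a) * (exp (nuclear_norm a - block_norm N a) - 1)"
proof (rule LIMSEQ_le_const2)
  show "(\<lambda>M. cmod (fdet M a - fdet N a)) \<longlonglongrightarrow> cmod (fredholm a - fdet N a)"
    by (intro tendsto_intros fdet_LIMSEQ assms)
qed (use fdet_diff_nuclear[OF assms] in blast)

lemma nuclear_comparison:
  assumes "nuclear b" "\<And>i j. cmod (a i j) \<le> cmod (b i j)"
  shows "nuclear a"
  using assms(1) unfolding nuclear_def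
  by (rule summable_on_comparison_test) (use assms(2) in auto)

lemma nuclear_add: "nuclear a \<Longrightarrow> nuclear b \<Longrightarrow> nuclear (\<lambda>i j. a i j + b i j)"
  unfolding nuclear_def
  by (rule summable_on_comparison_test[OF summable_on_add[of "\<lambda>(i,j). cmod (a i j)" UNIV "\<lambda>(i,j). cmod (b i j)"]])
     (auto intro: norm_triangle_ineq)

lemma nuclear_cmult: "nuclear a \<Longrightarrow> nuclear (\<lambda>i j. c * a i j)"
  unfolding nuclear_def
  using summable_on_cmult_right[of "\<lambda>(i,j). cmod (a i j)" UNIV "cmod c"]
  by (simp add: norm_mult case_prod_unfold)

lemma nuclear_divide: "nuclear a \<Longrightarrow> nuclear (\<lambda>i j. a i j / c)"
  using nuclear_cmult[of a "1 / c"] by simp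

lemma nuclear_diff: "nuclear a \<Longrightarrow> nuclear b \<Longrightarrow> nuclear (\<lambda>i j. a i j - b i j)"
  using nuclear_add[of a "\<lambda>i j. (-1) * b i j"] nuclear_cmult[of b "-1"] by simp

lemma nuclear_norm_divide: "nuclear_norm (\<lambda>i j. a i j / c) = nuclear_norm a / cmod c"
proof -
  have "nuclear_norm (\<lambda>i j. a i j / c) = (\<Sum>\<^sub>\<infinity>p. (1 / cmod c) * (\<lambda>(i,j). cmod (a i j)) p)"
    unfolding nuclear_norm_def by (rule infsum_cong) (auto simp: norm_divide)
  also have "\<dots> = (1 / cmod c) * nuclear_norm a"
    unfolding nuclear_norm_def by (rule infsum_cmult_right')
  finally show ?thesis by simp
qed

lemma block_norm_divide: "block_norm N (\<lambda>i j. a i j / c) = block_norm N a / cmod c"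
  by (simp add: block_norm_def norm_divide sum_divide_distrib)

lemma fredholm_diff_le:
  assumes "nuclear a" "nuclear b"
  shows "cmod (fredholm a - fredholm b) \<le> exp (nuclear_norm b) * (exp (nuclear_norm (\<lambda>i j. a i j - b i j)) - 1)"
proof (rule LIMSEQ_le)
  show "(\<lambda>M. cmod (fdet M a - fdet M b)) \<longlonglongrightarrow> cmod (fredholm a - fredholm b)"
    by (intro tendsto_intros fdet_LIMSEQ assms)
  show "(\<lambda>N. exp (block_norm N b) * (exp (block_norm N (\<lambda>i j. a i j - b i j)) - 1)) \<longlonglongrightarrow>
    exp (nuclear_norm b) * (exp (nuclear_norm (\<lambda>i j. a i j - b i j)) - 1)"
    by (intro tendsto_intros block_norm_tendsto assms nuclear_diff)
qed (use fdet_diff_le in blast)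

lemma fredholm_minus_1_le:
  assumes "nuclear a" shows "cmod (fredholm a - 1) \<le> exp (nuclear_norm a) - 1"
proof (rule LIMSEQ_le)
  show "(\<lambda>M. cmod (fdet M a - 1)) \<longlonglongrightarrow> cmod (fredholm a - 1)"
    by (intro tendsto_intros fdet_LIMSEQ assms)
  show "(\<lambda>N. exp (block_norm N a) - 1) \<longlonglongrightarrow> exp (nuclear_norm a) - 1"
    by (intro tendsto_intros block_norm_tendsto assms)
qed (use fdet_minus_1_le in blast)

text \<open>With \<open>a / z\<close> instead of \<open>z * a\<close> the zeros are the nonzero
  eigenvalues themselves. At \<open>z = 0\<close> division by zero turns the matrix into 0 and the
  value into 1, so statements about zeros exclude this point.\<close>

definition char_det :: "(nat \<Rightarrow> nat \<Rightarrow> complex) \<Rightarrow> complex \<Rightarrow> complex" where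
  "char_det a z = fredholm (\<lambda>i j. a i j / z)"

lemma char_det_holomorphic:
  assumes "nuclear a" shows "char_det a holomorphic_on - {0}"
proof (rule holomorphic_uniform_sequence)
  show "(\<lambda>z. fdet n (\<lambda>i j. a i j / z)) holomorphic_on - {0}" for n
    unfolding fdet_leibniz
    by (intro holomorphic_intros holomorphic_on_sum holomorphic_on_prod) auto
  fix x :: complex assume x: "x \<in> - {0}"
  \<comment> \<open>All points within \<open>cmod x / 2\<close> of \<open>x\<close> have modulus at
    least \<open>m\<close>, which makes the error \<open>c N\<close> independent of the
    point.\<close>
  define m where "m = cmod x / 2"
  have m: "m > 0" using x by (simp add: m_def)
  have mz: "m \<le> cmod z" if "z \<in> cball x m" for z
    using that norm_triangle_ineq2[of x z] by (simp add: m_def dist_norm norm_minus_commute)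
  define c where "c N = exp (nuclear_norm a / m) * (exp ((nuclear_norm a - block_norm N a) / m) - 1)" for N
  have "c \<longlonglongrightarrow> exp (nuclear_norm a / m) * (exp ((nuclear_norm a - nuclear_norm a) / m) - 1)"
    unfolding c_def using m by (intro tendsto_intros block_norm_tendsto assms) auto
  then have c0: "c \<longlonglongrightarrow> 0" by simp
  have bd: "dist (fdet N (\<lambda>i j. a i j / z)) (char_det a z) \<le> c N" if z: "z \<in> cball x m" for N z
  proof -
    have le: "t / cmod z \<le> t / m" if "0 \<le> t" for t :: real
      using mz[OF z] m that by (simp add: frac_le)
    have "cmod (char_det a z - fdet N (\<lambda>i j. a i j / z)) \<le> exp (nuclear_norm a / cmod z) *
       (exp (nuclear_norm a / cmod z - block_norm N a / cmod z) - 1)"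
      unfolding char_det_def
      using fredholm_approx[OF nuclear_divide[OF assms], of z N]
      by (simp add: nuclear_norm_divide block_norm_divide)
    also have "\<dots> \<le> c N"
      unfolding c_def diff_divide_distrib[symmetric]
      using le[OF nuclear_norm_nonneg[of a]] le[of "nuclear_norm a - block_norm N a"] block_norm_le_nuclear[OF assms, of N]
      by (intro mult_mono) auto
    finally show ?thesis by (simp add: dist_norm norm_minus_commute)
  qed
  show "\<exists>d>0. cball x d \<subseteq> - {0} \<and> uniform_limit (cball x d) (\<lambda>N z. fdet N (\<lambda>i j. a i j / z)) (char_det a) sequentially"
  proof (intro exI[of _ m] conjI m)
    show "cball x m \<subseteq> - {0}"
    proof
      fix z assume "z \<in> cball x m"
      then show "z \<in> - {0}" using mz[of z] m by auto
    qed
    show "uniform_limit (cball x m) (\<lambda>N z. fdet N (\<lambda>i j. a i j / z)) (char_det a) sequentially"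
    proof (rule uniform_limitI)
      fix e :: real assume "0 < e"
      then have "\<forall>\<^sub>F N in sequentially. c N < e" using c0 by (intro order_tendstoD) auto
      then show "\<forall>\<^sub>F N in sequentially. \<forall>z\<in>cball x m. dist (fdet N (\<lambda>i j. a i j / z)) (char_det a z) < e"
      proof eventually_elim
        case (elim N)
        show ?case
        proof
          fix z assume "z \<in> cball x m"
          from le_less_trans[OF bd[OF this] elim]
          show "dist (fdet N (\<lambda>i j. a i j / z)) (char_det a z) < e" .
        qed
      qed
    qed
  qed
qed auto

text \<open>Where \<open>nuclear_norm a / cmod z < ln 2\<close>, the determinant differs from 1 by
  less than \<open>exp (ln 2) - 1 = 1\<close>. So it is not identically zero, and its zeros in the
  connected punctured plane are isolated.\<close>

lemma char_det_nonzero_far: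
  assumes "nuclear a" "cmod z > nuclear_norm a / ln 2" "z \<noteq> 0"
  shows "char_det a z \<noteq> 0"
proof
  assume 0: "char_det a z = 0"
  have "nuclear_norm a / cmod z < ln 2"
    using assms(2,3) by (simp add: field_simps)
  then have "exp (nuclear_norm a / cmod z) < 2"
    by (metis exp_less_cancel_iff exp_ln zero_less_numeral)
  moreover have "cmod (char_det a z - 1) \<le> exp (nuclear_norm a / cmod z) - 1"
    unfolding char_det_def
    using fredholm_minus_1_le[OF nuclear_divide[OF assms(1)]] by (simp add: nuclear_norm_divide)
  ultimately show False using 0 by simp
qed

section \<open>Zeros of the determinant and eigenvectors\<close>

definition mapp :: "(nat \<Rightarrow> nat \<Rightarrow> complex) \<Rightarrow> (nat \<Rightarrow> complex) \<Rightarrow> nat \<Rightarrow> complex" where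
  "mapp a x i = (\<Sum>\<^sub>\<infinity>j. a i j * x j)"

lemma nuclear_row: "nuclear a \<Longrightarrow> (\<lambda>j. cmod (a i j)) summable_on UNIV"
  unfolding nuclear_def
  using Infinite_Sum.abs_summable_on_Sigma_iff[of "\<lambda>(i,j). a i j" UNIV "\<lambda>_. UNIV"]
  by (simp add: case_prod_unfold)

lemma nuclear_mult_bounded:
  assumes "nuclear a" "\<And>j. cmod (x j) \<le> C"
  shows "(\<lambda>(i, j). cmod (a i j * x j)) summable_on UNIV" "(\<lambda>j. cmod (a i j * x j)) summable_on UNIV"
    "(\<lambda>j. a i j * x j) summable_on UNIV"
proof -
  have "nuclear (\<lambda>i j. a i j * x j)"
  proof (rule nuclear_comparison[OF nuclear_cmult[OF assms(1), of "of_real C"]])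
    have "0 \<le> C" using norm_ge_zero assms(2) order_trans by blast
    then show "cmod (a i j * x j) \<le> cmod (complex_of_real C * a i j)" for i j
      using assms(2)[of j] by (simp add: norm_mult mult.commute[of C] mult_left_mono)
  qed
  then show "(\<lambda>(i, j). cmod (a i j * x j)) summable_on UNIV"
    and s: "(\<lambda>j. cmod (a i j * x j)) summable_on UNIV"
    using nuclear_row[of "\<lambda>i j. a i j * x j" i] by (auto simp: nuclear_def)
  show "(\<lambda>j. a i j * x j) summable_on UNIV"
    by (rule Infinite_Sum.abs_summable_summable[OF s])
qed

lemma mapp_finite_support:
  assumes "\<And>j. j \<ge> N \<Longrightarrow> x j = 0"
  shows "mapp a x i = (\<Sum>j<N. a i j * x j)"
proof -
  have "mapp a x i = (\<Sum>\<^sub>\<infinity>j\<in>{..<N}. a i j * x j)"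
    unfolding mapp_def by (rule infsum_cong_neutral) (use assms in \<open>auto simp: not_less\<close>)
  then show ?thesis by simp
qed

lemma mapp_tendsto:
  assumes "nuclear a" "\<And>m j. cmod (y m j) \<le> C" "\<And>j. (\<lambda>m. y m j) \<longlonglongrightarrow> x j"
  shows "(\<lambda>m. mapp a (y m) i) \<longlonglongrightarrow> mapp a x i"
  unfolding mapp_def
proof (rule infsum_dominated_tendsto)
  show "norm (a i j * y m j) \<le> cmod (a i j) * C" for m j
    using assms(2) by (simp add: norm_mult mult_left_mono)
  show "(\<lambda>j. cmod (a i j) * C) summable_on UNIV"
    by (intro summable_on_cmult_left nuclear_row assms)
  show "(\<lambda>m. a i j * y m j) \<longlonglongrightarrow> a i j * x j" for j
    by (intro tendsto_intros assms)
qed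

text \<open>Fubini for the absolutely summable double family \<open>a i j * x j\<close>. It upgrades
  a bounded eigenvector with nonzero eigenvalue to an absolutely summable one, and the second bound
  controls the mass of the image even when \<open>x\<close> is only known entrywise.\<close>

lemma mapp_abs_summable:
  assumes "nuclear a" "\<And>j. cmod (x j) \<le> C"
  shows "(\<lambda>i. cmod (mapp a x i)) summable_on UNIV"
    "(\<Sum>\<^sub>\<infinity>i. cmod (mapp a x i)) \<le> (\<Sum>\<^sub>\<infinity>(i, j). cmod (a i j) * cmod (x j))"
proof -
  have s: "(\<lambda>p. cmod ((\<lambda>(i,j). a i j * x j) p)) summable_on Sigma UNIV (\<lambda>_. UNIV)"
    using nuclear_mult_bounded(1)[OF assms] by (simp add: case_prod_unfold)
  have row: "(\<lambda>j. cmod (a i j * x j)) summable_on UNIV" for i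
    using nuclear_mult_bounded(2)[OF assms] .
  have r: "(\<lambda>i. \<Sum>\<^sub>\<infinity>j. cmod (a i j * x j)) summable_on UNIV"
    using s unfolding Infinite_Sum.abs_summable_on_Sigma_iff by (simp add: infsum_nonneg)
  have le: "cmod (mapp a x i) \<le> (\<Sum>\<^sub>\<infinity>j. cmod (a i j * x j))" for i
    unfolding mapp_def by (rule Infinite_Sum.norm_infsum_bound[OF row])
  show abs: "(\<lambda>i. cmod (mapp a x i)) summable_on UNIV"
    by (rule Infinite_Sum.abs_summable_on_comparison_test'[OF r le])
  have "(\<Sum>\<^sub>\<infinity>i. cmod (mapp a x i)) \<le> (\<Sum>\<^sub>\<infinity>i. \<Sum>\<^sub>\<infinity>j. cmod (a i j * x j))"
    by (rule infsum_mono[OF abs r le])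
  also have "\<dots> = (\<Sum>\<^sub>\<infinity>(i, j). cmod (a i j) * cmod (x j))"
    using infsum_Sigma_banach[of "\<lambda>(i,j). cmod (a i j * x j)" UNIV "\<lambda>_. UNIV"] s
    by (simp add: case_prod_unfold norm_mult)
  finally show "(\<Sum>\<^sub>\<infinity>i. cmod (mapp a x i)) \<le> (\<Sum>\<^sub>\<infinity>(i, j). cmod (a i j) * cmod (x j))" .
qed

text \<open>The cofactors along column \<open>k\<close> do not involve that column, so Laplace
  expansion is linear in it.\<close>

lemma det_replace_col_add:
  assumes A: "A \<in> carrier_mat n n" and x: "x \<in> carrier_vec n" and y: "y \<in> carrier_vec n" and k: "k < n"
  shows "Determinant.det (replace_col A (c \<cdot>\<^sub>v x + d \<cdot>\<^sub>v y) k) =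
     c * Determinant.det (replace_col A x k) + d * Determinant.det (replace_col A (y :: complex Matrix.vec) k)"
proof -
  have expand: "Determinant.det (replace_col A u k) = (\<Sum>i<n. u $ i * cofactor A i k)"
    if u: "u \<in> carrier_vec n" for u
  proof -
    have c: "replace_col A u k \<in> carrier_mat n n" using A by (auto simp: replace_col_def)
    have "mat_delete (replace_col A u k) i k = mat_delete A i k" if "i < n" for i
      using A k that by (intro eq_matI) (auto simp: replace_col_def mat_delete_def)
    then show ?thesis
      by (subst laplace_expansion_column[OF c k])
         (use A k in \<open>auto intro!: sum.cong simp: cofactor_def replace_col_def\<close>)
  qed
  show ?thesis
    using x y by (simp add: expand sum_distrib_left sum.distrib[symmetric] algebra_simps)
qed

text \<open>Wielandt deflation: if \<open>v\<close> is an eigenvector of \<open>a\<close> for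
  \<open>w\<close> and \<open>v i\<close> is nonzero, the deflated matrix sends \<open>v\<close> to
  0. The rank one correction is confined to column \<open>i\<close>, so once that column is replaced
  the two matrices agree.\<close>

definition deflate :: "(nat \<Rightarrow> nat \<Rightarrow> complex) \<Rightarrow> complex \<Rightarrow> (nat \<Rightarrow> complex) \<Rightarrow> nat \<Rightarrow> nat \<Rightarrow> nat \<Rightarrow> complex" where
  "deflate a w v i k l = a k l - (if l = i then w * v k / v i else 0)"

lemma nuclear_column:
  assumes "(\<lambda>k. cmod (v k)) summable_on UNIV"
  shows "nuclear (\<lambda>k l. if l = i then v k else 0)"
  unfolding nuclear_def
proof (rule iffD1[OF summable_on_cong_neutral[of UNIV "UNIV \<times> {i}"]])
  have "(\<lambda>p. cmod (v (fst p))) \<circ> (\<lambda>k. (k, i)) = (\<lambda>k. cmod (v k))" by auto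
  then have s: "(\<lambda>p. cmod (v (fst p))) summable_on ((\<lambda>k. (k, i)) ` UNIV)"
    using assms summable_on_reindex[of "\<lambda>k. (k, i)" UNIV "\<lambda>p. cmod (v (fst p))"] by (simp add: inj_on_def)
  have eq: "(\<lambda>k. (k, i)) ` UNIV = UNIV \<times> {i}" by auto
  show "(\<lambda>p. cmod (v (fst p))) summable_on UNIV \<times> {i}"
    using s unfolding eq .
qed (auto split: if_splits)

lemma nuclear_deflate:
  assumes "nuclear a" "(\<lambda>k. cmod (v k)) summable_on UNIV"
  shows "nuclear (deflate a w v i)"
  unfolding deflate_def
proof (rule nuclear_diff[OF assms(1)])
  show "nuclear (\<lambda>k l. if l = i then w * v k / v i else 0)"
    by (rule nuclear_comparison[OF nuclear_cmult[OF nuclear_column[OF assms(2)], of "w / v i" i]])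
       (simp add: norm_mult norm_divide)
qed

text \<open>Cramer's rule replaces column \<open>i\<close> of \<open>1 - a/z\<close> by its image of the truncated eigenvector \<open>v\<close>,
  which is \<open>(1 - w/z) v\<close> up to a tail; for the deflated matrix the same column becomes \<open>v\<close>.\<close>

lemma char_det_deflate:
  assumes a: "nuclear a" and v: "(\<lambda>k. cmod (v k)) summable_on UNIV"
    and eig: "\<And>k. mapp a v k = w * v k" and vi: "v i \<noteq> 0" and z: "z \<noteq> 0"
  shows "z * char_det a z = (z - w) * char_det (deflate a w v i) z"
proof -
  obtain C where C: "\<And>k. cmod (v k) \<le> C" and C0: "0 \<le> C"
  proof
    show "cmod (v k) \<le> (\<Sum>\<^sub>\<infinity>k. cmod (v k))" for k
      using finite_sum_le_infsum[OF v, of "{k}"] by simp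
  qed (simp add: infsum_nonneg)
  define b where "b = deflate a w v i"
  \<comment> \<open>For the eigenvector \<open>v\<close> this is \<open>1 / z\<close> times the
    tail, from index \<open>N\<close> on, of row \<open>k\<close> applied to \<open>v\<close>: the
    defect from truncating the eigenvalue equation.\<close>
  define e where "e N k = (v k * w - (\<Sum>l<N. a k l * v l)) / z" for N k
  define A where "A N = Matrix.mat N N (\<lambda>(k, l). (if k = l then 1 else 0) - a k l / z)" for N
  define B where "B N = Matrix.mat N N (\<lambda>(k, l). (if k = l then 1 else 0) - b k l / z)" for N
  define vN where "vN N = Matrix.vec N v" for N
  define eN where "eN N = Matrix.vec N (e N)" for N
  define \<Delta> where "\<Delta> N x = Determinant.det (replace_col (A N) x i)" for N x
  have AN: "A N \<in> carrier_mat N N" and BN: "B N \<in> carrier_mat N N"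
    and vC: "vN N \<in> carrier_vec N" and eC: "eN N \<in> carrier_vec N" for N
    by (auto simp: A_def B_def vN_def eN_def)
  have sumdelta: "(\<Sum>l<N. ((if k = l then 1 else 0) - c l) * v l) = v k - (\<Sum>l<N. c l * v l)"
    if "k < N" for k N and c :: "nat \<Rightarrow> complex"
  proof -
    have "(\<Sum>l<N. ((if k = l then 1 else 0) - c l) * v l) = (\<Sum>l<N. (if k = l then v l else 0)) - (\<Sum>l<N. c l * v l)"
      unfolding sum_subtractf[symmetric] by (rule sum.cong) (auto simp: algebra_simps)
    then show ?thesis using that by simp
  qed
  have Av: "A N *\<^sub>v vN N = (1 - w / z) \<cdot>\<^sub>v vN N + 1 \<cdot>\<^sub>v eN N" for N
  proof (rule eq_vecI)
    fix k assume "k < dim_vec ((1 - w / z) \<cdot>\<^sub>v vN N + 1 \<cdot>\<^sub>v eN N)"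
    then have k: "k < N" by (simp add: eN_def)
    have "(A N *\<^sub>v vN N) $ k = (\<Sum>l<N. ((if k = l then 1 else 0) - a k l / z) * v l)"
      using k by (auto simp: A_def vN_def scalar_prod_def atLeast0LessThan intro!: sum.cong)
    also have "\<dots> = v k - (\<Sum>l<N. a k l * v l) / z"
      using sumdelta[OF k, of "\<lambda>l. a k l / z"] by (simp add: sum_divide_distrib)
    finally show "(A N *\<^sub>v vN N) $ k = ((1 - w / z) \<cdot>\<^sub>v vN N + 1 \<cdot>\<^sub>v eN N) $ k"
      using k by (simp add: vN_def eN_def e_def diff_divide_distrib algebra_simps)
  qed (simp add: A_def eN_def)
  have Bv: "B N *\<^sub>v vN N = 1 \<cdot>\<^sub>v vN N + 1 \<cdot>\<^sub>v eN N" if i: "i < N" for N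
  proof (rule eq_vecI)
    fix k assume "k < dim_vec (1 \<cdot>\<^sub>v vN N + 1 \<cdot>\<^sub>v eN N)"
    then have k: "k < N" by (simp add: eN_def)
    have "(\<Sum>l<N. b k l / z * v l) = (\<Sum>l<N. a k l / z * v l - (if l = i then w * v k / z else 0))"
      by (rule sum.cong) (use vi in \<open>auto simp: b_def deflate_def diff_divide_distrib left_diff_distrib\<close>)
    also have "\<dots> = (\<Sum>l<N. a k l * v l) / z - w * v k / z"
      using i by (simp add: sum_subtractf sum_divide_distrib)
    finally have bs: "(\<Sum>l<N. b k l / z * v l) = (\<Sum>l<N. a k l * v l) / z - w * v k / z" .
    have "(B N *\<^sub>v vN N) $ k = (\<Sum>l<N. ((if k = l then 1 else 0) - b k l / z) * v l)"
      using k by (auto simp: B_def vN_def scalar_prod_def atLeast0LessThan intro!: sum.cong)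
    also have "\<dots> = v k - ((\<Sum>l<N. a k l * v l) / z - w * v k / z)"
      using sumdelta[OF k, of "\<lambda>l. b k l / z"] bs by simp
    finally show "(B N *\<^sub>v vN N) $ k = (1 \<cdot>\<^sub>v vN N + 1 \<cdot>\<^sub>v eN N) $ k"
      using k by (simp add: vN_def eN_def e_def diff_divide_distrib algebra_simps)
  qed (simp add: B_def eN_def)
  have rc: "replace_col (B N) x i = replace_col (A N) x i" for N x
    by (auto intro!: eq_matI simp: replace_col_def A_def B_def b_def deflate_def)
  have dA: "v i * Determinant.det (A N) = (1 - w / z) * \<Delta> N (vN N) + \<Delta> N (eN N)" if i: "i < N" for N
    using cramer_lemma_mat[OF AN vC i] det_replace_col_add[OF AN vC eC i, of "1 - w / z" 1] i
    unfolding Av \<Delta>_def by (simp add: vN_def)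
  have dB: "v i * Determinant.det (B N) = \<Delta> N (vN N) + \<Delta> N (eN N)" if i: "i < N" for N
    using cramer_lemma_mat[OF BN vC i] det_replace_col_add[OF AN vC eC i, of 1 1] i
    unfolding Bv[OF i] \<Delta>_def rc by (simp add: vN_def)
  \<comment> \<open>With these factors the two Cramer identities cancel
    \<open>\<Delta> N (vN N)\<close>, which need not be small; only the determinant with the defect
    column is left.\<close>
  have main: "v i * (z * Determinant.det (A N) - (z - w) * Determinant.det (B N)) = w * \<Delta> N (eN N)" if i: "i < N" for N
  proof -
    have "v i * (z * Determinant.det (A N) - (z - w) * Determinant.det (B N))
      = z * (v i * Determinant.det (A N)) - (z - w) * (v i * Determinant.det (B N))"
      by (simp add: algebra_simps)
    also have "\<dots> = w * \<Delta> N (eN N)"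
    proof -
      have "z * (1 - w / z) = z - w" using z by (simp add: right_diff_distrib)
      then have "z * ((1 - w / z) * \<Delta> N (vN N) + \<Delta> N (eN N)) = (z - w) * \<Delta> N (vN N) + z * \<Delta> N (eN N)"
        by (metis distrib_left mult.assoc)
      then show ?thesis unfolding dA[OF i] dB[OF i] by (simp add: algebra_simps)
    qed
    finally show ?thesis .
  qed
  define t where "t N = C * (nuclear_norm a - block_norm N a) / cmod z" for N
  have esum: "(\<Sum>k<N. cmod (e N k)) \<le> t N" for N
  proof -
    have "cmod (e N k) \<le> C / cmod z * (\<Sum>\<^sub>\<infinity>l\<in>{N..}. cmod (a k l))" for k
    proof -
      have row: "(\<lambda>l. cmod (a k l)) summable_on UNIV" by (rule nuclear_row[OF a])
      have s: "(\<lambda>l. a k l * v l) summable_on S" for S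
        by (rule summable_on_subset_banach[OF nuclear_mult_bounded(3)[OF a C]]) auto
      have "w * v k = (\<Sum>\<^sub>\<infinity>l\<in>{..<N} \<union> {N..}. a k l * v l)"
      proof -
        have U: "{..<N} \<union> {N..} = (UNIV :: nat set)" by auto
        show ?thesis using eig[of k] unfolding U mapp_def by simp
      qed
      also have "\<dots> = (\<Sum>l<N. a k l * v l) + (\<Sum>\<^sub>\<infinity>l\<in>{N..}. a k l * v l)"
        by (subst infsum_Un_disjoint) (auto intro: s)
      finally have "e N k = (\<Sum>\<^sub>\<infinity>l\<in>{N..}. a k l * v l) / z"
        by (simp add: e_def mult.commute)
      moreover have "cmod (\<Sum>\<^sub>\<infinity>l\<in>{N..}. a k l * v l) \<le> (\<Sum>\<^sub>\<infinity>l\<in>{N..}. C * cmod (a k l))"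
      proof (rule norm_infsum_le)
        show "((\<lambda>l. a k l * v l) has_sum (\<Sum>\<^sub>\<infinity>l\<in>{N..}. a k l * v l)) {N..}"
          by (rule has_sum_infsum[OF s])
        show "((\<lambda>l. C * cmod (a k l)) has_sum (\<Sum>\<^sub>\<infinity>l\<in>{N..}. C * cmod (a k l))) {N..}"
          by (intro has_sum_infsum summable_on_cmult_right summable_on_subset_banach[OF row]) auto
      qed (use C in \<open>simp add: norm_mult mult.commute mult_right_mono\<close>)
      ultimately show ?thesis
        by (simp add: norm_divide infsum_cmult_right' divide_right_mono)
    qed
    then have "(\<Sum>k<N. cmod (e N k)) \<le> (\<Sum>k<N. C / cmod z * (\<Sum>\<^sub>\<infinity>l\<in>{N..}. cmod (a k l)))"
      by (rule sum_mono)
    also have "\<dots> = C / cmod z * (\<Sum>k<N. \<Sum>\<^sub>\<infinity>l\<in>{N..}. cmod (a k l))"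
      by (simp add: sum_distrib_left)
    also have "(\<Sum>k<N. \<Sum>\<^sub>\<infinity>l\<in>{N..}. cmod (a k l)) \<le> nuclear_norm a - block_norm N a"
    proof -
      have all: "(\<lambda>(k,l). cmod (a k l)) summable_on S" for S
        using a unfolding nuclear_def by (rule summable_on_subset_banach) auto
      have "(\<Sum>k<N. \<Sum>\<^sub>\<infinity>l\<in>{N..}. cmod (a k l)) = (\<Sum>\<^sub>\<infinity>(k,l)\<in>{..<N} \<times> {N..}. cmod (a k l))"
        using infsum_Sigma_banach[where A = "{..<N}" and B = "\<lambda>_. {N..}" and f = "\<lambda>(k,l). cmod (a k l)", OF all]
        by simp
      moreover have "block_norm N a = (\<Sum>\<^sub>\<infinity>(k,l)\<in>{..<N} \<times> {..<N}. cmod (a k l))"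
        unfolding block_norm_eq_sum by simp
      moreover have "(\<Sum>\<^sub>\<infinity>(k,l)\<in>{..<N} \<times> {..<N}. cmod (a k l)) + (\<Sum>\<^sub>\<infinity>(k,l)\<in>{..<N} \<times> {N..}. cmod (a k l))
        = (\<Sum>\<^sub>\<infinity>(k,l)\<in>{..<N} \<times> {..<N} \<union> {..<N} \<times> {N..}. cmod (a k l))"
        by (rule infsum_Un_disjoint[symmetric]) (auto intro: all)
      moreover have "\<dots> \<le> nuclear_norm a"
        unfolding nuclear_norm_def by (rule infsum_mono_neutral) (auto intro: all)
      ultimately show ?thesis by simp
    qed
    finally show ?thesis
      using C0 by (simp add: t_def mult_left_mono divide_right_mono)
  qed
  have t0: "t \<longlonglongrightarrow> 0"
  proof -
    have "t \<longlonglongrightarrow> C * (nuclear_norm a - nuclear_norm a) / cmod z"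
      unfolding t_def using z by (intro tendsto_intros block_norm_tendsto a) auto
    then show ?thesis by simp
  qed
  \<comment> \<open>Column \<open>i\<close> of \<open>1 - c N\<close> is zero, so its determinant
    vanishes, and \<open>1 - c' N\<close> carries the defect \<open>e N\<close> in that column
    instead. The perturbation bound therefore estimates the defect determinant by the size of
    \<open>e N\<close>.\<close>
  define c where "c N k l = (if l = i then if k = i then 1 else 0 else a k l / z)" for N k l :: nat
  define c' where "c' N k l = (if l = i then (if k = i then 1 else 0) - e N k else a k l / z)" for N k l :: nat
  have \<Delta>e: "cmod (\<Delta> N (eN N)) \<le> exp (1 + nuclear_norm a / cmod z) * (exp (t N) - 1)" if i: "i < N" for N
  proof -
    have "\<Delta> N (eN N) = fdet N (c' N)"
      unfolding \<Delta>_def fdet_def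
      by (rule arg_cong[of _ _ Determinant.det]) (auto intro!: eq_matI simp: replace_col_def A_def c'_def eN_def)
    moreover have "fdet N (c N) = 0"
    proof -
      let ?M = "Matrix.mat N N (\<lambda>(k, l). (if k = l then 1 else 0) - c N k l)"
      have "fdet N (c N) = (\<Sum>k<N. ?M $$ (k, i) * cofactor ?M k i)"
        unfolding fdet_def by (rule laplace_expansion_column[OF _ i]) simp
      also have "\<dots> = 0" using i by (intro sum.neutral) (auto simp: c_def)
      finally show ?thesis .
    qed
    moreover have "cmod (fdet N (c' N) - fdet N (c N)) \<le>
        exp (block_norm N (c N)) * (exp (block_norm N (\<lambda>k l. c' N k l - c N k l)) - 1)"
      by (rule fdet_diff_le)
    moreover have "\<dots> \<le> exp (1 + nuclear_norm a / cmod z) * (exp (t N) - 1)"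
    proof (intro mult_mono)
      have "block_norm N (c N) \<le> (\<Sum>k<N. \<Sum>l<N. (if l = i then if k = i then 1 else 0 else 0) + cmod (a k l / z))"
        unfolding block_norm_def by (intro sum_mono) (auto simp: c_def)
      also have "\<dots> = 1 + block_norm N a / cmod z"
        using i by (simp add: sum.distrib block_norm_def norm_divide sum_divide_distrib)
      also have "\<dots> \<le> 1 + nuclear_norm a / cmod z"
        using block_norm_le_nuclear[OF a, of N] by (simp add: divide_right_mono)
      finally show "exp (block_norm N (c N)) \<le> exp (1 + nuclear_norm a / cmod z)" by simp
      have "block_norm N (\<lambda>k l. c' N k l - c N k l) = (\<Sum>k<N. \<Sum>l<N. if l = i then cmod (e N k) else 0)"
        unfolding block_norm_def by (intro sum.cong) (auto simp: c_def c'_def)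
      also have "\<dots> = (\<Sum>k<N. cmod (e N k))" using i by simp
      also have "\<dots> \<le> t N" by (rule esum)
      finally show "exp (block_norm N (\<lambda>k l. c' N k l - c N k l)) - 1 \<le> exp (t N) - 1" by simp
    qed (auto simp: block_norm_nonneg)
    ultimately show ?thesis by simp
  qed
  have "(\<lambda>N. \<Delta> N (eN N)) \<longlonglongrightarrow> 0"
  proof (rule Lim_null_comparison)
    show "\<forall>\<^sub>F N in sequentially. cmod (\<Delta> N (eN N)) \<le> exp (1 + nuclear_norm a / cmod z) * (exp (t N) - 1)"
      using eventually_gt_at_top[of i] by eventually_elim (rule \<Delta>e)
    have "(\<lambda>N. exp (1 + nuclear_norm a / cmod z) * (exp (t N) - 1)) \<longlonglongrightarrow> exp (1 + nuclear_norm a / cmod z) * (exp 0 - 1)"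
      by (intro tendsto_intros t0)
    then show "(\<lambda>N. exp (1 + nuclear_norm a / cmod z) * (exp (t N) - 1)) \<longlonglongrightarrow> 0" by simp
  qed
  then have lim: "(\<lambda>N. w * \<Delta> N (eN N)) \<longlonglongrightarrow> w * 0" by (intro tendsto_intros)
  have "(\<lambda>N. v i * (z * Determinant.det (A N) - (z - w) * Determinant.det (B N))) \<longlonglongrightarrow> w * 0"
  proof (rule Lim_transform_eventually[OF lim])
    show "\<forall>\<^sub>F N in sequentially. w * \<Delta> N (eN N) =
        v i * (z * Determinant.det (A N) - (z - w) * Determinant.det (B N))"
      using eventually_gt_at_top[of i] by eventually_elim (simp only: main)
  qed
  moreover have "(\<lambda>N. v i * (z * Determinant.det (A N) - (z - w) * Determinant.det (B N)))
     \<longlonglongrightarrow> v i * (z * char_det a z - (z - w) * char_det b z)"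
  proof -
    have "(\<lambda>N. Determinant.det (A N)) \<longlonglongrightarrow> char_det a z"
      using fdet_LIMSEQ[OF nuclear_divide[OF a, of z]] unfolding A_def fdet_def char_det_def .
    moreover have "(\<lambda>N. Determinant.det (B N)) \<longlonglongrightarrow> char_det b z"
      using fdet_LIMSEQ[OF nuclear_divide[OF nuclear_deflate[OF a v, of w i], of z]]
      unfolding B_def b_def fdet_def char_det_def .
    ultimately show ?thesis by (intro tendsto_mult tendsto_diff tendsto_const)
  qed
  ultimately have "w * 0 = v i * (z * char_det a z - (z - w) * char_det b z)"
    by (rule LIMSEQ_unique)
  then show ?thesis using vi by (simp add: b_def)
qed

lemma mapp_divide: "mapp (\<lambda>i j. a i j / w) x k = mapp a x k / w"
proof -
  have "mapp (\<lambda>i j. a i j / w) x k = (\<Sum>\<^sub>\<infinity>j. (1 / w) * (a k j * x j))"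
    unfolding mapp_def by (rule infsum_cong) simp
  also have "\<dots> = (1 / w) * mapp a x k"
    unfolding mapp_def by (rule infsum_cmult_right')
  finally show ?thesis by simp
qed

text \<open>Normalised vectors that the finite sections of \<open>1 - b\<close> almost annihilate would subconverge
  entrywise to a nonzero fixed point of \<open>b\<close>.\<close>

lemma sections_bounded_below:
  assumes b: "nuclear b"
    and ff: "\<forall>x. (\<forall>k. cmod (x k) \<le> 1) \<longrightarrow> (\<forall>k. mapp b x k = x k) \<longrightarrow> x = (\<lambda>_. 0)"
  shows "\<exists>c N0. c > 0 \<and>
    (\<forall>N\<ge>N0. \<forall>x. c * (\<Sum>k<N. cmod (x k)) \<le> (\<Sum>k<N. cmod (x k - (\<Sum>l<N. b k l * x l))))"
proof (rule ccontr)
  assume neg: "\<not> ?thesis"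
  define D where "D N x = (\<Sum>k<N. cmod (x k - (\<Sum>l<N. b k l * x l)))" for N x
  define Z where "Z N x = (\<Sum>k<N. cmod (x k))" for N :: nat and x :: "nat \<Rightarrow> complex"
  \<comment> \<open>Failure of the bound for the constant \<open>1 / (m + 1)\<close> and the
    threshold \<open>m\<close> supplies sections of unbounded size with relative residual below
    \<open>1 / (m + 1)\<close>.\<close>
  have "\<exists>N x. N \<ge> m \<and> D N x < inverse (real (Suc m)) * Z N x" for m
  proof (rule ccontr)
    assume nex: "\<not> ?thesis"
    have "inverse (real (Suc m)) * Z N x \<le> D N x" if "N \<ge> m" for N x
      using nex that by (metis not_less)
    then have "inverse (real (Suc m)) > 0 \<and> (\<forall>N\<ge>m. \<forall>x. inverse (real (Suc m)) * Z N x \<le> D N x)"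
      by simp
    with neg show False unfolding D_def Z_def by blast
  qed
  then obtain N x where N: "\<And>m. N m \<ge> m" and small: "\<And>m. D (N m) (x m) < inverse (real (Suc m)) * Z (N m) (x m)"
    by metis
  note small = small[unfolded D_def Z_def]
  define S where "S m = (\<Sum>k<N m. cmod (x m k))" for m
  have S: "S m > 0" for m
  proof -
    have "0 \<le> (\<Sum>k<N m. cmod (x m k - (\<Sum>l<N m. b k l * x m l)))" by (auto intro: sum_nonneg)
    then have "0 < inverse (real (Suc m)) * S m" using small[of m] unfolding S_def by linarith
    then show ?thesis by (simp add: zero_less_mult_iff)
  qed
  define y where "y m k = (if k < N m then x m k / complex_of_real (S m) else 0)" for m k
  have ysum: "(\<Sum>k<N m. cmod (y m k)) = 1" for m
  proof -
    have "(\<Sum>k<N m. cmod (y m k)) = (\<Sum>k<N m. cmod (x m k)) / S m"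
      using S[of m] by (simp add: y_def norm_divide sum_divide_distrib)
    then show ?thesis using S[of m] by (simp add: S_def)
  qed
  have ybd: "cmod (y m k) \<le> 1" for m k
  proof (cases "k < N m")
    case True
    then show ?thesis using member_le_sum[of k "{..<N m}" "\<lambda>k. cmod (y m k)"] ysum[of m] by simp
  qed (simp add: y_def)
  have ymapp: "mapp b (y m) k = (\<Sum>l<N m. b k l * x m l) / complex_of_real (S m)" for m k
    by (subst mapp_finite_support[where N = "N m"]) (auto simp: y_def sum_divide_distrib)
  have ysmall: "(\<Sum>k<N m. cmod (y m k - mapp b (y m) k)) < inverse (real (Suc m))" for m
  proof -
    have "(\<Sum>k<N m. cmod (y m k - mapp b (y m) k)) = (\<Sum>k<N m. cmod (x m k - (\<Sum>l<N m. b k l * x m l)) / S m)"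
      using S[of m] by (intro sum.cong) (auto simp: ymapp y_def norm_divide simp flip: diff_divide_distrib)
    also have "\<dots> = (\<Sum>k<N m. cmod (x m k - (\<Sum>l<N m. b k l * x m l))) / S m"
      by (simp add: sum_divide_distrib)
    also have "\<dots> < inverse (real (Suc m))"
      using small[of m] S[of m] unfolding S_def[symmetric] by (simp add: pos_divide_less_eq)
    finally show ?thesis .
  qed
  obtain r where r: "strict_mono (r :: nat \<Rightarrow> nat)" and "\<And>k. \<exists>l. (\<lambda>m. y (r m) k) \<longlonglongrightarrow> l"
    using function_convergent_subsequence[of UNIV y 1] ybd by auto
  then obtain L where L: "\<And>k. (\<lambda>m. y (r m) k) \<longlonglongrightarrow> L k" by metis
  have Lbd: "cmod (L k) \<le> 1" for k
    by (rule LIMSEQ_le_const2[OF tendsto_norm[OF L]]) (use ybd in auto)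
  have inv_r: "inverse (real (Suc (r m))) \<le> inverse (real (Suc m))" for m
    using seq_suble[OF r, of m] by (intro le_imp_inverse_le) auto
  have "mapp b L k = L k" for k
  proof -
    have 1: "(\<lambda>m. y (r m) k - mapp b (y (r m)) k) \<longlonglongrightarrow> L k - mapp b L k"
      by (intro tendsto_diff L mapp_tendsto[OF b, where C = 1] ybd)
    have "(\<lambda>m. y (r m) k - mapp b (y (r m)) k) \<longlonglongrightarrow> 0"
    proof (rule Lim_null_comparison)
      show "\<forall>\<^sub>F m in sequentially. cmod (y (r m) k - mapp b (y (r m)) k) \<le> inverse (real (Suc m))"
        using eventually_gt_at_top[of k]
      proof eventually_elim
        case (elim m)
        then have "k < N (r m)" using N[of "r m"] seq_suble[OF r, of m] by linarith
        then have "cmod (y (r m) k - mapp b (y (r m)) k) \<le> (\<Sum>k<N (r m). cmod (y (r m) k - mapp b (y (r m)) k))"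
          by (intro member_le_sum[of k "{..<N (r m)}" "\<lambda>k. cmod (y (r m) k - mapp b (y (r m)) k)"]) auto
        then show ?case using ysmall[of "r m"] inv_r[of m] by linarith
      qed
    qed (rule LIMSEQ_inverse_real_of_nat)
    then show ?thesis using LIMSEQ_unique[OF 1] by fastforce
  qed
  then have L0: "L = (\<lambda>_. 0)" using ff Lbd by simp
  \<comment> \<open>Entrywise convergence to 0 could hide mass escaping to infinity. But the mass 1
    of \<open>y (r m)\<close> is at most the residual plus the mass of its image under
    \<open>b\<close>, and the latter tends to 0 by dominated convergence, because the entries of
    \<open>b\<close> are summable.\<close>
  define s where "s m = inverse (real (Suc m)) + (\<Sum>\<^sub>\<infinity>(i, j). cmod (b i j) * cmod (y (r m) j))" for m
  have "1 \<le> s m" for m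
  proof -
    let ?y = "y (r m)"
    have "1 = (\<Sum>k<N (r m). cmod (?y k))" using ysum by simp
    also have "\<dots> \<le> (\<Sum>k<N (r m). cmod (?y k - mapp b ?y k) + cmod (mapp b ?y k))"
      by (intro sum_mono) (metis diff_add_cancel norm_triangle_ineq)
    also have "\<dots> = (\<Sum>k<N (r m). cmod (?y k - mapp b ?y k)) + (\<Sum>k<N (r m). cmod (mapp b ?y k))"
      by (rule sum.distrib)
    also have "\<dots> \<le> inverse (real (Suc m)) + (\<Sum>\<^sub>\<infinity>k. cmod (mapp b ?y k))"
    proof (rule add_mono)
      show "(\<Sum>k<N (r m). cmod (?y k - mapp b ?y k)) \<le> inverse (real (Suc m))"
        using ysmall[of "r m"] inv_r[of m] by linarith
      show "(\<Sum>k<N (r m). cmod (mapp b ?y k)) \<le> (\<Sum>\<^sub>\<infinity>k. cmod (mapp b ?y k))"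
        by (rule finite_sum_le_infsum[OF mapp_abs_summable(1)[OF b ybd]]) auto
    qed
    also have "\<dots> \<le> s m"
      unfolding s_def using mapp_abs_summable(2)[OF b ybd] by simp
    finally show ?thesis .
  qed
  moreover have "s \<longlonglongrightarrow> 0 + (\<Sum>\<^sub>\<infinity>(i, j). cmod (b i j) * cmod (L j))"
    unfolding s_def
  proof (intro tendsto_add LIMSEQ_inverse_real_of_nat infsum_dominated_tendsto)
    show "(\<lambda>(i, j). cmod (b i j)) summable_on UNIV" using b by (simp add: nuclear_def)
    show "norm (case p of (i, j) \<Rightarrow> cmod (b i j) * cmod (y (r m) j)) \<le> (case p of (i, j) \<Rightarrow> cmod (b i j))" for m p
      using ybd by (auto simp: mult_left_le split: prod.split)
    show "(\<lambda>m. case p of (i, j) \<Rightarrow> cmod (b i j) * cmod (y (r m) j)) \<longlonglongrightarrow> (case p of (i, j) \<Rightarrow> cmod (b i j) * cmod (L j))" for p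
      by (auto intro!: tendsto_intros L split: prod.split)
  qed
  ultimately have "1 \<le> 0 + (\<Sum>\<^sub>\<infinity>(i, j). cmod (b i j) * cmod (L j))"
    by (intro LIMSEQ_le_const) auto
  then show False by (simp add: L0 case_prod_unfold)
qed

text \<open>The lower bound makes the section of \<open>1 - b\<close> injective, so its determinant
  is nonzero and the adjugate provides the inverse \<open>B\<close>. The determinant of
  \<open>B\<close> is written as an \<open>fdet\<close>, with \<open>1 - B\<close> as matrix, so
  that the general bounds for \<open>fdet\<close> apply to it.\<close>

lemma section_inverse:
  assumes c: "c > 0" and lb: "\<And>x. c * (\<Sum>k<N. cmod (x k)) \<le> (\<Sum>k<N. cmod (x k - (\<Sum>l<N. b k l * x l)))"
  obtains B where "\<And>k j. k < N \<Longrightarrow> j < N \<Longrightarrow> B k j - (\<Sum>l<N. b k l * B l j) = (if k = j then 1 else 0)"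
    "fdet N b * fdet N (\<lambda>k j. (if k = j then 1 else 0) - B k j) = 1"
proof -
  define A where "A = Matrix.mat N N (\<lambda>(k, l). (if k = l then 1 else 0) - b k l)"
  have A: "A \<in> carrier_mat N N" by (simp add: A_def)
  have sumdelta: "(\<Sum>l<N. ((if k = l then 1 else 0) - b k l) * x l) = x k - (\<Sum>l<N. b k l * x l)" if "k < N" for k x
  proof -
    have "(\<Sum>l<N. ((if k = l then 1 else 0) - b k l) * x l) = (\<Sum>l<N. (if k = l then x l else 0)) - (\<Sum>l<N. b k l * x l)"
      unfolding sum_subtractf[symmetric] by (rule sum.cong) (auto simp: algebra_simps)
    then show ?thesis using that by simp
  qed
  have dA: "Determinant.det A \<noteq> 0"
  proof
    assume "Determinant.det A = 0"
    then obtain v where v: "v \<in> carrier_vec N" "v \<noteq> 0\<^sub>v N" "A *\<^sub>v v = 0\<^sub>v N"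
      using det_0_iff_vec_prod_zero[OF A] by auto
    have "v $ k - (\<Sum>l<N. b k l * v $ l) = 0" if k: "k < N" for k
    proof -
      have "(A *\<^sub>v v) $ k = (\<Sum>l<N. ((if k = l then 1 else 0) - b k l) * v $ l)"
        using k v(1) by (auto simp: A_def scalar_prod_def atLeast0LessThan intro!: sum.cong)
      then show ?thesis using v(3) k sumdelta[OF k, of "\<lambda>l. v $ l"] by simp
    qed
    then have "c * (\<Sum>k<N. cmod (v $ k)) \<le> 0" using lb[of "\<lambda>k. v $ k"] by simp
    then have "(\<Sum>k<N. cmod (v $ k)) \<le> 0" using c by (simp add: mult_le_0_iff)
    then have "(\<Sum>k<N. cmod (v $ k)) = 0" by (simp add: antisym sum_nonneg)
    then have "\<forall>k<N. v $ k = 0" by (simp add: sum_nonneg_eq_0_iff)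
    then show False using v(1,2) by (auto intro!: eq_vecI)
  qed
  define B where "B k j = adj_mat A $$ (k, j) / Determinant.det A" for k j
  define B' where "B' = Matrix.mat N N (\<lambda>(k, j). B k j)"
  have B'C: "B' \<in> carrier_mat N N" by (simp add: B'_def)
  have "A * B' = 1\<^sub>m N"
  proof (rule eq_matI)
    fix k j assume "k < dim_row (1\<^sub>m N :: complex mat)" "j < dim_col (1\<^sub>m N :: complex mat)"
    then have kj: "k < N" "j < N" by auto
    have "(A * B') $$ (k, j) = (\<Sum>l<N. A $$ (k, l) * adj_mat A $$ (l, j)) / Determinant.det A"
      using kj A by (auto simp: B'_def B_def scalar_prod_def atLeast0LessThan sum_divide_distrib intro!: sum.cong)
    also have "(\<Sum>l<N. A $$ (k, l) * adj_mat A $$ (l, j)) = (A * adj_mat A) $$ (k, j)"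
      using kj A adj_mat(1)[OF A] by (auto simp: scalar_prod_def atLeast0LessThan intro!: sum.cong)
    also have "\<dots> = Determinant.det A * (if k = j then 1 else 0)"
      using adj_mat(2)[OF A] kj by simp
    finally show "(A * B') $$ (k, j) = 1\<^sub>m N $$ (k, j)" using kj dA by simp
  qed (auto simp: A_def B'_def)
  show thesis
  proof
    fix k j assume kj: "k < N" "j < N"
    have "(A * B') $$ (k, j) = (\<Sum>l<N. ((if k = l then 1 else 0) - b k l) * B l j)"
      using kj by (auto simp: A_def B'_def scalar_prod_def atLeast0LessThan intro!: sum.cong)
    then show "B k j - (\<Sum>l<N. b k l * B l j) = (if k = j then 1 else 0)"
      using sumdelta[OF kj(1), of "\<lambda>l. B l j"] \<open>A * B' = 1\<^sub>m N\<close> kj by simp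
  next
    have "Determinant.det A * Determinant.det B' = 1"
      using det_mult[OF A B'C] \<open>A * B' = 1\<^sub>m N\<close> by simp
    moreover have "fdet N (\<lambda>k j. (if k = j then 1 else 0) - B k j) = Determinant.det B'"
      by (simp add: fdet_def B'_def)
    ultimately show "fdet N b * fdet N (\<lambda>k j. (if k = j then 1 else 0) - B k j) = 1"
      by (simp add: fdet_def A_def)
  qed
qed

text \<open>Without a bounded fixed point the sections would be uniformly bounded below, and a
  uniform bound for the determinants of their inverses is a positive lower bound for the
  determinants of the sections. The limit could not vanish.\<close>

lemma fredholm_zero_fixpoint:
  assumes b: "nuclear b" and 0: "fredholm b = 0"
  obtains x where "\<And>k. cmod (x k) \<le> 1" "\<And>k. mapp b x k = x k" "x \<noteq> (\<lambda>_. 0)"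
proof (rule ccontr)
  assume neg: "\<not> thesis"
  have ff: "\<forall>x. (\<forall>k. cmod (x k) \<le> 1) \<longrightarrow> (\<forall>k. mapp b x k = x k) \<longrightarrow> x = (\<lambda>_. 0)"
  proof (intro allI impI, rule ccontr)
    fix x assume "\<forall>k. cmod (x k) \<le> 1" "\<forall>k. mapp b x k = x k" "x \<noteq> (\<lambda>_. 0)"
    then have thesis by (intro that[of x]) simp_all
    with neg show False ..
  qed
  obtain c N0 where c: "c > 0"
    and lb: "\<And>N x. N \<ge> N0 \<Longrightarrow> c * (\<Sum>k<N. cmod (x k)) \<le> (\<Sum>k<N. cmod (x k - (\<Sum>l<N. b k l * x l)))"
    using sections_bounded_below[OF b ff] by auto
  have "exp (- (nuclear_norm b / c)) \<le> cmod (fdet N b)" if N: "N \<ge> N0" for N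
  proof -
    obtain B where B: "\<And>k j. k < N \<Longrightarrow> j < N \<Longrightarrow> B k j - (\<Sum>l<N. b k l * B l j) = (if k = j then 1 else 0)"
      and dB: "fdet N b * fdet N (\<lambda>k j. (if k = j then 1 else 0) - B k j) = 1"
      by (rule section_inverse[OF c lb[OF N]]) (rule that)
    \<comment> \<open>On the section \<open>(1 - b) E = - b\<close>, so the entry sum of
      \<open>E\<close> is at most that of \<open>b\<close> divided by \<open>c\<close>,
      independently of \<open>N\<close>. The entry sum of the inverse itself grows with
      \<open>N\<close>.\<close>
    define E where "E k j = (if k = j then 1 else 0) - B k j" for k j
    have "c * block_norm N E \<le> block_norm N b"
    proof -
      have "c * (\<Sum>k<N. cmod (E k j)) \<le> (\<Sum>k<N. cmod (b k j))" if j: "j < N" for j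
      proof -
        have "E k j - (\<Sum>l<N. b k l * E l j) = - b k j" if k: "k < N" for k
        proof -
          have "(\<Sum>l<N. b k l * E l j) = (\<Sum>l<N. (if l = j then b k l else 0)) - (\<Sum>l<N. b k l * B l j)"
            unfolding sum_subtractf[symmetric] E_def by (rule sum.cong) (auto simp: algebra_simps)
          then have "(\<Sum>l<N. b k l * E l j) = b k j - (\<Sum>l<N. b k l * B l j)" using j by simp
          then show ?thesis using B[OF k j] by (simp add: E_def algebra_simps)
        qed
        then show ?thesis using lb[OF N, of "\<lambda>k. E k j"] by simp
      qed
      then have "(\<Sum>j<N. c * (\<Sum>k<N. cmod (E k j))) \<le> (\<Sum>j<N. \<Sum>k<N. cmod (b k j))"
        by (intro sum_mono) auto
      then show ?thesis
        unfolding block_norm_def sum_distrib_left[symmetric]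
        by (subst (1 2) sum.swap)
    qed
    then have "c * block_norm N E \<le> nuclear_norm b" using block_norm_le_nuclear[OF b, of N] by linarith
    then have "block_norm N E \<le> nuclear_norm b / c" using c by (simp add: field_simps)
    then have le: "cmod (fdet N E) \<le> exp (nuclear_norm b / c)"
      using norm_fdet_le[of N E] by (meson exp_le_cancel_iff order_trans)
    have "1 = cmod (fdet N b) * cmod (fdet N E)"
      using dB unfolding E_def[symmetric] norm_mult[symmetric] by simp
    also have "\<dots> \<le> cmod (fdet N b) * exp (nuclear_norm b / c)"
      using le by (intro mult_left_mono) auto
    finally show ?thesis by (simp add: exp_minus field_simps)
  qed
  then have "exp (- (nuclear_norm b / c)) \<le> cmod (fredholm b)"
    by (intro LIMSEQ_le_const[OF tendsto_norm[OF fdet_LIMSEQ[OF b]]]) auto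
  then show False using 0 by simp
qed

lemma char_det_zero_eigenvector:
  assumes a: "nuclear a" and w: "w \<noteq> 0" and 0: "char_det a w = 0"
  obtains x where "(\<lambda>k. cmod (x k)) summable_on UNIV" "\<And>k. mapp a x k = w * x k" "x \<noteq> (\<lambda>_. 0)"
proof -
  obtain x where x: "\<And>k. cmod (x k) \<le> 1" "\<And>k. mapp (\<lambda>i j. a i j / w) x k = x k" "x \<noteq> (\<lambda>_. 0)"
    using fredholm_zero_fixpoint[OF nuclear_divide[OF a]] 0 unfolding char_det_def by blast
  have "mapp (\<lambda>i j. a i j / w) x = x" using x(2) by auto
  then have s: "(\<lambda>k. cmod (x k)) summable_on UNIV"
    using mapp_abs_summable(1)[of "\<lambda>i j. a i j / w" x 1, OF nuclear_divide[OF a] x(1)] by simp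
  show thesis
    by (rule that[OF s _ x(3)]) (use x(2) w in \<open>simp add: mapp_divide field_simps\<close>)
qed

lemma eigenvector_char_det_zero:
  assumes a: "nuclear a" and w: "w \<noteq> 0" and x: "(\<lambda>k. cmod (x k)) summable_on UNIV"
    "\<And>k. mapp a x k = w * x k" "x \<noteq> (\<lambda>_. 0)"
  shows "char_det a w = 0"
proof -
  obtain i where "x i \<noteq> 0" using x(3) by auto
  from char_det_deflate[OF a x(1,2) this w] show ?thesis using w by simp
qed

lemma summable_imp_bounded:
  assumes "(\<lambda>k. cmod (x k)) summable_on UNIV"
  shows "cmod (x k) \<le> (\<Sum>\<^sub>\<infinity>k. cmod (x k))"
  using finite_sum_le_infsum[OF assms, of "{k}"] by simp

text \<open>A nonzero determinant excludes bounded fixed points of \<open>a / w\<close>, so the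
  finite sections are stable: their solutions have norm at most \<open>1 / c\<close> times that of
  the right-hand side. A diagonal subsequence converges entrywise, and \<open>mapp_tendsto\<close>
  carries the equation to the limit.\<close>

lemma nuclear_resolvent:
  assumes a: "nuclear a" and w: "w \<noteq> 0" and nz: "char_det a w \<noteq> 0"
  obtains C where "C \<ge> 0"
    "\<And>g. (\<lambda>k. cmod (g k)) summable_on UNIV \<Longrightarrow>
      \<exists>f. (\<lambda>k. cmod (f k)) summable_on UNIV \<and> (\<forall>k. w * f k - mapp a f k = g k) \<and>
          (\<Sum>\<^sub>\<infinity>k. cmod (f k)) \<le> C * (\<Sum>\<^sub>\<infinity>k. cmod (g k))"
proof -
  define b where "b i j = a i j / w" for i j
  have b: "nuclear b" unfolding b_def by (rule nuclear_divide[OF a])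
  have ff: "\<forall>x. (\<forall>k. cmod (x k) \<le> 1) \<longrightarrow> (\<forall>k. mapp b x k = x k) \<longrightarrow> x = (\<lambda>_. 0)"
  proof (intro allI impI, rule ccontr)
    fix x assume x: "\<forall>k. cmod (x k) \<le> 1" "\<forall>k. mapp b x k = x k" and "x \<noteq> (\<lambda>_. 0)"
    note x = x[rule_format]
    note \<open>x \<noteq> (\<lambda>_. 0)\<close>
    moreover have "mapp b x = x" using x(2) by auto
    then have "(\<lambda>k. cmod (x k)) summable_on UNIV" using mapp_abs_summable(1)[of b x 1, OF b x(1)] by simp
    moreover have "mapp a x k = w * x k" for k
      using x(2)[of k] w unfolding b_def mapp_divide by (simp add: field_simps)
    ultimately show False using eigenvector_char_det_zero[OF a w] nz by blast
  qed
  obtain c N0 where c: "c > 0"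
    and lb: "\<And>N x. N \<ge> N0 \<Longrightarrow> c * (\<Sum>k<N. cmod (x k)) \<le> (\<Sum>k<N. cmod (x k - (\<Sum>l<N. b k l * x l)))"
    using sections_bounded_below[OF b ff] by auto
  have main: "\<exists>f. (\<lambda>k. cmod (f k)) summable_on UNIV \<and> (\<forall>k. f k - mapp b f k = g k) \<and>
          (\<Sum>\<^sub>\<infinity>k. cmod (f k)) \<le> (\<Sum>\<^sub>\<infinity>k. cmod (g k)) / c" if g: "(\<lambda>k. cmod (g k)) summable_on UNIV" for g :: "nat \<Rightarrow> complex"
  proof -
    define G where "G = (\<Sum>\<^sub>\<infinity>k. cmod (g k))"
    have "\<exists>f. (\<forall>k\<ge>N. f k = 0) \<and> (\<forall>k<N. f k - (\<Sum>l<N. b k l * f l) = g k)" if N: "N \<ge> N0" for N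
    proof -
      obtain B where B: "\<And>k j. k < N \<Longrightarrow> j < N \<Longrightarrow> B k j - (\<Sum>l<N. b k l * B l j) = (if k = j then 1 else 0)"
        and "fdet N b * fdet N (\<lambda>k j. (if k = j then 1 else 0) - B k j) = 1"
        by (rule section_inverse[OF c lb[OF N]]) (rule that)
      define f where "f k = (if k < N then \<Sum>j<N. B k j * g j else 0)" for k
      have "f k - (\<Sum>l<N. b k l * f l) = g k" if k: "k < N" for k
      proof -
        have "(\<Sum>l<N. b k l * f l) = (\<Sum>l<N. \<Sum>j<N. b k l * B l j * g j)"
          by (rule sum.cong) (auto simp: f_def sum_distrib_left mult.assoc)
        also have "\<dots> = (\<Sum>j<N. (\<Sum>l<N. b k l * B l j) * g j)"
          by (subst sum.swap) (simp add: sum_distrib_right)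
        finally have "f k - (\<Sum>l<N. b k l * f l) = (\<Sum>j<N. (B k j - (\<Sum>l<N. b k l * B l j)) * g j)"
          using k by (simp add: f_def sum_subtractf[symmetric] left_diff_distrib)
        also have "\<dots> = (\<Sum>j<N. if k = j then g j else 0)"
          by (rule sum.cong) (use B[OF k] in auto)
        also have "\<dots> = g k" using k by simp
        finally show ?thesis .
      qed
      then show ?thesis by (intro exI[of _ f]) (auto simp: f_def)
    qed
    then have "\<forall>n. \<exists>f. (\<forall>k\<ge>N0 + n. f k = 0) \<and> (\<forall>k<N0 + n. f k - (\<Sum>l<N0 + n. b k l * f l) = g k)"
      by simp
    from choice[OF this] obtain F where
      "\<forall>n. (\<forall>k\<ge>N0 + n. F n k = 0) \<and> (\<forall>k<N0 + n. F n k - (\<Sum>l<N0 + n. b k l * F n l) = g k)" ..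
    then have F0: "\<And>n k. k \<ge> N0 + n \<Longrightarrow> F n k = 0"
      and F: "\<And>n k. k < N0 + n \<Longrightarrow> F n k - (\<Sum>l<N0 + n. b k l * F n l) = g k"
      by auto
    have Fmapp: "F n k - mapp b (F n) k = g k" if "k < N0 + n" for n k
      using F[OF that] mapp_finite_support[of "N0 + n" "F n", OF F0] by simp
    have Fsum: "(\<Sum>k<M. cmod (F n k)) \<le> G / c" for n M
    proof -
      have "c * (\<Sum>k<N0 + n. cmod (F n k)) \<le> (\<Sum>k<N0 + n. cmod (g k))"
        using lb[of "N0 + n" "F n"] F[of _ n] by simp
      also have "\<dots> \<le> G" unfolding G_def by (rule finite_sum_le_infsum[OF g]) auto
      finally have 1: "(\<Sum>k<N0 + n. cmod (F n k)) \<le> G / c" using c by (simp add: field_simps)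
      have "(\<Sum>k<M. cmod (F n k)) \<le> (\<Sum>k<max M (N0 + n). cmod (F n k))"
        by (rule sum_mono2) auto
      also have "\<dots> = (\<Sum>k<N0 + n. cmod (F n k))"
        by (rule sum.mono_neutral_right) (use F0 in auto)
      finally show ?thesis using 1 by simp
    qed
    have Fbd: "cmod (F n k) \<le> G / c" for n k
      using Fsum[of n "Suc k"] member_le_sum[of k "{..<Suc k}" "\<lambda>k. cmod (F n k)"] by simp
    obtain r where r: "strict_mono (r :: nat \<Rightarrow> nat)" and "\<And>k. \<exists>l. (\<lambda>m. F (r m) k) \<longlonglongrightarrow> l"
      using function_convergent_subsequence[of UNIV F "G / c"] Fbd by auto
    then obtain f where f: "\<And>k. (\<lambda>m. F (r m) k) \<longlonglongrightarrow> f k" by metis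
    have fsum: "(\<Sum>k<M. cmod (f k)) \<le> G / c" for M
      by (rule LIMSEQ_le_const2[OF tendsto_sum[OF tendsto_norm[OF f]]]) (use Fsum in auto)
    have fin: "(\<Sum>k\<in>X. cmod (f k)) \<le> G / c" if fX: "finite X" for X
    proof -
      obtain M where "X \<subseteq> {..<M}" using finite_nat_set_iff_bounded[of X] fX by auto
      then have "(\<Sum>k\<in>X. cmod (f k)) \<le> (\<Sum>k<M. cmod (f k))" by (intro sum_mono2) auto
      then show ?thesis using fsum[of M] by simp
    qed
    have fs: "(\<lambda>k. cmod (f k)) summable_on UNIV"
      by (rule nonneg_bdd_above_summable_on) (use fin in \<open>auto intro!: bdd_aboveI\<close>)
    have le: "(\<Sum>\<^sub>\<infinity>k. cmod (f k)) \<le> G / c"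
      by (rule infsum_le_finite_sums[OF fs]) (use fin in auto)
    have eq: "f k - mapp b f k = g k" for k
    proof -
      have 1: "(\<lambda>m. F (r m) k - mapp b (F (r m)) k) \<longlonglongrightarrow> f k - mapp b f k"
        by (intro tendsto_diff f mapp_tendsto[OF b, where C = "G / c"] Fbd)
      have "(\<lambda>m. F (r m) k - mapp b (F (r m)) k) \<longlonglongrightarrow> g k"
      proof (rule Lim_transform_eventually[OF tendsto_const])
        show "\<forall>\<^sub>F m in sequentially. g k = F (r m) k - mapp b (F (r m)) k"
          using eventually_gt_at_top[of k]
        proof eventually_elim
          case (elim m)
          then have "k < N0 + r m" using seq_suble[OF r, of m] by linarith
          then show ?case using Fmapp by simp
        qed
      qed
      then show ?thesis using LIMSEQ_unique[OF 1] by simp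
    qed
    show ?thesis
      by (intro exI[of _ f] conjI allI fs eq le[unfolded G_def])
  qed
  show thesis
  proof
    show "1 / (c * cmod w) \<ge> 0" using c by simp
  next
    fix g :: "nat \<Rightarrow> complex" assume g: "(\<lambda>k. cmod (g k)) summable_on UNIV"
    have g': "(\<lambda>k. cmod (g k / w)) summable_on UNIV"
      using summable_on_cmult_left[OF g, of "1 / cmod w"] by (simp add: norm_divide)
    obtain f where f: "(\<lambda>k. cmod (f k)) summable_on UNIV" "\<And>k. f k - mapp b f k = g k / w"
      "(\<Sum>\<^sub>\<infinity>k. cmod (f k)) \<le> (\<Sum>\<^sub>\<infinity>k. cmod (g k / w)) / c"
      using main[OF g'] by blast
    have "w * f k - mapp a f k = g k" for k
      using f(2)[of k] w unfolding b_def mapp_divide by (simp add: field_simps)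
    moreover have "(\<Sum>\<^sub>\<infinity>k. cmod (g k / w)) = 1 / cmod w * (\<Sum>\<^sub>\<infinity>k. cmod (g k))"
      using infsum_cmult_right'[of "1 / cmod w" "\<lambda>k. cmod (g k)" UNIV] by (simp add: norm_divide)
    then have "(\<Sum>\<^sub>\<infinity>k. cmod (f k)) \<le> 1 / (c * cmod w) * (\<Sum>\<^sub>\<infinity>k. cmod (g k))"
      using f(3) by (simp add: mult.commute)
    ultimately show "\<exists>f. (\<lambda>k. cmod (f k)) summable_on UNIV \<and> (\<forall>k. w * f k - mapp a f k = g k) \<and>
          (\<Sum>\<^sub>\<infinity>k. cmod (f k)) \<le> 1 / (c * cmod w) * (\<Sum>\<^sub>\<infinity>k. cmod (g k))"
      using f(1) by (intro exI[of _ f]) simp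
  qed
qed

section \<open>Counting zeros along a homotopy\<close>

lemma finite_set_separated:
  fixes Z :: "'a::metric_space set"
  assumes "finite Z"
  obtains d where "d > 0" "\<And>p q. p \<in> Z \<Longrightarrow> q \<in> Z \<Longrightarrow> p \<noteq> q \<Longrightarrow> d \<le> dist p q"
proof -
  define M where "M = insert 1 ((\<lambda>(p, q). dist p q) ` {(p, q). p \<in> Z \<and> q \<in> Z \<and> p \<noteq> q})"
  have "finite {(p, q). p \<in> Z \<and> q \<in> Z \<and> p \<noteq> q}"
    by (rule finite_subset[of _ "Z \<times> Z"]) (use assms in auto)
  then have fin: "finite M" by (simp add: M_def)
  show thesis
  proof
    show "Min M > 0" using fin by (subst Min_gr_iff) (auto simp: M_def)
    show "Min M \<le> dist p q" if "p \<in> Z" "q \<in> Z" "p \<noteq> q" for p q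
      by (rule Min_le[OF fin]) (use that in \<open>force simp: M_def\<close>)
  qed
qed

text \<open>The boundary of \<open>D\<close> may be too irregular for an integration contour, so
  Rouche's theorem is applied on small circles around the zeros of \<open>f\<close>. On the compact
  rest \<open>K\<close> of the closure \<open>cmod (f z)\<close> is bounded away from 0, which
  leaves no room there for zeros of a nearby \<open>g\<close>.\<close>

lemma zero_count_locally_constant:
  fixes f :: "complex \<Rightarrow> complex"
  assumes U: "open U" and f: "f holomorphic_on U" and D: "open D" "bounded D" "closure D \<subseteq> U"
    and fr: "\<And>z. z \<in> frontier D \<Longrightarrow> f z \<noteq> 0" and fin: "finite {z \<in> D. f z = 0}"
  shows "\<exists>e>0. \<forall>g. g holomorphic_on U \<longrightarrow> finite {z \<in> D. g z = 0} \<longrightarrow> (\<forall>z\<in>closure D. cmod (g z - f z) < e) \<longrightarrow>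
       (\<Sum>z | z \<in> D \<and> g z = 0. zorder g z) = (\<Sum>z | z \<in> D \<and> f z = 0. zorder f z)"
proof -
  define Z where "Z = {z \<in> D. f z = 0}"
  have finZ: "finite Z" using fin by (simp add: Z_def)
  obtain d where d: "d > 0" "\<And>p q. p \<in> Z \<Longrightarrow> q \<in> Z \<Longrightarrow> p \<noteq> q \<Longrightarrow> d \<le> dist p q"
    using finite_set_separated[OF finZ] by blast
  have "\<forall>p\<in>Z. \<exists>t>0. ball p t \<subseteq> D"
    using D(1) open_contains_ball unfolding Z_def by blast
  then obtain t where t: "\<And>p. p \<in> Z \<Longrightarrow> t p > 0" "\<And>p. p \<in> Z \<Longrightarrow> ball p (t p) \<subseteq> D"
    by metis
  \<comment> \<open>Balls of radius \<open>2 * r\<close> around the zeros lie in \<open>D\<close>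
    and, by the term \<open>d / 4\<close>, are pairwise disjoint, so no zero of \<open>g\<close> is
    counted twice. They serve as domains, the circles of radius \<open>r\<close> as
    contours.\<close>
  define r where "r = Min (insert (d / 4) (t ` Z)) / 2"
  have r0: "r > 0" unfolding r_def using finZ t d by (simp add: Min_gr_iff)
  have rd: "4 * r \<le> d"
  proof -
    have "Min (insert (d / 4) (t ` Z)) \<le> d / 4" using finZ by (intro Min_le) auto
    then show ?thesis using d unfolding r_def by linarith
  qed
  have rt: "ball p (2 * r) \<subseteq> D" if "p \<in> Z" for p
  proof -
    have "Min (insert (d / 4) (t ` Z)) \<le> t p" using finZ that by (intro Min_le) auto
    then have "ball p (2 * r) \<subseteq> ball p (t p)" unfolding r_def by (intro subset_ball) simp
    then show ?thesis using t(2)[OF that] by blast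
  qed
  have disj: "q = p" if "p \<in> Z" "q \<in> Z" "dist p z < 2 * r" "dist q z < 2 * r" for p q z
  proof (rule ccontr)
    assume "q \<noteq> p"
    then have "d \<le> dist p q" using d(2) that by blast
    also have "\<dots> \<le> dist p z + dist q z" by (rule dist_triangle2)
    finally show False using that rd by linarith
  qed
  define K where "K = closure D - (\<Union>p\<in>Z. ball p r)"
  have "compact (closure D)" using D(2) by (simp add: compact_closure)
  then have K: "compact K" unfolding K_def by (intro compact_diff open_UN) auto
  have fK: "f z \<noteq> 0" if "z \<in> K" for z
  proof (cases "z \<in> D")
    case True
    then show ?thesis using that r0 unfolding K_def Z_def by fastforce
  next
    case False
    then have "z \<in> frontier D"
      using that D(1) unfolding K_def frontier_def by (simp add: interior_open)
    then show ?thesis by (rule fr)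
  qed
  obtain e where e: "e > 0" "\<And>z. z \<in> K \<Longrightarrow> e \<le> cmod (f z)"
  proof (cases "K = {}")
    case True
    then show thesis using that[of 1] by simp
  next
    case False
    have "K \<subseteq> U" using D(3) by (auto simp: K_def)
    then have "continuous_on K (\<lambda>z. cmod (f z))"
      by (intro continuous_intros continuous_on_subset[OF holomorphic_on_imp_continuous_on[OF f]])
    then obtain z0 where "z0 \<in> K" "\<forall>z\<in>K. cmod (f z0) \<le> cmod (f z)"
      using continuous_attains_inf[OF K False] by blast
    then show thesis using that[of "cmod (f z0)"] fK[of z0] by simp
  qed
  show ?thesis
  proof (intro exI[of _ e] conjI allI impI e(1))
    fix g assume g: "g holomorphic_on U" and fing: "finite {z \<in> D. g z = 0}"
      and "\<forall>z\<in>closure D. cmod (g z - f z) < e"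
    then have close: "\<And>z. z \<in> closure D \<Longrightarrow> cmod (g z - f z) < e" by auto
    have gK: "g z \<noteq> 0" if "z \<in> K" for z
      using close[of z] e(2)[OF that] that by (auto simp: K_def)
    have local: "(\<Sum>z | z \<in> ball p (2 * r) \<and> g z = 0. zorder g z) = zorder f p" if p: "p \<in> Z" for p
    proof -
      have ballU: "ball p (2 * r) \<subseteq> U" using rt[OF p] D(3) closure_subset by blast
      have sph: "sphere p r \<subseteq> K"
      proof
        fix z assume z: "z \<in> sphere p r"
        have "z \<in> D" using z rt[OF p] r0 by (auto simp: subset_iff)
        moreover have "z \<notin> ball q r" if "q \<in> Z" for q
          using disj[OF p that, of z] z r0 by auto
        ultimately show "z \<in> K" using closure_subset by (auto simp: K_def)
      qed
      have gz: "z \<in> ball p r" if "z \<in> ball p (2 * r)" "g z = 0" for z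
      proof (rule ccontr)
        assume nz: "z \<notin> ball p r"
        have "z \<in> D" using that rt[OF p] by auto
        moreover have "z \<notin> ball q r" if q: "q \<in> Z" for q
          using disj[OF p q, of z] nz \<open>z \<in> ball p (2 * r)\<close> r0 by auto
        ultimately have "z \<in> K" using closure_subset by (auto simp: K_def)
        then show False using gK that by blast
      qed
      have fz: "{z \<in> ball p (2 * r). f z = 0} = {p}"
      proof (intro equalityI subsetI)
        fix z assume z: "z \<in> {z \<in> ball p (2 * r). f z = 0}"
        then have "z \<in> Z" using rt[OF p] by (auto simp: Z_def)
        then show "z \<in> {p}" using disj[OF p, of z z] z r0 by auto
      qed (use p r0 in \<open>auto simp: Z_def\<close>)
      have wn: "winding_number (circlepath p r) z = 1" if "z \<in> ball p r" for z
        using that by (intro winding_number_circlepath) (simp add: dist_norm norm_minus_commute)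
      have "(\<Sum>z\<in>{z \<in> ball p (2 * r). f z + (g z - f z) = 0}. winding_number (circlepath p r) z * zorder (\<lambda>z. f z + (g z - f z)) z)
        = (\<Sum>z\<in>{z \<in> ball p (2 * r). f z = 0}. winding_number (circlepath p r) z * zorder f z)"
      proof (rule Rouche_theorem)
        show "finite {z \<in> ball p (2 * r). f z + (g z - f z) = 0}"
          by (rule finite_subset[OF _ fing]) (use rt[OF p] in auto)
        show "finite {z \<in> ball p (2 * r). f z = 0}" unfolding fz by simp
        show "f holomorphic_on ball p (2 * r)" using f ballU by (rule holomorphic_on_subset)
        show "(\<lambda>z. g z - f z) holomorphic_on ball p (2 * r)"
          using f g ballU by (intro holomorphic_intros) (auto intro: holomorphic_on_subset)
        show "path_image (circlepath p r) \<subseteq> ball p (2 * r)" using r0 by auto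
        show "\<forall>z\<in>path_image (circlepath p r). cmod (g z - f z) < cmod (f z)"
        proof
          fix z assume "z \<in> path_image (circlepath p r)"
          then have zK: "z \<in> K" using sph r0 by auto
          then have "cmod (g z - f z) < e" using close by (auto simp: K_def)
          also have "\<dots> \<le> cmod (f z)" by (rule e(2)[OF zK])
          finally show "cmod (g z - f z) < cmod (f z)" .
        qed
        show "\<forall>z. z \<notin> ball p (2 * r) \<longrightarrow> winding_number (circlepath p r) z = 0"
        proof (intro allI impI)
          fix z assume "z \<notin> ball p (2 * r)"
          then show "winding_number (circlepath p r) z = 0"
            using r0 by (intro winding_number_zero_outside[of _ "cball p r"]) (auto simp: path_image_circlepath)
        qed
      qed auto
      also have "\<dots> = of_int (zorder f p)" unfolding fz using wn[of p] r0 by simp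
      also have "(\<Sum>z\<in>{z \<in> ball p (2 * r). f z + (g z - f z) = 0}. winding_number (circlepath p r) z * zorder (\<lambda>z. f z + (g z - f z)) z)
        = (\<Sum>z | z \<in> ball p (2 * r) \<and> g z = 0. complex_of_int (zorder g z))"
        by (rule sum.cong) (use wn gz in auto)
      finally have "complex_of_int (\<Sum>z | z \<in> ball p (2 * r) \<and> g z = 0. zorder g z) = complex_of_int (zorder f p)"
        by simp
      then show ?thesis by (simp only: of_int_eq_iff)
    qed
    have "{z. z \<in> D \<and> g z = 0} = (\<Union>p\<in>Z. {z. z \<in> ball p (2 * r) \<and> g z = 0})"
    proof (intro equalityI subsetI)
      fix z assume z: "z \<in> {z. z \<in> D \<and> g z = 0}"
      then have "z \<notin> K" using gK by auto
      then obtain p where "p \<in> Z" "z \<in> ball p r" using z closure_subset by (auto simp: K_def)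
      then have "z \<in> ball p (2 * r)" using r0 by auto
      then show "z \<in> (\<Union>p\<in>Z. {z. z \<in> ball p (2 * r) \<and> g z = 0})"
        using z \<open>p \<in> Z\<close> by (intro UN_I[of p]) auto
    next
      fix z assume "z \<in> (\<Union>p\<in>Z. {z. z \<in> ball p (2 * r) \<and> g z = 0})"
      then obtain p where "p \<in> Z" "z \<in> ball p (2 * r)" "g z = 0" by auto
      then show "z \<in> {z. z \<in> D \<and> g z = 0}" using rt[of p] by auto
    qed
    then have "(\<Sum>z | z \<in> D \<and> g z = 0. zorder g z) = (\<Sum>p\<in>Z. \<Sum>z | z \<in> ball p (2 * r) \<and> g z = 0. zorder g z)"
    proof (simp only:, intro sum.UNION_disjoint finZ ballI)
      show "finite {z. z \<in> ball p (2 * r) \<and> g z = 0}" if "p \<in> Z" for p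
        by (rule finite_subset[OF _ fing]) (use rt[OF that] in auto)
      show "p \<noteq> q \<longrightarrow> {z. z \<in> ball p (2 * r) \<and> g z = 0} \<inter> {z. z \<in> ball q (2 * r) \<and> g z = 0} = {}"
        if "p \<in> Z" "q \<in> Z" for p q
        using disj[OF that] by auto
    qed
    also have "\<dots> = (\<Sum>p\<in>Z. zorder f p)" by (rule sum.cong) (use local in auto)
    finally show "(\<Sum>z | z \<in> D \<and> g z = 0. zorder g z) = (\<Sum>z | z \<in> D \<and> f z = 0. zorder f z)"
      by (simp add: Z_def)
  qed
qed

lemma zero_count_homotopy:
  fixes F :: "real \<Rightarrow> complex \<Rightarrow> complex"
  assumes U: "open U" and F: "\<And>s. s \<in> {0..1} \<Longrightarrow> F s holomorphic_on U"
    and D: "open D" "bounded D" "closure D \<subseteq> U"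
    and fr: "\<And>s z. s \<in> {0..1} \<Longrightarrow> z \<in> frontier D \<Longrightarrow> F s z \<noteq> 0"
    and fin: "\<And>s. s \<in> {0..1} \<Longrightarrow> finite {z \<in> D. F s z = 0}"
    and cont: "\<And>s e. s \<in> {0..1} \<Longrightarrow> e > 0 \<Longrightarrow>
      \<exists>d>0. \<forall>t\<in>{0..1}. \<bar>t - s\<bar> < d \<longrightarrow> (\<forall>z\<in>closure D. cmod (F t z - F s z) < e)"
  shows "(\<Sum>z | z \<in> D \<and> F 0 z = 0. zorder (F 0) z) = (\<Sum>z | z \<in> D \<and> F 1 z = 0. zorder (F 1) z)"
proof -
  define c where "c s = (\<Sum>z | z \<in> D \<and> F s z = 0. zorder (F s) z)" for s
  have "c constant_on {0..1}"
  proof (rule locally_constant_imp_constant)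
    fix s :: real assume s: "s \<in> {0..1}"
    obtain e where e: "e > 0" "\<forall>g. g holomorphic_on U \<longrightarrow> finite {z \<in> D. g z = 0} \<longrightarrow>
        (\<forall>z\<in>closure D. cmod (g z - F s z) < e) \<longrightarrow>
       (\<Sum>z | z \<in> D \<and> g z = 0. zorder g z) = (\<Sum>z | z \<in> D \<and> F s z = 0. zorder (F s) z)"
      using zero_count_locally_constant[OF U F[OF s] D fr[OF s] fin[OF s]] by auto
    obtain d where d: "d > 0" "\<And>t. t \<in> {0..1} \<Longrightarrow> \<bar>t - s\<bar> < d \<Longrightarrow> \<forall>z\<in>closure D. cmod (F t z - F s z) < e"
      using cont[OF s e(1)] by blast
    show "\<exists>T. openin (top_of_set {0..1}) T \<and> s \<in> T \<and> (\<forall>x\<in>T. c x = c s)"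
    proof (intro exI conjI ballI)
      show "openin (top_of_set {0..1}) ({0..1} \<inter> ball s d)" by (intro openin_open_Int) auto
      show "s \<in> {0..1} \<inter> ball s d" using s d by auto
      fix t assume t: "t \<in> {0..1} \<inter> ball s d"
      then show "c t = c s"
        unfolding c_def using d(2)[of t]
        by (intro e(2)[rule_format] F fin) (auto simp: dist_real_def abs_minus_commute)
    qed
  qed auto
  then have "c 0 = c 1" unfolding constant_on_def by fastforce
  then show ?thesis by (simp add: c_def)
qed

lemma char_det_not_constant_zero:
  assumes "nuclear a" "compact K" "K \<subseteq> - {0}"
  shows "finite {z \<in> K. char_det a z = 0}"
proof (cases "char_det a constant_on - {0}")
  case True
  obtain z :: complex where z: "cmod z > nuclear_norm a / ln 2" "z \<noteq> 0"
  proof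
    let ?t = "nuclear_norm a / ln 2 + 1"
    have "nuclear_norm a / ln 2 \<ge> 0" using nuclear_norm_nonneg by simp
    then show "cmod (complex_of_real ?t) > nuclear_norm a / ln 2" "complex_of_real ?t \<noteq> 0"
      by (auto simp del: of_real_add simp: of_real_eq_0_iff)
  qed
  have "char_det a z \<noteq> 0" by (rule char_det_nonzero_far[OF assms(1) z])
  then have "\<forall>x\<in>- {0}. char_det a x \<noteq> 0"
    using True z(2) unfolding constant_on_def by fastforce
  then have nz: "char_det a x \<noteq> 0" if "x \<in> K" for x
    using subsetD[OF assms(3) that] by blast
  have "{z \<in> K. char_det a z = 0} = {}"
    unfolding Collect_empty_eq using nz by blast
  then show ?thesis by (simp only: finite.emptyI)
next
  case False
  have "connected (- {0::complex})"
    by (rule connected_punctured_universe) simp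
  then show ?thesis
    by (intro holomorphic_compact_finite_zeros[OF char_det_holomorphic[OF assms(1)] _ _ assms(2,3) False]) auto
qed

lemma nuclear_norm_cmult: "nuclear_norm (\<lambda>i j. c * a i j) = cmod c * nuclear_norm a"
proof (cases "c = 0")
  case False
  then show ?thesis using nuclear_norm_divide[of a "1 / c"] by (simp add: norm_divide mult.commute)
qed (simp add: nuclear_norm_def case_prod_unfold)

text \<open>The closure of \<open>D\<close> keeps a distance \<open>m\<close> from 0, so the norms
  of the matrices divided by \<open>z\<close> are at most \<open>1 / m\<close> times the original
  norms. This makes the determinants continuous in \<open>s\<close> uniformly in \<open>z\<close>,
  as the counting of zeros demands.\<close>

lemma char_det_zero_count_homotopy:
  fixes a b :: "nat \<Rightarrow> nat \<Rightarrow> complex"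
  defines "c \<equiv> \<lambda>s::real. \<lambda>i j. b i j + complex_of_real s * (a i j - b i j)"
  assumes a: "nuclear a" and b: "nuclear b"
    and D: "open D" "bounded D" "0 \<notin> closure D"
    and fr: "\<And>s z. s \<in> {0..1} \<Longrightarrow> z \<in> frontier D \<Longrightarrow> char_det (c s) z \<noteq> 0"
  shows "(\<Sum>z | z \<in> D \<and> char_det a z = 0. zorder (char_det a) z) = (\<Sum>z | z \<in> D \<and> char_det b z = 0. zorder (char_det b) z)"
proof -
  have cn: "nuclear (c s)" for s
    unfolding c_def by (intro nuclear_add b nuclear_cmult nuclear_diff a)
  have cD: "compact (closure D)" using D(2) by (simp add: compact_closure)
  obtain m where m: "m > 0" "\<And>z. z \<in> closure D \<Longrightarrow> m \<le> cmod z"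
    using separate_point_closed[OF closed_closure D(3)] by (auto simp: dist_norm)
  have "(\<Sum>z | z \<in> D \<and> char_det (c 0) z = 0. zorder (char_det (c 0)) z) = (\<Sum>z | z \<in> D \<and> char_det (c 1) z = 0. zorder (char_det (c 1)) z)"
  proof (rule zero_count_homotopy[where U = "- {0}" and F = "\<lambda>s. char_det (c s)"])
    show "finite {z \<in> D. char_det (c s) z = 0}" for s
      by (rule finite_subset[OF _ char_det_not_constant_zero[OF cn[of s] cD]])
         (use D(3) closure_subset in auto)
    show "\<exists>d>0. \<forall>t\<in>{0..1}. \<bar>t - s\<bar> < d \<longrightarrow> (\<forall>z\<in>closure D. cmod (char_det (c t) z - char_det (c s) z) < e)"
      if e: "e > 0" for s e :: real
    proof -
      define h where "h u = exp (nuclear_norm (c s) / m) * (exp (u * nuclear_norm (\<lambda>i j. a i j - b i j) / m) - 1)" for u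
      have "(h \<longlongrightarrow> h 0) (at 0)" unfolding h_def using m by (intro tendsto_intros) auto
      moreover have "h 0 = 0" by (simp add: h_def)
      ultimately have "\<forall>\<^sub>F u in at 0. h u < e" using e by (intro order_tendstoD(2)) auto
      then obtain d where d: "d > 0" "\<And>u. u \<noteq> 0 \<Longrightarrow> \<bar>u\<bar> < d \<Longrightarrow> h u < e"
        by (auto simp: eventually_at dist_real_def)
      have hd: "h u < e" if "\<bar>u\<bar> < d" for u
        using d(2)[of u] that \<open>h 0 = 0\<close> e by (cases "u = 0") auto
      have "cmod (char_det (c t) z - char_det (c s) z) < e" if t: "\<bar>t - s\<bar> < d" and z: "z \<in> closure D" for t z
      proof -
        have le: "x / cmod z \<le> x / m" if "0 \<le> x" for x :: real
          using m(2)[OF z] m(1) that by (simp add: frac_le)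
        have diff: "(\<lambda>i j. c t i j / z - c s i j / z) = (\<lambda>i j. (complex_of_real (t - s) * (a i j - b i j)) / z)"
          by (auto simp: c_def fun_eq_iff diff_divide_distrib[symmetric] algebra_simps)
        have "cmod (char_det (c t) z - char_det (c s) z) \<le>
          exp (nuclear_norm (c s) / cmod z) * (exp (\<bar>t - s\<bar> * nuclear_norm (\<lambda>i j. a i j - b i j) / cmod z) - 1)"
          using fredholm_diff_le[OF nuclear_divide[OF cn[of t], of z] nuclear_divide[OF cn[of s], of z]]
          unfolding char_det_def diff nuclear_norm_divide nuclear_norm_cmult norm_of_real .
        also have "\<dots> \<le> h \<bar>t - s\<bar>"
          unfolding h_def
          using le[OF nuclear_norm_nonneg[of "c s"]] le[of "\<bar>t - s\<bar> * nuclear_norm (\<lambda>i j. a i j - b i j)"]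
            nuclear_norm_nonneg[of "\<lambda>i j. a i j - b i j"]
          by (intro mult_mono) auto
        also have "\<dots> < e" using hd[of "\<bar>t - s\<bar>"] t by simp
        finally show ?thesis .
      qed
      then show ?thesis using d(1) by blast
    qed
  qed (use D fr char_det_holomorphic[OF cn] in auto)
  moreover have "c 0 = b" "c 1 = a" by (auto simp: c_def fun_eq_iff)
  ultimately show ?thesis by simp
qed

section \<open>Algebraic multiplicity as the order of a zero\<close>

text \<open>An identification of \<open>V\<close> with \<open>l^1\<close> as a vector space. No norm
  occurs: eigenvalues, generalised eigenspaces and their dimensions are algebraic, and for the
  matrices summability of the entries takes the place of boundedness.\<close>

locale l1_coordinates =
  fixes V :: "circle_L1 set" and \<Phi> :: "circle_L1 \<Rightarrow> nat \<Rightarrow> complex"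
  assumes subspace: "circle_L1.subspace V"
    and add: "f \<in> V \<Longrightarrow> g \<in> V \<Longrightarrow> \<Phi> (f + g) = (\<lambda>k. \<Phi> f k + \<Phi> g k)"
    and scale: "f \<in> V \<Longrightarrow> \<Phi> (c *\<^sub>C f) = (\<lambda>k. c * \<Phi> f k)"
    and inj0: "f \<in> V \<Longrightarrow> \<Phi> f = (\<lambda>_. 0) \<Longrightarrow> f = 0"
    and summable: "f \<in> V \<Longrightarrow> (\<lambda>k. cmod (\<Phi> f k)) summable_on UNIV"
    and surj: "(\<lambda>k. cmod (x k)) summable_on UNIV \<Longrightarrow> \<exists>f\<in>V. \<Phi> f = x"
begin

definition represents :: "(nat \<Rightarrow> nat \<Rightarrow> complex) \<Rightarrow> (circle_L1 \<Rightarrow> circle_L1) \<Rightarrow> bool" where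
  "represents a B \<longleftrightarrow> (\<forall>f\<in>V. B f \<in> V \<and> \<Phi> (B f) = mapp a (\<Phi> f))"

lemma add_mem: "f \<in> V \<Longrightarrow> g \<in> V \<Longrightarrow> f + g \<in> V"
  and scale_mem: "f \<in> V \<Longrightarrow> c *\<^sub>C f \<in> V"
  and zero_mem: "0 \<in> V"
  using subspace by (auto simp: circle_L1.subspace_def)

lemma diff_mem: "f \<in> V \<Longrightarrow> g \<in> V \<Longrightarrow> f - g \<in> V"
  by (rule circle_L1.subspace_diff[OF subspace])

lemma zero: "\<Phi> 0 = (\<lambda>_. 0)"
  using scale[OF zero_mem, of 0] by simp

lemma diff: "f \<in> V \<Longrightarrow> g \<in> V \<Longrightarrow> \<Phi> (f - g) = (\<lambda>k. \<Phi> f k - \<Phi> g k)"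
  using add[of "f - g" g] diff_mem[of f g] by auto

lemma inj: "f \<in> V \<Longrightarrow> g \<in> V \<Longrightarrow> \<Phi> f = \<Phi> g \<Longrightarrow> f = g"
  using inj0[of "f - g"] diff[of f g] diff_mem[of f g] by auto

lemma bounded: "f \<in> V \<Longrightarrow> cmod (\<Phi> f k) \<le> (\<Sum>\<^sub>\<infinity>k. cmod (\<Phi> f k))"
  by (rule summable_imp_bounded[OF summable])

lemma represents_mem: "represents a B \<Longrightarrow> f \<in> V \<Longrightarrow> B f \<in> V"
  and represents_coord: "represents a B \<Longrightarrow> f \<in> V \<Longrightarrow> \<Phi> (B f) = mapp a (\<Phi> f)"
  by (auto simp: represents_def)

text \<open>Matrices act linearly on coordinates and the coordinates are injective on
  \<open>V\<close>, so linearity of the operator is a consequence of being represented.\<close>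

lemma represents_linear:
  assumes a: "nuclear a" and B: "represents a B" and f: "f \<in> V" and g: "g \<in> V"
  shows "B (f + c *\<^sub>C g) = B f + c *\<^sub>C B g"
proof (rule inj)
  note mem = add_mem scale_mem represents_mem[OF B] f g
  show "B (f + c *\<^sub>C g) \<in> V" "B f + c *\<^sub>C B g \<in> V" by (simp_all add: mem)
  have "mapp a (\<lambda>k. \<Phi> f k + c * \<Phi> g k) i = mapp a (\<Phi> f) i + c * mapp a (\<Phi> g) i" for i
  proof -
    have "mapp a (\<lambda>k. \<Phi> f k + c * \<Phi> g k) i = (\<Sum>\<^sub>\<infinity>k. a i k * \<Phi> f k + c * (a i k * \<Phi> g k))"
      unfolding mapp_def by (rule infsum_cong) (simp add: algebra_simps)
    also have "\<dots> = (\<Sum>\<^sub>\<infinity>k. a i k * \<Phi> f k) + (\<Sum>\<^sub>\<infinity>k. c * (a i k * \<Phi> g k))"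
      by (intro infsum_add summable_on_cmult_right nuclear_mult_bounded(3)[OF a bounded] f g)
    also have "(\<Sum>\<^sub>\<infinity>k. c * (a i k * \<Phi> g k)) = c * (\<Sum>\<^sub>\<infinity>k. a i k * \<Phi> g k)"
      by (rule infsum_cmult_right')
    finally show ?thesis by (simp add: mapp_def)
  qed
  then show "\<Phi> (B (f + c *\<^sub>C g)) = \<Phi> (B f + c *\<^sub>C B g)"
    by (simp add: represents_coord[OF B] add scale mem fun_eq_iff)
qed

definition linear_endo :: "(circle_L1 \<Rightarrow> circle_L1) \<Rightarrow> bool" where
  "linear_endo U \<longleftrightarrow> (\<forall>f\<in>V. U f \<in> V) \<and> (\<forall>f\<in>V. \<forall>g\<in>V. \<forall>c. U (f + c *\<^sub>C g) = U f + c *\<^sub>C U g)"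

lemma linear_endo_funpow:
  assumes "linear_endo U" shows "linear_endo (U ^^ n)"
proof (induction n)
  case (Suc n)
  then show ?case using assms unfolding linear_endo_def by (simp add: o_def)
qed (simp add: linear_endo_def)

lemma linear_endo_zero: "linear_endo U \<Longrightarrow> U 0 = 0"
proof -
  assume U: "linear_endo U"
  have "U (0 + (-1) *\<^sub>C 0) = U 0 + (-1) *\<^sub>C U 0"
    using U zero_mem unfolding linear_endo_def by blast
  then show ?thesis by simp
qed

lemma linear_endo_scale: "linear_endo U \<Longrightarrow> f \<in> V \<Longrightarrow> U (c *\<^sub>C f) = c *\<^sub>C U f"
proof -
  assume U: "linear_endo U" and f: "f \<in> V"
  have "U (0 + c *\<^sub>C f) = U 0 + c *\<^sub>C U f"
    using U zero_mem f unfolding linear_endo_def by blast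
  then show ?thesis using linear_endo_zero[OF U] by simp
qed

lemma linear_endo_add: "linear_endo U \<Longrightarrow> f \<in> V \<Longrightarrow> g \<in> V \<Longrightarrow> U (f + g) = U f + U g"
proof -
  assume U: "linear_endo U" and f: "f \<in> V" and g: "g \<in> V"
  have "U (f + 1 *\<^sub>C g) = U f + 1 *\<^sub>C U g"
    using U f g unfolding linear_endo_def by blast
  then show ?thesis by simp
qed

lemma linear_endo_mem: "linear_endo U \<Longrightarrow> f \<in> V \<Longrightarrow> U f \<in> V"
  by (simp add: linear_endo_def)

lemma linear_endo_shift:
  assumes a: "nuclear a" and B: "represents a B"
  shows "linear_endo (\<lambda>g. w *\<^sub>C g - B g)"
  unfolding linear_endo_def
proof (intro conjI ballI allI)
  fix f g c assume f: "f \<in> V"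
  then show "w *\<^sub>C f - B f \<in> V" by (intro diff_mem scale_mem represents_mem[OF B])
  assume g: "g \<in> V"
  show "w *\<^sub>C (f + c *\<^sub>C g) - B (f + c *\<^sub>C g) = w *\<^sub>C f - B f + c *\<^sub>C (w *\<^sub>C g - B g)"
    unfolding represents_linear[OF a B f g]
    by (simp add: circle_L1.scale_right_distrib circle_L1.scale_right_diff_distrib mult.commute)
qed

lemma funpow_kernel_mono:
  assumes "linear_endo U" "(U ^^ n) f = 0" "n \<le> m"
  shows "(U ^^ m) f = 0"
proof -
  have "(U ^^ m) f = (U ^^ (m - n)) ((U ^^ n) f)"
    using assms(3) by (simp flip: funpow_add comp_apply[of "U ^^ (m - n)" "U ^^ n" f])
  then show ?thesis using assms(2) linear_endo_zero[OF linear_endo_funpow[OF assms(1)]] by simp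
qed

lemma gen_eigenspace_subspace:
  assumes a: "nuclear a" and B: "represents a B"
  shows "circle_L1.subspace (gen_eigenspace V B w)"
proof -
  let ?U = "\<lambda>g. w *\<^sub>C g - B g"
  have U: "linear_endo ?U" by (rule linear_endo_shift[OF a B])
  show ?thesis
  proof (rule circle_L1.subspaceI)
    show "0 \<in> gen_eigenspace V B w"
      unfolding gen_eigenspace_def using zero_mem by (auto intro!: exI[of _ 0])
  next
    fix f g assume "f \<in> gen_eigenspace V B w" "g \<in> gen_eigenspace V B w"
    then obtain n m where f: "f \<in> V" "(?U ^^ n) f = 0" and g: "g \<in> V" "(?U ^^ m) g = 0"
      unfolding gen_eigenspace_def by auto
    have "(?U ^^ max n m) (f + g) = 0"
      using linear_endo_add[OF linear_endo_funpow[OF U] f(1) g(1)]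
        funpow_kernel_mono[OF U f(2), of "max n m"] funpow_kernel_mono[OF U g(2), of "max n m"] by simp
    then show "f + g \<in> gen_eigenspace V B w"
      unfolding gen_eigenspace_def using add_mem[OF f(1) g(1)] by auto
  next
    fix f c assume "f \<in> gen_eigenspace V B w"
    then obtain n where f: "f \<in> V" "(?U ^^ n) f = 0"
      unfolding gen_eigenspace_def by auto
    then have "(?U ^^ n) (c *\<^sub>C f) = 0"
      using linear_endo_scale[OF linear_endo_funpow[OF U] f(1)] by simp
    then show "c *\<^sub>C f \<in> gen_eigenspace V B w"
      unfolding gen_eigenspace_def using scale_mem[OF f(1)] by auto
  qed
qed

lemma eigenvalue_iff:
  assumes a: "nuclear a" and B: "represents a B" and w: "w \<noteq> 0"
  shows "w \<in> eigenvalues V B \<longleftrightarrow> char_det a w = 0"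
proof
  assume "w \<in> eigenvalues V B"
  then obtain f where f: "f \<in> V" "f \<noteq> 0" "B f = w *\<^sub>C f" by (auto simp: eigenvalues_def)
  have "mapp a (\<Phi> f) k = w * \<Phi> f k" for k
    using represents_coord[OF B f(1)] f(3) scale[OF f(1)] by (metis (full_types))
  moreover have "\<Phi> f \<noteq> (\<lambda>_. 0)" using inj0[OF f(1)] f(2) by blast
  ultimately show "char_det a w = 0"
    by (rule eigenvector_char_det_zero[OF a w summable[OF f(1)]])
next
  assume "char_det a w = 0"
  then obtain x where x: "(\<lambda>k. cmod (x k)) summable_on UNIV" "\<And>k. mapp a x k = w * x k" "x \<noteq> (\<lambda>_. 0)"
    using char_det_zero_eigenvector[OF a w] by blast
  obtain f where f: "f \<in> V" "\<Phi> f = x" using surj[OF x(1)] by blast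
  have "B f = w *\<^sub>C f"
    by (rule inj) (use f x(2) represents_coord[OF B f(1)] represents_mem[OF B f(1)] in \<open>auto simp: scale scale_mem\<close>)
  moreover have "f \<noteq> 0" using f x(3) zero by auto
  ultimately show "w \<in> eigenvalues V B" using f(1) by (auto simp: eigenvalues_def)
qed

section \<open>Deflation of generalised eigenspaces\<close>

lemma represents_deflate:
  assumes a: "nuclear a" and B: "represents a B" and f0: "f0 \<in> V" and i: "\<Phi> f0 i \<noteq> 0"
  shows "represents (deflate a w (\<Phi> f0) i) (\<lambda>f. B f - (w * \<Phi> f i / \<Phi> f0 i) *\<^sub>C f0)"
  unfolding represents_def
proof (intro ballI conjI)
  fix f assume f: "f \<in> V"
  note mem = diff_mem scale_mem represents_mem[OF B] f f0
  show "B f - (w * \<Phi> f i / \<Phi> f0 i) *\<^sub>C f0 \<in> V" by (simp add: mem)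
  have "mapp (deflate a w (\<Phi> f0) i) (\<Phi> f) k = mapp a (\<Phi> f) k - w * \<Phi> f0 k / \<Phi> f0 i * \<Phi> f i" for k
  proof -
    define c where "c = w * \<Phi> f0 k / \<Phi> f0 i * \<Phi> f i"
    have "((\<lambda>_. c) has_sum c) {i}" by (rule has_sum_finiteI) auto
    then have d: "((\<lambda>l. if l = i then c else 0) has_sum c) UNIV"
      by (subst has_sum_cong_neutral[where T = "{i}" and g = "\<lambda>_. c"]) auto
    have "mapp (deflate a w (\<Phi> f0) i) (\<Phi> f) k = (\<Sum>\<^sub>\<infinity>l. a k l * \<Phi> f l + - (if l = i then c else 0))"
      unfolding mapp_def deflate_def by (rule infsum_cong) (simp add: algebra_simps c_def)
    also have "\<dots> = mapp a (\<Phi> f) k + - c"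
    proof -
      have m: "((\<lambda>l. a k l * \<Phi> f l) has_sum mapp a (\<Phi> f) k) UNIV"
        unfolding mapp_def by (intro has_sum_infsum nuclear_mult_bounded(3)[OF a bounded[OF f]])
      have "((\<lambda>l. - (if l = i then c else 0)) has_sum - c) UNIV"
        using d unfolding has_sum_uminus by simp
      then show ?thesis by (intro infsumI has_sum_add m)
    qed
    finally show ?thesis by (simp add: c_def)
  qed
  then show "\<Phi> (B f - (w * \<Phi> f i / \<Phi> f0 i) *\<^sub>C f0) = mapp (deflate a w (\<Phi> f0) i) (\<Phi> f)"
    by (simp add: diff scale mem represents_coord[OF B] mult_ac fun_eq_iff)
qed

lemma gen_eigenspace_trivial:
  assumes a: "nuclear a" and B: "represents a B" and w: "w \<noteq> 0" and nz: "char_det a w \<noteq> 0"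
  shows "gen_eigenspace V B w = {0}"
proof -
  let ?U = "\<lambda>g. w *\<^sub>C g - B g"
  have U: "linear_endo ?U" by (rule linear_endo_shift[OF a B])
  have "f = 0" if "f \<in> V" "(?U ^^ n) f = 0" for f n
    using that
  proof (induction n arbitrary: f)
    case (Suc n)
    have "?U f = 0"
      by (rule Suc.IH) (use Suc.prems linear_endo_mem[OF U] in \<open>simp_all add: funpow_Suc_right del: funpow.simps\<close>)
    then have "B f = w *\<^sub>C f" by simp
    then show ?case
      using eigenvalue_iff[OF a B w] nz Suc.prems(1) unfolding eigenvalues_def by blast
  qed simp
  moreover have "0 \<in> gen_eigenspace V B w"
    by (rule circle_L1.subspace_0[OF gen_eigenspace_subspace[OF a B]])
  ultimately show ?thesis unfolding gen_eigenspace_def by blast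
qed

text \<open>\<open>B'\<close> annihilates \<open>f0\<close>, so powers of \<open>w - B'\<close>
  multiply it by powers of \<open>w\<close> and never reach 0. On the other hand \<open>B\<close>
  and \<open>B'\<close> differ by multiples of \<open>f0\<close>, which \<open>w - B\<close>
  annihilates; hence the powers of \<open>w - B\<close> and \<open>w - B'\<close> agree modulo
  \<open>f0\<close>, and so do the generalised eigenspaces. Deflation removes exactly one
  dimension.\<close>

lemma gen_eigenspace_deflate:
  assumes a: "nuclear a" and B: "represents a B" and w: "w \<noteq> 0" and f0: "f0 \<in> V" "B f0 = w *\<^sub>C f0"
    and i: "\<Phi> f0 i \<noteq> 0"
  defines "B' \<equiv> \<lambda>f. B f - (w * \<Phi> f i / \<Phi> f0 i) *\<^sub>C f0"
  shows "f0 \<notin> gen_eigenspace V B' w"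
    and "f \<in> gen_eigenspace V B w \<longleftrightarrow> (\<exists>c. f - c *\<^sub>C f0 \<in> gen_eigenspace V B' w)"
proof -
  define U where "U = (\<lambda>g. w *\<^sub>C g - B g)"
  define U' where "U' = (\<lambda>g. w *\<^sub>C g - B' g)"
  have B': "represents (deflate a w (\<Phi> f0) i) B'"
    unfolding B'_def by (rule represents_deflate[OF a B f0(1) i])
  have U: "linear_endo U" unfolding U_def by (rule linear_endo_shift[OF a B])
  have U': "linear_endo U'" unfolding U'_def
    by (rule linear_endo_shift[OF nuclear_deflate[OF a summable[OF f0(1)]] B'])
  have Uf0: "U f0 = 0" by (simp add: U_def f0)
  have "U' f0 = w *\<^sub>C f0" using i by (simp add: U'_def B'_def f0)
  then have U'n: "(U' ^^ n) f0 = w ^ n *\<^sub>C f0" for n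
    by (induction n) (simp_all add: linear_endo_scale[OF U' f0(1)] mult.commute)
  have f0nz: "f0 \<noteq> 0" using i zero by auto
  show nmem: "f0 \<notin> gen_eigenspace V B' w"
    using U'n f0nz w unfolding gen_eigenspace_def U'_def by auto
  have rel: "\<exists>c. (U ^^ n) g = (U' ^^ n) g + c *\<^sub>C f0" if g: "g \<in> V" for g n
  proof (induction n)
    case 0
    show ?case by (intro exI[of _ 0]) simp
  next
    case (Suc n)
    then obtain c where c: "(U ^^ n) g = (U' ^^ n) g + c *\<^sub>C f0" by blast
    define h where "h = (U' ^^ n) g"
    have h: "h \<in> V" unfolding h_def by (rule linear_endo_mem[OF linear_endo_funpow[OF U'] g])
    have "(U ^^ Suc n) g = U (h + c *\<^sub>C f0)" by (simp add: c h_def)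
    also have "\<dots> = U h"
      using linear_endo_add[OF U h scale_mem[OF f0(1)]] linear_endo_scale[OF U f0(1)] Uf0 by simp
    also have "\<dots> = U' h + (- (w * \<Phi> h i / \<Phi> f0 i)) *\<^sub>C f0"
      by (simp add: U_def U'_def B'_def)
    finally have "(U ^^ Suc n) g = U' h + (- (w * \<Phi> h i / \<Phi> f0 i)) *\<^sub>C f0" .
    then show ?case by (intro exI[of _ "- (w * \<Phi> h i / \<Phi> f0 i)"]) (simp add: h_def)
  qed
  show "f \<in> gen_eigenspace V B w \<longleftrightarrow> (\<exists>c. f - c *\<^sub>C f0 \<in> gen_eigenspace V B' w)"
  proof
    assume "f \<in> gen_eigenspace V B w"
    then obtain n where f: "f \<in> V" "(U ^^ n) f = 0" unfolding gen_eigenspace_def U_def by auto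
    obtain c where "(U ^^ n) f = (U' ^^ n) f + c *\<^sub>C f0" using rel[OF f(1)] by blast
    then have c: "(U' ^^ n) f = (- c) *\<^sub>C f0" using f(2) by (simp add: eq_neg_iff_add_eq_0)
    \<comment> \<open>\<open>U' ^^ n\<close> multiplies \<open>f0\<close> by \<open>w ^ n\<close>,
      so the coefficient \<open>c / w ^ n\<close> cancels the remainder.\<close>
    have "(U' ^^ n) (f + (c / w ^ n) *\<^sub>C f0) = (- c) *\<^sub>C f0 + (c / w ^ n) *\<^sub>C (w ^ n *\<^sub>C f0)"
      using linear_endo_add[OF linear_endo_funpow[OF U'] f(1) scale_mem[OF f0(1)]]
        linear_endo_scale[OF linear_endo_funpow[OF U'] f0(1)] c U'n by simp
    also have "\<dots> = 0" using w by simp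
    finally have "f + (c / w ^ n) *\<^sub>C f0 \<in> gen_eigenspace V B' w"
      unfolding gen_eigenspace_def U'_def[symmetric] using add_mem[OF f(1) scale_mem[OF f0(1)]] by auto
    then show "\<exists>c. f - c *\<^sub>C f0 \<in> gen_eigenspace V B' w"
      by (intro exI[of _ "- (c / w ^ n)"]) simp
  next
    assume "\<exists>c. f - c *\<^sub>C f0 \<in> gen_eigenspace V B' w"
    then obtain c n where g: "f - c *\<^sub>C f0 \<in> V" "(U' ^^ n) (f - c *\<^sub>C f0) = 0"
      unfolding gen_eigenspace_def U'_def by auto
    obtain d where d: "(U ^^ n) (f - c *\<^sub>C f0) = d *\<^sub>C f0" using rel[OF g(1), of n] g(2) by auto
    \<comment> \<open>One further application of \<open>U\<close> kills the remaining multiple of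
      \<open>f0\<close>.\<close>
    have "(U ^^ Suc n) (f - c *\<^sub>C f0) = 0"
      using d linear_endo_scale[OF U f0(1)] Uf0 by simp
    then have "f - c *\<^sub>C f0 \<in> gen_eigenspace V B w"
      using g(1) unfolding gen_eigenspace_def U_def by blast
    moreover have "f0 \<in> gen_eigenspace V B w"
      using f0 unfolding gen_eigenspace_def by (auto intro!: exI[of _ 1])
    ultimately have "(f - c *\<^sub>C f0) + c *\<^sub>C f0 \<in> gen_eigenspace V B w"
      by (intro circle_L1.subspace_add circle_L1.subspace_scale gen_eigenspace_subspace[OF a B])
    then show "f \<in> gen_eigenspace V B w" by simp
  qed
qed

text \<open>Induction on the order of the zero: deflating by an eigenvector divides the determinant
  by \<open>(z - w) / z\<close>, which lowers the order by one, and removes one dimension. The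
  cofactor \<open>g\<close> turns into \<open>z * g z\<close>, still nonzero at \<open>w\<close>,
  and is therefore kept arbitrary. At order 0 there is no generalised eigenvector but 0.\<close>

lemma gen_eigenspace_basis:
  assumes a: "nuclear a" and B: "represents a B" and w: "w \<noteq> 0" and r: "r > 0" "0 \<notin> ball w r"
    and g: "g holomorphic_on ball w r" "g w \<noteq> 0"
    and fac: "\<And>z. z \<in> ball w r \<Longrightarrow> char_det a z = (z - w) ^ n * g z"
  shows "\<exists>S. finite S \<and> card S = n \<and> circle_L1.independent S \<and> circle_L1.span S = gen_eigenspace V B w"
  using a B g fac
proof (induction n arbitrary: a B g)
  case 0
  have "char_det a w \<noteq> 0" using 0(5)[of w] 0(4) r by simp
  then have "gen_eigenspace V B w = {0}" by (rule gen_eigenspace_trivial[OF 0(1,2) w])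
  then show ?case
    by (intro exI[of _ "{}"]) (simp add: circle_L1.independent_empty)
next
  case (Suc n)
  note a = Suc.prems(1) and B = Suc.prems(2)
  have "char_det a w = 0" using Suc.prems(5)[of w] r by simp
  then obtain f0 where f0: "f0 \<in> V" "f0 \<noteq> 0" "B f0 = w *\<^sub>C f0"
    using eigenvalue_iff[OF a B w] by (auto simp: eigenvalues_def)
  obtain i where i: "\<Phi> f0 i \<noteq> 0" using inj0[OF f0(1)] f0(2) by (metis (full_types) ext)
  define B' where "B' = (\<lambda>f. B f - (w * \<Phi> f i / \<Phi> f0 i) *\<^sub>C f0)"
  define a' where "a' = deflate a w (\<Phi> f0) i"
  have a': "nuclear a'" unfolding a'_def by (rule nuclear_deflate[OF a summable[OF f0(1)]])
  have B': "represents a' B'" unfolding a'_def B'_def by (rule represents_deflate[OF a B f0(1) i])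
  have eig: "mapp a (\<Phi> f0) k = w * \<Phi> f0 k" for k
    using fun_cong[OF represents_coord[OF B f0(1)], of k] by (simp add: f0(3) scale[OF f0(1)])
  have off: "char_det a' z = (z - w) ^ n * (z * g z)" if z: "z \<in> ball w r" "z \<noteq> w" for z
  proof -
    have z0: "z \<noteq> 0" using z r by auto
    have "(z - w) * char_det a' z = (z - w) * ((z - w) ^ n * (z * g z))"
      using char_det_deflate[OF a summable[OF f0(1)] eig i z0] Suc.prems(5)[OF z(1)]
      unfolding a'_def by (simp add: algebra_simps)
    then show ?thesis using z(2) by simp
  qed
  \<comment> \<open>At \<open>z = w\<close> the factor \<open>z - w\<close> cannot be cancelled;
    there both sides are compared by continuity.\<close>
  have fac': "char_det a' z = (z - w) ^ n * (z * g z)" if z: "z \<in> ball w r" for z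
  proof (cases "z = w")
    case True
    have "open (- {0::complex})" by (intro open_Compl) simp
    then have "isCont (char_det a') w"
      using holomorphic_on_imp_continuous_on[OF char_det_holomorphic[OF a']] w
      by (auto simp: continuous_on_eq_continuous_at)
    moreover have "isCont g w"
      using holomorphic_on_imp_continuous_on[OF Suc.prems(3)] r by (simp add: continuous_on_eq_continuous_at)
    then have "isCont (\<lambda>z. (z - w) ^ n * (z * g z)) w" by (intro continuous_intros)
    ultimately have lim: "(char_det a' \<longlongrightarrow> char_det a' w) (at w)"
      "((\<lambda>z. (z - w) ^ n * (z * g z)) \<longlongrightarrow> (w - w) ^ n * (w * g w)) (at w)"
      unfolding isCont_def by auto
    have "(char_det a' \<longlongrightarrow> (w - w) ^ n * (w * g w)) (at w)"
    proof (rule Lim_transform_within_open[OF lim(2) open_ball])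
      show "w \<in> ball w r" using r by simp
    qed (use off in simp)
    then show ?thesis using tendsto_unique[OF _ lim(1)] True by simp
  qed (use off z in simp)
  obtain S where S: "finite S" "card S = n" "circle_L1.independent S"
    "circle_L1.span S = gen_eigenspace V B' w"
  proof -
    have "(\<lambda>z. z * g z) holomorphic_on ball w r" by (intro holomorphic_intros Suc.prems(3))
    moreover have "w * g w \<noteq> 0" using Suc.prems(4) w by simp
    ultimately show thesis using Suc.IH[OF a' B' _ _ fac'] that by blast
  qed
  note defl = gen_eigenspace_deflate[OF a B w f0(1,3) i, folded B'_def]
  have nin: "f0 \<notin> circle_L1.span S" using defl(1) S(4) by simp
  have "circle_L1.span (insert f0 S) = gen_eigenspace V B w"
  proof (rule Set.set_eqI)
    fix f show "f \<in> circle_L1.span (insert f0 S) \<longleftrightarrow> f \<in> gen_eigenspace V B w"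
      unfolding circle_L1.span_insert S(4) using defl(2)[of f] by simp
  qed
  moreover have "circle_L1.independent (insert f0 S)"
    using S(3) nin by (rule circle_L1.independent_insertI[rotated])
  moreover have "f0 \<notin> S" using nin circle_L1.span_base[of f0 S] by auto
  then have "card (insert f0 S) = Suc n" using S(1,2) by simp
  ultimately show ?case using S(1) by (intro exI[of _ "insert f0 S"]) simp
qed

lemma alg_mult_eq_zorder:
  assumes a: "nuclear a" and B: "represents a B" and w: "w \<noteq> 0" and 0: "char_det a w = 0"
  shows "alg_mult V B w = enat (nat (zorder (char_det a) w))" and "zorder (char_det a) w > 0"
proof -
  have conn: "connected (- {0::complex})" by (rule connected_punctured_universe) simp
  obtain z :: complex where z: "cmod z > nuclear_norm a / ln 2" "z \<noteq> 0"
  proof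
    let ?t = "nuclear_norm a / ln 2 + 1"
    have "nuclear_norm a / ln 2 \<ge> 0" using nuclear_norm_nonneg by simp
    then show "cmod (complex_of_real ?t) > nuclear_norm a / ln 2" "complex_of_real ?t \<noteq> 0"
      by (auto simp del: of_real_add simp: of_real_eq_0_iff)
  qed
  have nz: "\<exists>z\<in>- {0}. char_det a z \<noteq> 0" using char_det_nonzero_far[OF a z] z(2) by blast
  let ?n = "zorder (char_det a) w" and ?g = "zor_poly (char_det a) w"
  obtain r where r: "r > 0" "cball w r \<subseteq> - {0}" "?g holomorphic_on cball w r"
    "\<forall>z\<in>cball w r. char_det a z = ?g z * (z - w) ^ nat ?n \<and> ?g z \<noteq> 0" and n: "?n > 0"
    using zorder_exist_zero[OF char_det_holomorphic[OF a] _ conn _ nz, of w] w 0 by auto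
  show "?n > 0" by (rule n)
  have "\<exists>S. finite S \<and> card S = nat ?n \<and> circle_L1.independent S \<and> circle_L1.span S = gen_eigenspace V B w"
  proof (rule gen_eigenspace_basis[OF a B w r(1), of ?g])
    show "?g holomorphic_on ball w r" using r(3) ball_subset_cball by (rule holomorphic_on_subset)
    show "0 \<notin> ball w r"
    proof
      assume "0 \<in> ball w r"
      then have "0 \<in> cball w r" by simp
      from subsetD[OF r(2) this] show False by simp
    qed
    have "w \<in> cball w r" using r(1) by simp
    from bspec[OF r(4) this] show "?g w \<noteq> 0" ..
    show "char_det a z = (z - w) ^ nat ?n * ?g z" if "z \<in> ball w r" for z
    proof -
      have "z \<in> cball w r" using that by simp
      from bspec[OF r(4) this] have "char_det a z = ?g z * (z - w) ^ nat ?n" ..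
      then show ?thesis by (simp only: mult.commute)
    qed
  qed
  then obtain S where S: "finite S" "card S = nat ?n" "circle_L1.independent S"
    "circle_L1.span S = gen_eigenspace V B w" by blast
  have "circle_L1.dim (gen_eigenspace V B w) = card S"
    by (rule circle_L1.dim_eq_card[OF _ S(3)])
       (metis S(4) circle_L1.span_span)
  moreover have "\<exists>F. finite F \<and> gen_eigenspace V B w \<subseteq> circle_L1.span F"
    using S by (intro exI[of _ S]) simp
  ultimately show "alg_mult V B w = enat (nat ?n)" by (simp add: alg_mult_def S(2))
qed

lemma total_mult_eq_zero_count:
  assumes a: "nuclear a" and B: "represents a B" and D: "0 \<notin> D" "finite {z \<in> D. char_det a z = 0}"
  shows "total_mult V B D = enat (nat (\<Sum>z | z \<in> D \<and> char_det a z = 0. zorder (char_det a) z))"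
proof -
  have eq: "D \<inter> eigenvalues V B = {z \<in> D. char_det a z = 0}"
  proof (intro equalityI subsetI)
    fix z assume z: "z \<in> D \<inter> eigenvalues V B"
    then have "z \<noteq> 0" using D(1) by auto
    then show "z \<in> {z \<in> D. char_det a z = 0}" using z eigenvalue_iff[OF a B] by simp
  next
    fix z assume z: "z \<in> {z \<in> D. char_det a z = 0}"
    then have "z \<noteq> 0" using D(1) by auto
    then show "z \<in> D \<inter> eigenvalues V B" using z eigenvalue_iff[OF a B] by simp
  qed
  have ne: "z \<noteq> 0" if "z \<in> D" for z using that D(1) by auto
  have "total_mult V B D = (\<Sum>z | z \<in> D \<and> char_det a z = 0. alg_mult V B z)"
    unfolding total_mult_def eq using D(2) by simp
  also have "\<dots> = (\<Sum>z | z \<in> D \<and> char_det a z = 0. enat (nat (zorder (char_det a) z)))"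
    by (rule sum.cong) (auto intro!: alg_mult_eq_zorder[OF a B] ne)
  also have "\<dots> = enat (\<Sum>z | z \<in> D \<and> char_det a z = 0. nat (zorder (char_det a) z))"
    by (simp flip: of_nat_eq_enat)
  also have "(\<Sum>z | z \<in> D \<and> char_det a z = 0. nat (zorder (char_det a) z)) = nat (\<Sum>z | z \<in> D \<and> char_det a z = 0. zorder (char_det a) z)"
  proof -
    have "int (\<Sum>z | z \<in> D \<and> char_det a z = 0. nat (zorder (char_det a) z)) = (\<Sum>z | z \<in> D \<and> char_det a z = 0. zorder (char_det a) z)"
      unfolding of_nat_sum
      by (rule sum.cong) (use alg_mult_eq_zorder(2)[OF a B] ne in \<open>auto simp: less_imp_le\<close>)
    then show ?thesis by linarith
  qed
  finally show ?thesis .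
qed

end

section \<open>The spaces \<open>\<A>\<^sub>\<beta>\<close> as weighted sequence spaces\<close>

definition fourier_weight :: "real \<Rightarrow> int \<Rightarrow> real" where
  "fourier_weight \<beta> k = exp (2 * pi * of_int \<bar>k\<bar> * \<beta>)"

text \<open>Real counterpart of \<open>fourier_norm\<close>. The two are identified only on
  \<open>fourier_space\<close>, since a real \<open>infsum\<close> that does not converge is
  0.\<close>

definition fourier_sum :: "real \<Rightarrow> circle_L1 \<Rightarrow> real" where
  "fourier_sum \<beta> f = (\<Sum>\<^sub>\<infinity>k. fourier_weight \<beta> k * cmod (fourier_coeff f k))"

lemma fourier_weight_pos [simp]: "fourier_weight \<beta> k > 0"
  by (simp add: fourier_weight_def)

lemma fourier_weight_nonneg [simp]: "fourier_weight \<beta> k \<ge> 0"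
  using fourier_weight_pos[of \<beta> k] by (rule less_imp_le)

lemma fourier_weight_nz [simp]: "fourier_weight \<beta> k \<noteq> 0"
  using fourier_weight_pos[of \<beta> k] by (rule less_imp_neq[THEN not_sym])

lemma fourier_weight_mono: "\<beta> \<le> \<beta>' \<Longrightarrow> fourier_weight \<beta> k \<le> fourier_weight \<beta>' k"
  by (simp add: fourier_weight_def mult_left_mono)

lemma fourier_weight_0 [simp]: "fourier_weight 0 k = 1"
  by (simp add: fourier_weight_def)

text \<open>In \<open>ennreal\<close> every sum exists as the supremum of its finite partial sums;
  finiteness of this supremum bounds the real partial sums, hence gives summability.\<close>

lemma infsum_ennreal_finite_iff:
  fixes f :: "'a \<Rightarrow> real"
  assumes nn: "\<And>x. f x \<ge> 0"
  shows "(\<Sum>\<^sub>\<infinity>x. ennreal (f x)) < \<infinity> \<longleftrightarrow> f summable_on UNIV"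
    and "f summable_on UNIV \<Longrightarrow> (\<Sum>\<^sub>\<infinity>x. ennreal (f x)) = ennreal (infsum f UNIV)"
proof -
  have sup: "(\<Sum>\<^sub>\<infinity>x. ennreal (f x)) = (SUP F\<in>{F. finite F \<and> F \<subseteq> UNIV}. ennreal (sum f F))"
    by (subst nonneg_infsum_complete) (simp_all add: nn)
  show eq: "(\<Sum>\<^sub>\<infinity>x. ennreal (f x)) = ennreal (infsum f UNIV)" if "f summable_on UNIV"
    unfolding sup using infsum_nonneg_is_SUPREMUM_ennreal[OF that nn] by simp
  show "(\<Sum>\<^sub>\<infinity>x. ennreal (f x)) < \<infinity> \<longleftrightarrow> f summable_on UNIV"
  proof
    assume fin: "(\<Sum>\<^sub>\<infinity>x. ennreal (f x)) < \<infinity>"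
    then obtain M where M: "M \<ge> 0" "(\<Sum>\<^sub>\<infinity>x. ennreal (f x)) = ennreal M"
      by (cases "(\<Sum>\<^sub>\<infinity>x. ennreal (f x))") auto
    show "f summable_on UNIV"
    proof (rule nonneg_bdd_above_summable_on)
      show "bdd_above (sum f ` {F. F \<subseteq> UNIV \<and> finite F})"
      proof (rule bdd_aboveI2)
        fix F :: "'a set" assume "F \<in> {F. F \<subseteq> UNIV \<and> finite F}"
        then have "ennreal (sum f F) \<le> ennreal M"
          unfolding M(2)[symmetric] sup by (intro SUP_upper) auto
        then show "sum f F \<le> M" using M(1) by (simp add: ennreal_le_iff)
      qed
    qed (rule nn)
  next
    assume "f summable_on UNIV"
    from eq[OF this] show "(\<Sum>\<^sub>\<infinity>x. ennreal (f x)) < \<infinity>" by simp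
  qed
qed

lemma mem_fourier_space_iff:
  "f \<in> fourier_space \<beta> \<longleftrightarrow> (\<lambda>k. fourier_weight \<beta> k * cmod (fourier_coeff f k)) summable_on UNIV"
  unfolding fourier_space_def fourier_norm_def fourier_weight_def mem_Collect_eq
  by (rule infsum_ennreal_finite_iff(1)) simp

lemma fourier_norm_eq: "f \<in> fourier_space \<beta> \<Longrightarrow> fourier_norm \<beta> f = ennreal (fourier_sum \<beta> f)"
  unfolding mem_fourier_space_iff fourier_norm_def fourier_sum_def
  unfolding fourier_weight_def
  by (rule infsum_ennreal_finite_iff(2)) simp_all

lemma fourier_sum_nonneg: "fourier_sum \<beta> f \<ge> 0"
  unfolding fourier_sum_def by (rule infsum_nonneg) simp

lemma fourier_space_mono:
  assumes "\<beta> \<le> \<beta>'" "f \<in> fourier_space \<beta>'"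
  shows "f \<in> fourier_space \<beta>" and "fourier_sum \<beta> f \<le> fourier_sum \<beta>' f"
proof -
  have le: "fourier_weight \<beta> k * cmod (fourier_coeff f k) \<le> fourier_weight \<beta>' k * cmod (fourier_coeff f k)" for k
    by (rule mult_right_mono[OF fourier_weight_mono[OF assms(1)]]) simp
  note s = assms(2)[unfolded mem_fourier_space_iff]
  show m: "f \<in> fourier_space \<beta>"
    unfolding mem_fourier_space_iff by (rule summable_on_comparison_test[OF s le]) simp
  show "fourier_sum \<beta> f \<le> fourier_sum \<beta>' f"
    unfolding fourier_sum_def
    by (rule infsum_mono[OF m[unfolded mem_fourier_space_iff] s le])
qed

lemma fourier_space_coeff_summable:
  assumes "0 \<le> \<beta>" "f \<in> fourier_space \<beta>"
  shows "(\<lambda>k. cmod (fourier_coeff f k)) summable_on UNIV"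
  using fourier_space_mono(1)[OF assms] unfolding mem_fourier_space_iff by simp

lemma fourier_space_scaleC:
  assumes "f \<in> fourier_space \<beta>"
  shows "c *\<^sub>C f \<in> fourier_space \<beta>" and "fourier_sum \<beta> (c *\<^sub>C f) = cmod c * fourier_sum \<beta> f"
proof -
  have eq: "fourier_weight \<beta> k * cmod (fourier_coeff (c *\<^sub>C f) k) =
      cmod c * (fourier_weight \<beta> k * cmod (fourier_coeff f k))" for k
    by (simp add: fourier_coeff_scaleC norm_mult)
  show "c *\<^sub>C f \<in> fourier_space \<beta>"
    using assms unfolding mem_fourier_space_iff eq by (rule summable_on_cmult_right)
  show "fourier_sum \<beta> (c *\<^sub>C f) = cmod c * fourier_sum \<beta> f"
    unfolding fourier_sum_def eq by (rule infsum_cmult_right')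
qed

lemma fourier_space_add:
  assumes f: "f \<in> fourier_space \<beta>" and g: "g \<in> fourier_space \<beta>"
  shows "f + g \<in> fourier_space \<beta>" and "fourier_sum \<beta> (f + g) \<le> fourier_sum \<beta> f + fourier_sum \<beta> g"
proof -
  have le: "fourier_weight \<beta> k * cmod (fourier_coeff (f + g) k) \<le>
      fourier_weight \<beta> k * cmod (fourier_coeff f k) + fourier_weight \<beta> k * cmod (fourier_coeff g k)" for k
    unfolding fourier_coeff_add distrib_left[symmetric]
    by (intro mult_left_mono norm_triangle_ineq fourier_weight_nonneg)
  note s = f[unfolded mem_fourier_space_iff] g[unfolded mem_fourier_space_iff]
  show m: "f + g \<in> fourier_space \<beta>"
    unfolding mem_fourier_space_iff
    by (rule summable_on_comparison_test[OF summable_on_add[OF s] le]) simp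
  show "fourier_sum \<beta> (f + g) \<le> fourier_sum \<beta> f + fourier_sum \<beta> g"
    unfolding fourier_sum_def infsum_add[OF s, symmetric]
    by (rule infsum_mono[OF m[unfolded mem_fourier_space_iff] summable_on_add[OF s] le])
qed

lemma fourier_space_subspace: "circle_L1.subspace (fourier_space \<beta>)"
proof (rule circle_L1.subspaceI)
  show "0 \<in> fourier_space \<beta>" by (simp add: mem_fourier_space_iff fourier_coeff_0)
qed (rule fourier_space_add fourier_space_scaleC; assumption)+

lemma fourier_space_diff: "f \<in> fourier_space \<beta> \<Longrightarrow> g \<in> fourier_space \<beta> \<Longrightarrow> f - g \<in> fourier_space \<beta>"
  by (rule circle_L1.subspace_diff[OF fourier_space_subspace])

lemma fourier_sum_pos:
  assumes "0 \<le> \<beta>" "f \<in> fourier_space \<beta>" "f \<noteq> 0"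
  shows "fourier_sum \<beta> f > 0"
proof (rule ccontr)
  assume "\<not> fourier_sum \<beta> f > 0"
  then have "(\<Sum>\<^sub>\<infinity>k. fourier_weight \<beta> k * cmod (fourier_coeff f k)) = 0"
    using fourier_sum_nonneg[of \<beta> f] unfolding fourier_sum_def by simp
  then have "fourier_weight \<beta> k * cmod (fourier_coeff f k) = 0" for k
    using nonneg_infsum_le_0D[of "\<lambda>k. fourier_weight \<beta> k * cmod (fourier_coeff f k)" UNIV k]
      assms(2)[unfolded mem_fourier_space_iff] by simp
  then have "fourier_coeff f k = 0" for k by simp
  then have "f = 0" by (intro circle_L1_eqI) (simp add: fourier_coeff_0)
  then show False using assms(3) by simp
qed

text \<open>Young's inequality \<open>x powr \<theta> * l powr (1 - \<theta>) \<le> \<theta> * x +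
  (1 - \<theta>) * l\<close>, applied to each weight \<open>x = fourier_weight \<alpha> k\<close>,
  whose power with exponent \<theta> is the weight for \<eta>. The choice of \<open>l\<close> as the
  quotient of the norms makes the summed right-hand side collapse to
  \<open>fourier_sum \<alpha> f\<close>.\<close>

lemma interpolation:
  assumes "0 < \<eta>" "\<eta> < \<alpha>" and f: "f \<in> fourier_space \<alpha>" "f \<noteq> 0"
  defines "\<theta> \<equiv> \<eta> / \<alpha>" and "l \<equiv> fourier_sum \<alpha> f / fourier_sum 0 f"
  shows "l powr (1 - \<theta>) * fourier_sum \<eta> f \<le> fourier_sum \<alpha> f"
proof -
  have al: "0 < \<alpha>" using assms by simp
  have th: "0 \<le> \<theta>" "\<theta> \<le> 1" using assms(1,2) by (simp_all add: \<theta>_def)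
  have f0: "f \<in> fourier_space 0" "f \<in> fourier_space \<eta>"
    using fourier_space_mono(1)[OF _ f(1)] assms by auto
  have N0: "fourier_sum 0 f > 0" by (rule fourier_sum_pos[OF _ f0(1) f(2)]) simp
  have Na: "fourier_sum \<alpha> f > 0" by (rule fourier_sum_pos[OF _ f]) (use al in simp)
  have l: "l > 0" unfolding l_def using N0 Na by simp
  have w: "l powr (1 - \<theta>) * fourier_weight \<eta> k \<le> \<theta> * fourier_weight \<alpha> k + (1 - \<theta>) * l" for k
  proof -
    have "fourier_weight \<eta> k = fourier_weight \<alpha> k powr \<theta>"
      using al by (simp add: fourier_weight_def powr_def \<theta>_def)
    then show ?thesis
      using Youngs_inequality_0[of \<theta> "1 - \<theta>" "fourier_weight \<alpha> k" l] th l
      by (simp add: mult.commute)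
  qed
  let ?c = "\<lambda>k. cmod (fourier_coeff f k)"
  note s = f(1)[unfolded mem_fourier_space_iff] f0[unfolded mem_fourier_space_iff]
  have s0: "?c summable_on UNIV" using s(2) by simp
  have "l powr (1 - \<theta>) * fourier_sum \<eta> f = (\<Sum>\<^sub>\<infinity>k. l powr (1 - \<theta>) * (fourier_weight \<eta> k * ?c k))"
    unfolding fourier_sum_def by (rule infsum_cmult_right'[symmetric])
  also have "\<dots> \<le> (\<Sum>\<^sub>\<infinity>k. \<theta> * (fourier_weight \<alpha> k * ?c k) + (1 - \<theta>) * l * ?c k)"
  proof (rule infsum_mono)
    show "(\<lambda>k. l powr (1 - \<theta>) * (fourier_weight \<eta> k * ?c k)) summable_on UNIV"
      by (rule summable_on_cmult_right[OF s(3)])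
    show "(\<lambda>k. \<theta> * (fourier_weight \<alpha> k * ?c k) + (1 - \<theta>) * l * ?c k) summable_on UNIV"
      by (intro summable_on_add summable_on_cmult_right s(1) s0)
    show "l powr (1 - \<theta>) * (fourier_weight \<eta> k * ?c k)
        \<le> \<theta> * (fourier_weight \<alpha> k * ?c k) + (1 - \<theta>) * l * ?c k" for k
      using mult_right_mono[OF w[of k], of "?c k"] by (simp add: algebra_simps)
  qed
  also have "\<dots> = (\<Sum>\<^sub>\<infinity>k. \<theta> * (fourier_weight \<alpha> k * ?c k)) + (\<Sum>\<^sub>\<infinity>k. (1 - \<theta>) * l * ?c k)"
    by (intro infsum_add summable_on_cmult_right s(1) s0)
  also have "\<dots> = \<theta> * fourier_sum \<alpha> f + (1 - \<theta>) * l * fourier_sum 0 f"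
    unfolding fourier_sum_def by (simp add: infsum_cmult_right')
  also have "\<dots> = fourier_sum \<alpha> f"
  proof -
    have "l * fourier_sum 0 f = fourier_sum \<alpha> f" using N0 by (simp add: l_def)
    then show ?thesis unfolding mult.assoc by (simp add: algebra_simps)
  qed
  finally show ?thesis .
qed

text \<open>Multiplying by the weights turns the norm of \<open>\<A>\<^sub>\<beta>\<close> into the
  \<open>l^1\<close> norm of the coordinates; \<open>int_decode\<close> enumerates the frequencies
  by natural numbers.\<close>

definition weighted_coeff :: "real \<Rightarrow> circle_L1 \<Rightarrow> nat \<Rightarrow> complex" where
  "weighted_coeff \<beta> f i = of_real (fourier_weight \<beta> (int_decode i)) * fourier_coeff f (int_decode i)"

lemma weighted_coeff_summable_iff:
  "(\<lambda>i. cmod (weighted_coeff \<beta> f i)) summable_on UNIV \<longleftrightarrow> f \<in> fourier_space \<beta>"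
  unfolding mem_fourier_space_iff weighted_coeff_def norm_mult
  using summable_on_reindex_bij_betw[OF bij_int_decode, of "\<lambda>k. fourier_weight \<beta> k * cmod (fourier_coeff f k)"]
  by simp

lemma infsum_weighted_coeff: "(\<Sum>\<^sub>\<infinity>i. cmod (weighted_coeff \<beta> f i)) = fourier_sum \<beta> f"
  unfolding fourier_sum_def weighted_coeff_def norm_mult
  using infsum_reindex_bij_betw[OF bij_int_decode, of "\<lambda>k. fourier_weight \<beta> k * cmod (fourier_coeff f k)"]
  by simp

text \<open>For \<open>0 \<le> \<beta>\<close> the weights are at least 1, so dividing a summable
  sequence by them keeps it summable, and its Fourier series is an integrable function with the
  desired coefficients. Injectivity is the uniqueness of Fourier coefficients.\<close>

lemma l1_coordinates_fourier_space:
  assumes "0 \<le> \<beta>"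
  shows "l1_coordinates (fourier_space \<beta>) (weighted_coeff \<beta>)"
proof
  show "circle_L1.subspace (fourier_space \<beta>)" by (rule fourier_space_subspace)
  show "weighted_coeff \<beta> (f + g) = (\<lambda>k. weighted_coeff \<beta> f k + weighted_coeff \<beta> g k)" for f g
    by (rule ext) (simp add: weighted_coeff_def fourier_coeff_add algebra_simps)
  show "weighted_coeff \<beta> (c *\<^sub>C f) = (\<lambda>k. c * weighted_coeff \<beta> f k)" for c f
    by (rule ext) (simp add: weighted_coeff_def fourier_coeff_scaleC)
  show "f = 0" if "weighted_coeff \<beta> f = (\<lambda>_. 0)" for f
  proof (rule circle_L1_eqI)
    fix k
    have "weighted_coeff \<beta> f (int_encode k) = 0" using that by simp
    then show "fourier_coeff f k = fourier_coeff 0 k" by (simp add: weighted_coeff_def fourier_coeff_0)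
  qed
  show "(\<lambda>k. cmod (weighted_coeff \<beta> f k)) summable_on UNIV" if "f \<in> fourier_space \<beta>" for f
    using that by (simp add: weighted_coeff_summable_iff)
  show "\<exists>f\<in>fourier_space \<beta>. weighted_coeff \<beta> f = x" if x: "(\<lambda>k. cmod (x k)) summable_on UNIV" for x
  proof -
    define c where "c = (\<lambda>k. x (int_encode k) / of_real (fourier_weight \<beta> k))"
    have x': "(\<lambda>k. cmod (x (int_encode k))) summable_on UNIV"
      using summable_on_reindex_bij_betw[OF bij_int_encode, of "\<lambda>k. cmod (x k)"] x by simp
    have "(\<lambda>k. cmod (c k)) summable_on UNIV"
    proof (rule summable_on_comparison_test[OF x'])
      fix k
      have "fourier_weight \<beta> k \<ge> 1" using fourier_weight_mono[OF assms, of k] by simp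
      then have "cmod (x (int_encode k)) * 1 \<le> cmod (x (int_encode k)) * fourier_weight \<beta> k"
        by (intro mult_left_mono) auto
      then show "cmod (c k) \<le> cmod (x (int_encode k))"
        by (simp add: c_def norm_divide pos_divide_le_eq)
    qed simp
    then have fc: "fourier_coeff (abs_circle_L1 (fourier_series c)) k = c k" for k
      by (rule fourier_coeff_series)
    have eq: "weighted_coeff \<beta> (abs_circle_L1 (fourier_series c)) = x"
    proof
      fix i
      have "weighted_coeff \<beta> (abs_circle_L1 (fourier_series c)) i =
          of_real (fourier_weight \<beta> (int_decode i)) * c (int_decode i)"
        unfolding weighted_coeff_def fc ..
      then show "weighted_coeff \<beta> (abs_circle_L1 (fourier_series c)) i = x i" by (simp add: c_def)
    qed
    have "abs_circle_L1 (fourier_series c) \<in> fourier_space \<beta>"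
      using x unfolding weighted_coeff_summable_iff[symmetric] eq .
    then show ?thesis using eq by (rule bexI[rotated])
  qed
qed

text \<open>Two geometric series in \<open>q\<close>, over \<open>k \<ge> 0\<close> and over
  \<open>k < 0\<close>; the second starts with exponent 1, so that \<open>k = 0\<close> is counted
  once. For \<open>c = \<rho> - \<alpha>\<close> this is the base of the second power in
  \<open>r\<close>.\<close>

lemma has_sum_exp_abs:
  assumes c: "c > 0"
  shows "((\<lambda>k::int. exp (- (2 * pi * of_int \<bar>k\<bar> * c))) has_sum 1 + 2 / (exp (2 * pi * c) - 1)) UNIV"
proof -
  define q where "q = exp (- (2 * pi * c))"
  have q: "0 < q" "q < 1" using c by (simp_all add: q_def)
  have pw: "exp (- (2 * pi * of_int \<bar>k\<bar> * c)) = q ^ nat \<bar>k\<bar>" for k :: int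
    by (simp add: q_def flip: exp_of_nat_mult)
  have geo: "((\<lambda>n. q ^ n) has_sum 1 / (1 - q)) UNIV"
    using q by (intro norm_summable_imp_has_sum) (auto simp: geometric_sums intro!: summable_geometric)
  have geo1: "((\<lambda>n. q ^ Suc n) has_sum q * (1 / (1 - q))) UNIV"
    unfolding power_Suc by (rule has_sum_cmult_right[OF geo])
  have nn: "((\<lambda>k::int. q ^ nat \<bar>k\<bar>) has_sum 1 / (1 - q)) (range int)"
    by (subst has_sum_reindex) (simp_all add: o_def geo)
  have ng: "((\<lambda>k::int. q ^ nat \<bar>k\<bar>) has_sum q * (1 / (1 - q))) (range (\<lambda>n. - int (Suc n)))"
  proof (subst has_sum_reindex)
    show "inj (\<lambda>n. - int (Suc n))" by (rule injI) simp
    have e: "nat \<bar>- int (Suc n)\<bar> = Suc n" for n by simp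
    show "((\<lambda>k. q ^ nat \<bar>k\<bar>) \<circ> (\<lambda>n. - int (Suc n)) has_sum q * (1 / (1 - q))) UNIV"
      unfolding o_def e by (rule geo1)
  qed
  have un: "range int \<union> range (\<lambda>n. - int (Suc n)) = UNIV"
  proof (intro equalityI subsetI UnCI)
    fix k :: int assume "k \<notin> range (\<lambda>n. - int (Suc n))"
    moreover have "k = - int (Suc (nat (- k - 1)))" if "k < 0" using that by simp
    ultimately have "\<not> k < 0" by (metis rangeI)
    then have "k = int (nat k)" by simp
    then show "k \<in> range int" by (rule range_eqI)
  qed simp
  have "((\<lambda>k::int. q ^ nat \<bar>k\<bar>) has_sum 1 / (1 - q) + q * (1 / (1 - q))) UNIV"
    unfolding un[symmetric] by (rule has_sum_Un_disjoint[OF nn ng]) auto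
  moreover have "1 / (1 - q) + q * (1 / (1 - q)) = 1 + 2 / (exp (2 * pi * c) - 1)"
  proof -
    have "exp (2 * pi * c) = 1 / q" by (simp add: q_def exp_minus divide_inverse)
    moreover have "1 / q - 1 = (1 - q) / q" using q by (simp add: diff_divide_distrib)
    moreover have "1 / (1 - q) + q * (1 / (1 - q)) = 1 + 2 * (q / (1 - q))"
      using q by (simp add: divide_simps)
    ultimately show ?thesis by simp
  qed
  ultimately show ?thesis unfolding pw by simp
qed

definition decay_const :: "real \<Rightarrow> real" where
  "decay_const c = 1 + 2 / (exp (2 * pi * c) - 1)"

lemma decay_const_pos: "c > 0 \<Longrightarrow> decay_const c > 0"
  by (simp add: decay_const_def add_pos_nonneg)

lemma fourier_weight_ratio:
  "fourier_weight \<beta> k / fourier_weight \<beta>' k = exp (- (2 * pi * of_int \<bar>k\<bar> * (\<beta>' - \<beta>)))"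
  by (simp add: fourier_weight_def exp_diff[symmetric] algebra_simps)

lemma has_sum_fourier_weight_ratio:
  "\<beta> < \<beta>' \<Longrightarrow> ((\<lambda>k. fourier_weight \<beta> k / fourier_weight \<beta>' k) has_sum decay_const (\<beta>' - \<beta>)) UNIV"
  unfolding fourier_weight_ratio decay_const_def by (rule has_sum_exp_abs) simp

section \<open>Operators given by decaying Fourier kernels\<close>

lemma summable_on_product_nonneg:
  fixes u v :: "'a \<Rightarrow> real"
  assumes u: "u summable_on UNIV" and v: "v summable_on UNIV" and nn: "\<And>x. u x \<ge> 0" "\<And>x. v x \<ge> 0"
  shows "(\<lambda>(x, y). u x * v y) summable_on UNIV \<times> UNIV"
proof -
  have "(\<lambda>p. norm (case p of (x, y) \<Rightarrow> u x * v y)) summable_on UNIV \<times> UNIV"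
    unfolding Infinite_Sum.abs_summable_on_Sigma_iff
  proof (intro conjI ballI)
    show "(\<lambda>y. norm (case (x, y) of (x, y) \<Rightarrow> u x * v y)) summable_on UNIV" for x
      using summable_on_cmult_right[OF v, of "u x"] nn by simp
    have "(\<Sum>\<^sub>\<infinity>y. norm (u x * v y)) = u x * infsum v UNIV" for x
      using infsum_cmult_right'[of "u x" v UNIV] nn by simp
    then show "(\<lambda>x. norm (\<Sum>\<^sub>\<infinity>y. norm (case (x, y) of (x, y) \<Rightarrow> u x * v y))) summable_on UNIV"
      using summable_on_cmult_left[OF u, of "infsum v UNIV"] nn by (simp add: infsum_nonneg)
  qed
  then show ?thesis by (rule Infinite_Sum.abs_summable_summable)
qed

text \<open>Abstracts the transfer operator, its Galerkin truncation and the operators between them.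
  The coefficient formula is asked for on \<open>\<A>\<^sub>\<eta>\<close> only, where the decay
  bound makes the series absolutely convergent.\<close>

locale fourier_kernel =
  fixes \<eta> \<rho> :: real and m :: "int \<Rightarrow> int \<Rightarrow> complex" and B :: "circle_L1 \<Rightarrow> circle_L1"
  assumes eta: "0 < \<eta>"
    and decay: "cmod (m k n) \<le> fourier_weight \<eta> n / fourier_weight \<rho> k"
    and coeff: "f \<in> fourier_space \<eta> \<Longrightarrow> fourier_coeff (B f) k = (\<Sum>\<^sub>\<infinity>n. fourier_coeff f n * m k n)"
begin

lemma coeff_bound:
  assumes f: "f \<in> fourier_space \<eta>"
  shows "(\<lambda>n. cmod (fourier_coeff f n * m k n)) summable_on UNIV"
    and "(\<lambda>n. fourier_coeff f n * m k n) summable_on UNIV"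
    and "cmod (fourier_coeff (B f) k) \<le> fourier_sum \<eta> f / fourier_weight \<rho> k"
proof -
  note s = f[unfolded mem_fourier_space_iff]
  have le: "cmod (fourier_coeff f n * m k n) \<le>
      1 / fourier_weight \<rho> k * (fourier_weight \<eta> n * cmod (fourier_coeff f n))" for n
    using mult_left_mono[OF decay[of k n], of "cmod (fourier_coeff f n)"] by (simp add: norm_mult mult_ac)
  have s': "(\<lambda>n. 1 / fourier_weight \<rho> k * (fourier_weight \<eta> n * cmod (fourier_coeff f n))) summable_on UNIV"
    by (rule summable_on_cmult_right[OF s])
  show a: "(\<lambda>n. cmod (fourier_coeff f n * m k n)) summable_on UNIV"
    by (rule summable_on_comparison_test[OF s' le]) simp
  show "(\<lambda>n. fourier_coeff f n * m k n) summable_on UNIV"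
    by (rule Infinite_Sum.abs_summable_summable[OF a])
  have "cmod (fourier_coeff (B f) k) \<le> (\<Sum>\<^sub>\<infinity>n. cmod (fourier_coeff f n * m k n))"
    unfolding coeff[OF f] by (rule Infinite_Sum.norm_infsum_bound[OF a])
  also have "\<dots> \<le> (\<Sum>\<^sub>\<infinity>n. 1 / fourier_weight \<rho> k * (fourier_weight \<eta> n * cmod (fourier_coeff f n)))"
    by (rule infsum_mono[OF a s' le])
  also have "\<dots> = fourier_sum \<eta> f / fourier_weight \<rho> k"
    unfolding infsum_cmult_right' fourier_sum_def by simp
  finally show "cmod (fourier_coeff (B f) k) \<le> fourier_sum \<eta> f / fourier_weight \<rho> k" .
qed

text \<open>Coefficient \<open>k\<close> of \<open>B f\<close> is at most
  \<open>fourier_sum \<eta> f / fourier_weight \<rho> k\<close>. Against the weight for \<beta> this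
  leaves a geometric series with rate \<open>\<rho> - \<beta>\<close>: one application of
  \<open>B\<close> raises the regularity from \<eta> to anything below \<rho>.\<close>

lemma smoothing:
  assumes f: "f \<in> fourier_space \<eta>" and \<beta>: "\<beta> < \<rho>"
  shows "B f \<in> fourier_space \<beta>" and "fourier_sum \<beta> (B f) \<le> decay_const (\<rho> - \<beta>) * fourier_sum \<eta> f"
proof -
  note h = has_sum_cmult_left[OF has_sum_fourier_weight_ratio[OF \<beta>], of "fourier_sum \<eta> f"]
  have le: "fourier_weight \<beta> k * cmod (fourier_coeff (B f) k) \<le>
      fourier_weight \<beta> k / fourier_weight \<rho> k * fourier_sum \<eta> f" for k
    using mult_left_mono[OF coeff_bound(3)[OF f, of k] fourier_weight_nonneg[of \<beta> k]] by simp
  show mem: "B f \<in> fourier_space \<beta>"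
    unfolding mem_fourier_space_iff
    by (rule summable_on_comparison_test[OF has_sum_imp_summable[OF h] le]) simp
  show "fourier_sum \<beta> (B f) \<le> decay_const (\<rho> - \<beta>) * fourier_sum \<eta> f"
    unfolding fourier_sum_def[of \<beta>] infsumI[OF h, symmetric]
    by (rule infsum_mono[OF mem[unfolded mem_fourier_space_iff] has_sum_imp_summable[OF h] le])
qed

lemma linear:
  assumes f: "f \<in> fourier_space \<eta>" and g: "g \<in> fourier_space \<eta>"
  shows "B (f + c *\<^sub>C g) = B f + c *\<^sub>C B g"
proof (rule circle_L1_eqI)
  fix k
  have mem: "f + c *\<^sub>C g \<in> fourier_space \<eta>" by (intro fourier_space_add fourier_space_scaleC f g)
  have "fourier_coeff (B (f + c *\<^sub>C g)) k =
      (\<Sum>\<^sub>\<infinity>n. fourier_coeff f n * m k n + c * (fourier_coeff g n * m k n))"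
    unfolding coeff[OF mem] fourier_coeff_add fourier_coeff_scaleC by (simp add: algebra_simps)
  also have "\<dots> = (\<Sum>\<^sub>\<infinity>n. fourier_coeff f n * m k n) + (\<Sum>\<^sub>\<infinity>n. c * (fourier_coeff g n * m k n))"
    by (intro infsum_add summable_on_cmult_right coeff_bound(2)[OF f] coeff_bound(2)[OF g])
  also have "(\<Sum>\<^sub>\<infinity>n. c * (fourier_coeff g n * m k n)) = c * (\<Sum>\<^sub>\<infinity>n. fourier_coeff g n * m k n)"
    by (rule infsum_cmult_right')
  finally show "fourier_coeff (B (f + c *\<^sub>C g)) k = fourier_coeff (B f + c *\<^sub>C B g) k"
    by (simp add: fourier_coeff_add fourier_coeff_scaleC coeff[OF f] coeff[OF g])
qed

end

definition weighted_kernel :: "real \<Rightarrow> (int \<Rightarrow> int \<Rightarrow> complex) \<Rightarrow> nat \<Rightarrow> nat \<Rightarrow> complex" where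
  "weighted_kernel \<beta> m i j = of_real (fourier_weight \<beta> (int_decode i)) * m (int_decode i) (int_decode j)
     / of_real (fourier_weight \<beta> (int_decode j))"

context fourier_kernel
begin

text \<open>The entries are bounded by a product of a row factor, decaying at rate
  \<open>\<rho> - \<beta>\<close>, and a column factor, decaying at rate
  \<open>\<beta> - \<eta>\<close>. Both rates have to be positive, which confines \<beta> to the
  open interval.\<close>

lemma nuclear_weighted_kernel:
  assumes \<beta>: "\<eta> < \<beta>" "\<beta> < \<rho>"
  shows "nuclear (weighted_kernel \<beta> m)"
proof -
  let ?u = "\<lambda>k. fourier_weight \<beta> k / fourier_weight \<rho> k" and ?v = "\<lambda>n. fourier_weight \<eta> n / fourier_weight \<beta> n"
  have "?u summable_on UNIV" "?v summable_on UNIV"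
    by (rule has_sum_imp_summable[OF has_sum_fourier_weight_ratio], use \<beta> in simp)+
  then have s: "(\<lambda>i. ?u (int_decode i)) summable_on UNIV" "(\<lambda>i. ?v (int_decode i)) summable_on UNIV"
    using summable_on_reindex_bij_betw[OF bij_int_decode, of ?u]
      summable_on_reindex_bij_betw[OF bij_int_decode, of ?v] by simp_all
  have "(\<lambda>(i, j). ?u (int_decode i) * ?v (int_decode j)) summable_on UNIV \<times> UNIV"
    by (rule summable_on_product_nonneg[OF s]) simp_all
  then show ?thesis
    unfolding nuclear_def UNIV_Times_UNIV
  proof (rule summable_on_comparison_test)
    fix p :: "nat \<times> nat"
    obtain i j where p: "p = (i, j)" by fastforce
    have "cmod (weighted_kernel \<beta> m i j) =
        fourier_weight \<beta> (int_decode i) / fourier_weight \<beta> (int_decode j) * cmod (m (int_decode i) (int_decode j))"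
      by (simp add: weighted_kernel_def norm_mult norm_divide)
    also have "\<dots> \<le> fourier_weight \<beta> (int_decode i) / fourier_weight \<beta> (int_decode j) *
        (fourier_weight \<eta> (int_decode j) / fourier_weight \<rho> (int_decode i))"
      by (intro mult_left_mono decay) simp
    finally show "(case p of (i, j) \<Rightarrow> cmod (weighted_kernel \<beta> m i j)) \<le>
        (case p of (i, j) \<Rightarrow> ?u (int_decode i) * ?v (int_decode j))"
      by (simp add: p mult_ac)
  qed auto
qed

lemma represents_weighted_kernel:
  assumes \<beta>: "\<eta> \<le> \<beta>" "\<beta> < \<rho>"
  shows "l1_coordinates.represents (fourier_space \<beta>) (weighted_coeff \<beta>) (weighted_kernel \<beta> m) B"
proof -
  have \<beta>0: "0 \<le> \<beta>" using \<beta> eta by simp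
  interpret l1_coordinates "fourier_space \<beta>" "weighted_coeff \<beta>"
    by (rule l1_coordinates_fourier_space[OF \<beta>0])
  show ?thesis
    unfolding represents_def
  proof (intro ballI conjI ext)
    fix f i assume "f \<in> fourier_space \<beta>"
    then have f: "f \<in> fourier_space \<eta>" by (rule fourier_space_mono(1)[OF \<beta>(1)])
    show "B f \<in> fourier_space \<beta>" by (rule smoothing(1)[OF f \<beta>(2)])
    let ?k = "int_decode i" and ?w = "\<lambda>k. complex_of_real (fourier_weight \<beta> k)"
    have "mapp (weighted_kernel \<beta> m) (weighted_coeff \<beta> f) i =
        (\<Sum>\<^sub>\<infinity>j. ?w ?k * (fourier_coeff f (int_decode j) * m ?k (int_decode j)))"
      unfolding mapp_def by (rule infsum_cong) (simp add: weighted_kernel_def weighted_coeff_def)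
    also have "\<dots> = ?w ?k * (\<Sum>\<^sub>\<infinity>j. fourier_coeff f (int_decode j) * m ?k (int_decode j))"
      by (rule infsum_cmult_right')
    also have "(\<Sum>\<^sub>\<infinity>j. fourier_coeff f (int_decode j) * m ?k (int_decode j)) = fourier_coeff (B f) ?k"
      unfolding coeff[OF f]
      by (rule infsum_reindex_bij_betw[OF bij_int_decode, of "\<lambda>n. fourier_coeff f n * m ?k n"])
    finally show "weighted_coeff \<beta> (B f) i = mapp (weighted_kernel \<beta> m) (weighted_coeff \<beta> f) i"
      by (simp only: weighted_coeff_def[of \<beta> "B f"])
  qed
qed

end

text \<open>The decay bound is stable under convex combinations and the coefficient formula under
  linear ones, so every operator of the homotopy inherits the constants of the endpoints.\<close>

lemma fourier_kernel_interpolate: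
  assumes "fourier_kernel \<eta> \<rho> m B" and "fourier_kernel \<eta> \<rho> m' B'" and s: "s \<in> {0..1}"
  shows "fourier_kernel \<eta> \<rho> (\<lambda>k n. m' k n + of_real s * (m k n - m' k n)) (\<lambda>f. B' f + of_real s *\<^sub>C (B f - B' f))"
proof -
  interpret K1: fourier_kernel \<eta> \<rho> m B by (rule assms(1))
  interpret K2: fourier_kernel \<eta> \<rho> m' B' by (rule assms(2))
  show ?thesis
  proof
    show "0 < \<eta>" by (rule K1.eta)
    fix k n
    let ?b = "fourier_weight \<eta> n / fourier_weight \<rho> k"
    have "m' k n + of_real s * (m k n - m' k n) = of_real (1 - s) * m' k n + of_real s * m k n"
      by (simp add: algebra_simps)
    then have "cmod (m' k n + of_real s * (m k n - m' k n)) \<le> cmod (of_real (1 - s) * m' k n) + cmod (of_real s * m k n)"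
      by (simp only: norm_triangle_ineq)
    also have "\<dots> = (1 - s) * cmod (m' k n) + s * cmod (m k n)"
      using s unfolding norm_mult norm_of_real by simp
    also have "\<dots> \<le> (1 - s) * ?b + s * ?b"
      using s by (intro add_mono mult_left_mono K1.decay K2.decay) auto
    also have "\<dots> = ?b" unfolding distrib_right[symmetric] by simp
    finally show "cmod (m' k n + of_real s * (m k n - m' k n)) \<le> ?b" .
  next
    fix f k assume f: "f \<in> fourier_space \<eta>"
    let ?f = "fourier_coeff f"
    have "(\<Sum>\<^sub>\<infinity>n. ?f n * (m' k n + of_real s * (m k n - m' k n))) =
        (\<Sum>\<^sub>\<infinity>n. of_real (1 - s) * (?f n * m' k n) + of_real s * (?f n * m k n))"
      by (rule infsum_cong) (simp add: algebra_simps)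
    also have "\<dots> = (\<Sum>\<^sub>\<infinity>n. of_real (1 - s) * (?f n * m' k n)) + (\<Sum>\<^sub>\<infinity>n. of_real s * (?f n * m k n))"
      by (intro infsum_add summable_on_cmult_right K1.coeff_bound(2)[OF f] K2.coeff_bound(2)[OF f])
    also have "\<dots> = of_real (1 - s) * fourier_coeff (B' f) k + of_real s * fourier_coeff (B f) k"
      unfolding K1.coeff[OF f] K2.coeff[OF f] by (simp only: infsum_cmult_right')
    finally show "fourier_coeff (B' f + of_real s *\<^sub>C (B f - B' f)) k =
        (\<Sum>\<^sub>\<infinity>n. ?f n * (m' k n + of_real s * (m k n - m' k n)))"
      by (simp add: fourier_coeff_add fourier_coeff_scaleC fourier_coeff_diff algebra_simps)
  qed
qed

section \<open>Resolvent estimates\<close>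

text \<open>\<open>op_norm\<close> is a supremum over the unit ball for an arbitrary map, so the
  usual estimate requires homogeneity; this is asked for only at \<open>g\<close> and only for the
  scalar that normalises it. The inequality is kept in \<open>ennreal\<close> because the operator
  norm may still be infinite.\<close>

lemma op_norm_bound:
  assumes g: "g \<in> fourier_space \<alpha>" and c: "fourier_sum \<alpha> g > 0"
    and f: "f \<in> fourier_space \<beta>" and B: "B (inverse (of_real (fourier_sum \<alpha> g)) *\<^sub>C g) = inverse (of_real (fourier_sum \<alpha> g)) *\<^sub>C f"
  shows "ennreal (fourier_sum \<beta> f) \<le> op_norm (fourier_space \<alpha>) (fourier_norm \<alpha>) (fourier_norm \<beta>) B * ennreal (fourier_sum \<alpha> g)"
proof -
  define c where "c = fourier_sum \<alpha> g"
  define u :: complex where "u = inverse (of_real c)"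
  have c0: "c > 0" using c by (simp add: c_def)
  have u: "cmod u = inverse c" using c0 by (simp add: u_def norm_inverse)
  have "fourier_norm \<alpha> (u *\<^sub>C g) = ennreal (inverse c * c)"
    unfolding fourier_norm_eq[OF fourier_space_scaleC(1)[OF g]] fourier_space_scaleC(2)[OF g] u c_def ..
  then have "u *\<^sub>C g \<in> {h \<in> fourier_space \<alpha>. fourier_norm \<alpha> h \<le> 1}"
    using c0 fourier_space_scaleC(1)[OF g] by simp
  then have "fourier_norm \<beta> (B (u *\<^sub>C g)) \<le> op_norm (fourier_space \<alpha>) (fourier_norm \<alpha>) (fourier_norm \<beta>) B"
    unfolding op_norm_def by (rule SUP_upper)
  also have "B (u *\<^sub>C g) = u *\<^sub>C f" using B unfolding u_def c_def .
  also have "fourier_norm \<beta> (u *\<^sub>C f) = ennreal (inverse c * fourier_sum \<beta> f)"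
    unfolding fourier_norm_eq[OF fourier_space_scaleC(1)[OF f]] fourier_space_scaleC(2)[OF f] u ..
  finally have "ennreal (inverse c * fourier_sum \<beta> f) * ennreal c \<le>
      op_norm (fourier_space \<alpha>) (fourier_norm \<alpha>) (fourier_norm \<beta>) B * ennreal c"
    by (rule mult_right_mono) simp
  moreover have "ennreal (inverse c * fourier_sum \<beta> f) * ennreal c = ennreal (fourier_sum \<beta> f)"
    using c0 fourier_sum_nonneg[of \<beta> f] by (simp flip: ennreal_mult)
  ultimately show ?thesis unfolding c_def by simp
qed

lemma op_norm_finiteI:
  assumes "C \<ge> 0" and "\<And>g. g \<in> fourier_space \<alpha> \<Longrightarrow> B g \<in> fourier_space \<beta>"
    and "\<And>g. g \<in> fourier_space \<alpha> \<Longrightarrow> fourier_sum \<beta> (B g) \<le> C * fourier_sum \<alpha> g"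
  shows "op_norm (fourier_space \<alpha>) (fourier_norm \<alpha>) (fourier_norm \<beta>) B < \<infinity>"
proof -
  have "op_norm (fourier_space \<alpha>) (fourier_norm \<alpha>) (fourier_norm \<beta>) B \<le> ennreal C"
    unfolding op_norm_def
  proof (rule SUP_least)
    fix g assume g: "g \<in> {f \<in> fourier_space \<alpha>. fourier_norm \<alpha> f \<le> 1}"
    then have mem: "g \<in> fourier_space \<alpha>" by simp
    have "ennreal (fourier_sum \<alpha> g) \<le> ennreal 1" using g unfolding fourier_norm_eq[OF mem, symmetric] by simp
    then have "fourier_sum \<alpha> g \<le> 1" by (simp only: ennreal_le_iff[OF zero_le_one])
    then have "fourier_sum \<beta> (B g) \<le> C"
      using assms(3)[OF mem] mult_left_mono[OF _ assms(1), of "fourier_sum \<alpha> g" 1] by linarith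
    then show "fourier_norm \<beta> (B g) \<le> ennreal C"
      unfolding fourier_norm_eq[OF assms(2)[OF mem]] by (rule ennreal_leI)
  qed
  then show ?thesis by (rule le_less_trans) simp
qed

context fourier_kernel
begin

lemma linear_scale: "f \<in> fourier_space \<eta> \<Longrightarrow> B (c *\<^sub>C f) = c *\<^sub>C B f"
proof -
  assume f: "f \<in> fourier_space \<eta>"
  have z: "(0::circle_L1) \<in> fourier_space \<eta>" by (rule circle_L1.subspace_0[OF fourier_space_subspace])
  have "B 0 = 0" using linear[OF z z, of "-1"] by simp
  then show ?thesis using linear[OF z f, of c] by simp
qed

lemma linear_add: "f \<in> fourier_space \<eta> \<Longrightarrow> g \<in> fourier_space \<eta> \<Longrightarrow> B (f + g) = B f + B g"
  using linear[of f g 1] by simp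

text \<open>The determinant decides invertibility on \<open>\<A>\<^sub>\<alpha>\<close>, while
  \<beta> may be as small as \<eta>, where the weighted entries need not be summable. Since
  \<open>B\<close> maps \<open>\<A>\<^sub>\<beta>\<close> into \<open>\<A>\<^sub>\<alpha>\<close>, a
  kernel vector satisfies \<open>f = B f / z\<close> and is excluded in
  \<open>\<A>\<^sub>\<alpha>\<close>; the same gain of regularity yields solvability with the bound
  \<open>M\<close>.\<close>

lemma not_in_op_spectrum:
  assumes \<beta>: "\<eta> \<le> \<beta>" "\<beta> \<le> \<alpha>" and \<alpha>: "\<eta> < \<alpha>" "\<alpha> < \<rho>" and z: "z \<noteq> 0"
    and nz: "char_det (weighted_kernel \<alpha> m) z \<noteq> 0"
  shows "z \<notin> op_spectrum (fourier_space \<beta>) (fourier_norm \<beta>) B"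
proof -
  interpret A: l1_coordinates "fourier_space \<alpha>" "weighted_coeff \<alpha>"
    by (rule l1_coordinates_fourier_space) (use eta \<alpha> in simp)
  have nuc: "nuclear (weighted_kernel \<alpha> m)" by (rule nuclear_weighted_kernel[OF \<alpha>])
  have rep: "A.represents (weighted_kernel \<alpha> m) B"
    by (rule represents_weighted_kernel) (use \<alpha> in simp_all)
  define U where "U = (\<lambda>f. z *\<^sub>C f - B f)"
  obtain C where C: "C \<ge> 0" and res: "\<And>g. (\<lambda>k. cmod (g k)) summable_on UNIV \<Longrightarrow>
      \<exists>f. (\<lambda>k. cmod (f k)) summable_on UNIV \<and> (\<forall>k. z * f k - mapp (weighted_kernel \<alpha> m) f k = g k) \<and>
          (\<Sum>\<^sub>\<infinity>k. cmod (f k)) \<le> C * (\<Sum>\<^sub>\<infinity>k. cmod (g k))"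
  proof (rule nuclear_resolvent[OF nuc z nz])
    fix C
    assume "C \<ge> 0" and "\<And>g. (\<lambda>k. cmod (g k)) summable_on UNIV \<Longrightarrow>
      \<exists>f. (\<lambda>k. cmod (f k)) summable_on UNIV \<and> (\<forall>k. z * f k - mapp (weighted_kernel \<alpha> m) f k = g k) \<and>
          (\<Sum>\<^sub>\<infinity>k. cmod (f k)) \<le> C * (\<Sum>\<^sub>\<infinity>k. cmod (g k))"
    then show thesis by (rule that)
  qed
  have solve\<^sub>\<alpha>: "\<exists>h\<in>fourier_space \<alpha>. U h = g \<and> fourier_sum \<alpha> h \<le> C * fourier_sum \<alpha> g"
    if g: "g \<in> fourier_space \<alpha>" for g
  proof -
    obtain x where x: "(\<lambda>k. cmod (x k)) summable_on UNIV"
      "\<forall>k. z * x k - mapp (weighted_kernel \<alpha> m) x k = weighted_coeff \<alpha> g k"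
      "(\<Sum>\<^sub>\<infinity>k. cmod (x k)) \<le> C * (\<Sum>\<^sub>\<infinity>k. cmod (weighted_coeff \<alpha> g k))"
      using res[OF A.summable[OF g]] by (elim exE conjE) (rule that)
    obtain h where h: "h \<in> fourier_space \<alpha>" "weighted_coeff \<alpha> h = x"
      using A.surj[OF x(1)] by (elim bexE) (rule that)
    have Bh: "B h \<in> fourier_space \<alpha>" by (rule A.represents_mem[OF rep h(1)])
    have "weighted_coeff \<alpha> (U h) = weighted_coeff \<alpha> g"
      unfolding U_def A.diff[OF A.scale_mem[OF h(1)] Bh] A.scale[OF h(1)]
        A.represents_coord[OF rep h(1)] h(2) using x(2) by (intro ext) simp
    then have "U h = g"
      by (rule A.inj[rotated 2]) (use g A.diff_mem[OF A.scale_mem[OF h(1)] Bh] in \<open>simp_all add: U_def\<close>)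
    moreover have "fourier_sum \<alpha> h \<le> C * fourier_sum \<alpha> g"
      using x(3) unfolding h(2)[symmetric] infsum_weighted_coeff .
    ultimately show ?thesis using h(1) by (intro bexI conjI)
  qed
  have toeta: "f \<in> fourier_space \<eta>" if "f \<in> fourier_space \<beta>" for f
    by (rule fourier_space_mono(1)[OF \<beta>(1) that])
  have toalpha: "B f \<in> fourier_space \<alpha>" if "f \<in> fourier_space \<beta>" for f
    by (rule smoothing(1)[OF toeta[OF that] \<alpha>(2)])
  have tobeta: "f \<in> fourier_space \<beta>" if "f \<in> fourier_space \<alpha>" for f
    by (rule fourier_space_mono(1)[OF \<beta>(2) that])
  have ker: "f = 0" if f: "f \<in> fourier_space \<beta>" "U f = 0" for f
  proof -
    have Bf: "B f = z *\<^sub>C f" using f(2) by (simp add: U_def)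
    have "inverse z *\<^sub>C B f \<in> fourier_space \<alpha>" by (rule A.scale_mem[OF toalpha[OF f(1)]])
    then have "f \<in> fourier_space \<alpha>" unfolding Bf using z by simp
    moreover have "z \<notin> eigenvalues (fourier_space \<alpha>) B" using A.eigenvalue_iff[OF nuc rep z] nz by simp
    ultimately show ?thesis using Bf unfolding eigenvalues_def by auto
  qed
  \<comment> \<open>Write \<open>f = g / z + h\<close>; then \<open>h\<close> solves the resolvent equation with the smoother right-hand side \<open>B g / z\<close>.\<close>
  define M where "M = inverse (cmod z) * (1 + C * decay_const (\<rho> - \<alpha>))"
  have dc: "decay_const (\<rho> - \<alpha>) > 0" by (rule decay_const_pos) (use \<alpha> in simp)
  have M: "M \<ge> 0" using C dc unfolding M_def by simp
  have solve: "\<exists>f\<in>fourier_space \<beta>. U f = g \<and> fourier_sum \<beta> f \<le> M * fourier_sum \<beta> g"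
    if g: "g \<in> fourier_space \<beta>" for g
  proof -
    define g' where "g' = inverse z *\<^sub>C g"
    have g': "g' \<in> fourier_space \<beta>" unfolding g'_def by (rule fourier_space_scaleC(1)[OF g])
    have g's: "fourier_sum \<beta> g' = inverse (cmod z) * fourier_sum \<beta> g"
      unfolding g'_def fourier_space_scaleC(2)[OF g] norm_inverse ..
    obtain h where h: "h \<in> fourier_space \<alpha>" "U h = B g'" "fourier_sum \<alpha> h \<le> C * fourier_sum \<alpha> (B g')"
      using solve\<^sub>\<alpha>[OF toalpha[OF g']] by (elim bexE conjE) (rule that)
    have hb: "h \<in> fourier_space \<beta>" by (rule tobeta[OF h(1)])
    have "U (g' + h) = z *\<^sub>C g' - B g' + U h"
      unfolding U_def linear_add[OF toeta[OF g'] toeta[OF hb]] by (simp add: circle_L1.scale_right_distrib)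
    also have "\<dots> = g" unfolding h(2) g'_def using z by simp
    finally have eq: "U (g' + h) = g" .
    have "fourier_sum \<beta> (g' + h) \<le> fourier_sum \<beta> g' + fourier_sum \<beta> h" by (rule fourier_space_add(2)[OF g' hb])
    also have "fourier_sum \<beta> h \<le> fourier_sum \<alpha> h" by (rule fourier_space_mono(2)[OF \<beta>(2) h(1)])
    also have "fourier_sum \<alpha> h \<le> C * (decay_const (\<rho> - \<alpha>) * fourier_sum \<beta> g')"
    proof (rule order_trans[OF h(3)], rule mult_left_mono[OF _ C])
      have "fourier_sum \<eta> g' \<le> fourier_sum \<beta> g'" by (rule fourier_space_mono(2)[OF \<beta>(1) g'])
      then have "decay_const (\<rho> - \<alpha>) * fourier_sum \<eta> g' \<le> decay_const (\<rho> - \<alpha>) * fourier_sum \<beta> g'"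
        using dc by (intro mult_left_mono) simp_all
      then show "fourier_sum \<alpha> (B g') \<le> decay_const (\<rho> - \<alpha>) * fourier_sum \<beta> g'"
        using smoothing(2)[OF toeta[OF g'] \<alpha>(2)] by simp
    qed
    finally have "fourier_sum \<beta> (g' + h) \<le> M * fourier_sum \<beta> g"
      unfolding g's M_def by (simp add: algebra_simps)
    then show ?thesis using eq fourier_space_add(1)[OF g' hb] by (intro bexI conjI)
  qed
  have mem: "U f \<in> fourier_space \<beta>" if "f \<in> fourier_space \<beta>" for f
    unfolding U_def by (rule fourier_space_diff[OF fourier_space_scaleC(1)[OF that] tobeta[OF toalpha[OF that]]])
  have inj: "inj_on U (fourier_space \<beta>)"
  proof (rule inj_onI)
    fix f g assume f: "f \<in> fourier_space \<beta>" and g: "g \<in> fourier_space \<beta>" and e: "U f = U g"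
    have "U (f - g) = U f - U g"
      using linear[OF toeta[OF f] toeta[OF g], of "-1"]
      by (simp add: U_def circle_L1.scale_right_diff_distrib)
    then have "f - g = 0" using ker[OF fourier_space_diff[OF f g]] e by simp
    then show "f = g" by simp
  qed
  have img: "U ` fourier_space \<beta> = fourier_space \<beta>"
  proof (intro equalityI subsetI)
    fix g assume "g \<in> U ` fourier_space \<beta>"
    then show "g \<in> fourier_space \<beta>" using mem by auto
  next
    fix g assume "g \<in> fourier_space \<beta>"
    from solve[OF this] show "g \<in> U ` fourier_space \<beta>" by auto
  qed
  have bij: "bij_betw U (fourier_space \<beta>) (fourier_space \<beta>)" using inj img by (simp add: bij_betw_def)
  have "fourier_sum \<beta> (inv_into (fourier_space \<beta>) U g) \<le> M * fourier_sum \<beta> g" if g: "g \<in> fourier_space \<beta>" for g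
  proof -
    obtain f where f: "f \<in> fourier_space \<beta>" "U f = g" "fourier_sum \<beta> f \<le> M * fourier_sum \<beta> g"
      using solve[OF g] by (elim bexE conjE) (rule that)
    have "inv_into (fourier_space \<beta>) U g = f" by (rule inv_into_f_eq[OF inj f(1,2)])
    then show ?thesis using f(3) by simp
  qed
  then have "op_norm (fourier_space \<beta>) (fourier_norm \<beta>) (fourier_norm \<beta>) (inv_into (fourier_space \<beta>) U) < \<infinity>"
  proof (rule op_norm_finiteI[OF M, rotated])
    show "inv_into (fourier_space \<beta>) U g \<in> fourier_space \<beta>" if "g \<in> fourier_space \<beta>" for g
      by (rule inv_into_into) (use that img in simp)
  qed
  then show ?thesis
    using bij unfolding op_spectrum_def boundedly_invertible_def U_def by simp
qed

end

lemma homotopy_char_det_nonzero: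
  assumes m: "fourier_kernel \<eta> \<rho> m L" and m': "fourier_kernel \<eta> \<rho> m' L'"
    and \<alpha>: "\<eta> < \<alpha>" "\<alpha> < \<rho>" and rr: "0 < \<rr>" "\<rr> \<le> cmod z" and \<delta>: "\<delta> > 0"
    and r: "r = (1 / \<rr>) powr (\<alpha> / (\<alpha> - \<eta>)) * decay_const (\<rho> - \<alpha>) powr (\<alpha> / (\<alpha> - \<eta>))"
    and close: "ennreal \<delta> \<ge> ennreal r *
      op_norm (fourier_space \<alpha>) (fourier_norm \<alpha>) (fourier_norm 0) (\<lambda>f. L f - L' f)"
    and z: "z \<notin> pseudospectrum \<delta> (fourier_space 0) (fourier_norm 0) L'"
    and s: "s \<in> {0..1}"
  shows "char_det (weighted_kernel \<alpha> (\<lambda>k n. m' k n + of_real s * (m k n - m' k n))) z \<noteq> 0"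
proof
  interpret L: fourier_kernel \<eta> \<rho> m L by (rule m)
  interpret L': fourier_kernel \<eta> \<rho> m' L' by (rule m')
  interpret Ls: fourier_kernel \<eta> \<rho> "\<lambda>k n. m' k n + of_real s * (m k n - m' k n)"
      "\<lambda>f. L' f + of_real s *\<^sub>C (L f - L' f)"
    by (rule fourier_kernel_interpolate[OF m m' s])
  have eta: "0 < \<eta>" by (rule L.eta)
  have al: "0 < \<alpha>" using eta \<alpha> by simp
  have dc: "decay_const (\<rho> - \<alpha>) > 0" by (rule decay_const_pos) (use \<alpha> in simp)
  interpret A: l1_coordinates "fourier_space \<alpha>" "weighted_coeff \<alpha>"
    by (rule l1_coordinates_fourier_space) (use al in simp)
  assume "char_det (weighted_kernel \<alpha> (\<lambda>k n. m' k n + of_real s * (m k n - m' k n))) z = 0"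
  moreover have z0: "z \<noteq> 0" using rr by auto
  ultimately have "z \<in> eigenvalues (fourier_space \<alpha>) (\<lambda>f. L' f + of_real s *\<^sub>C (L f - L' f))"
    using A.eigenvalue_iff[OF Ls.nuclear_weighted_kernel[OF \<alpha>] Ls.represents_weighted_kernel[OF less_imp_le[OF \<alpha>(1)] \<alpha>(2)]]
    by simp
  then obtain f where f: "f \<in> fourier_space \<alpha>" "f \<noteq> 0" and ev: "L' f + of_real s *\<^sub>C (L f - L' f) = z *\<^sub>C f"
    unfolding eigenvalues_def by auto
  have f\<eta>: "f \<in> fourier_space \<eta>" by (rule fourier_space_mono(1)[OF less_imp_le[OF \<alpha>(1)] f(1)])
  have f0: "f \<in> fourier_space 0" by (rule fourier_space_mono(1)[OF less_imp_le[OF al] f(1)])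
  have N0: "fourier_sum 0 f > 0" by (rule fourier_sum_pos[OF _ f0 f(2)]) simp
  have Na: "fourier_sum \<alpha> f > 0" by (rule fourier_sum_pos[OF less_imp_le[OF al] f])
  define l where "l = fourier_sum \<alpha> f / fourier_sum 0 f"
  have l: "l > 0" unfolding l_def using N0 Na by simp
  have "\<rr> * fourier_sum \<alpha> f \<le> cmod z * fourier_sum \<alpha> f"
    using rr Na by (intro mult_right_mono) simp_all
  also have "\<dots> = fourier_sum \<alpha> (L' f + of_real s *\<^sub>C (L f - L' f))"
    unfolding ev fourier_space_scaleC(2)[OF f(1)] ..
  also have "\<dots> \<le> decay_const (\<rho> - \<alpha>) * fourier_sum \<eta> f"
    by (rule Ls.smoothing(2)[OF f\<eta> \<alpha>(2)])
  \<comment> \<open>The factor prepares the interpolation inequality, after which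
    \<open>fourier_sum \<alpha> f\<close> cancels and only a bound for the quotient \<open>l\<close>
    of the two norms remains.\<close>
  finally have "l powr (1 - \<eta> / \<alpha>) * (\<rr> * fourier_sum \<alpha> f) \<le>
      l powr (1 - \<eta> / \<alpha>) * (decay_const (\<rho> - \<alpha>) * fourier_sum \<eta> f)"
    by (rule mult_left_mono) simp
  also have "\<dots> = decay_const (\<rho> - \<alpha>) * (l powr (1 - \<eta> / \<alpha>) * fourier_sum \<eta> f)"
    by (simp add: mult_ac)
  also have "\<dots> \<le> decay_const (\<rho> - \<alpha>) * fourier_sum \<alpha> f"
    using interpolation[OF eta \<alpha>(1) f] dc unfolding l_def by (intro mult_left_mono) simp_all
  finally have "l powr (1 - \<eta> / \<alpha>) \<le> 1 / \<rr> * decay_const (\<rho> - \<alpha>)"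
    using Na rr(1) by (simp add: field_simps)
  then have pw: "(l powr (1 - \<eta> / \<alpha>)) powr (\<alpha> / (\<alpha> - \<eta>)) \<le> (1 / \<rr> * decay_const (\<rho> - \<alpha>)) powr (\<alpha> / (\<alpha> - \<eta>))"
    by (rule powr_mono2[rotated 2]) (use al \<alpha> in simp_all)
  \<comment> \<open>The exponent in \<open>r\<close> is the reciprocal of
    \<open>1 - \<eta> / \<alpha>\<close>, so this power recovers \<open>l\<close>.\<close>
  have "l = (l powr (1 - \<eta> / \<alpha>)) powr (\<alpha> / (\<alpha> - \<eta>))"
  proof -
    have e: "(1 - \<eta> / \<alpha>) * (\<alpha> / (\<alpha> - \<eta>)) = 1" using al \<alpha> by (simp add: field_simps)
    show ?thesis unfolding powr_powr e using l by (simp only: powr_one)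
  qed
  also have "\<dots> \<le> r" using pw unfolding r powr_mult .
  finally have lr: "fourier_sum \<alpha> f \<le> r * fourier_sum 0 f" unfolding l_def using N0 by (simp add: divide_le_eq)
  have rpos: "r > 0" unfolding r using rr dc by simp
  define D where "D = op_norm (fourier_space \<alpha>) (fourier_norm \<alpha>) (fourier_norm 0) (\<lambda>f. L f - L' f)"
  \<comment> \<open>Finiteness of the operator norm is extracted from the assumed inequality:
    \<open>r\<close> is positive and \<delta> is finite.\<close>
  have "D \<noteq> \<infinity>"
  proof
    assume "D = \<infinity>"
    then have "ennreal r * D = \<infinity>" using rpos by (simp add: ennreal_mult_eq_top_iff)
    then show False using close unfolding D_def by (simp add: top_unique)
  qed
  then obtain d where d: "d \<ge> 0" "D = ennreal d" by (cases D) auto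
  have rd: "r * d \<le> \<delta>"
    using close rpos d \<delta> unfolding D_def[symmetric] d(2) by (simp flip: ennreal_mult)
  define V where "V = (\<lambda>f. z *\<^sub>C f - L' f)"
  define g where "g = V f"
  have mem0: "L f \<in> fourier_space 0" "L' f \<in> fourier_space 0"
    by (rule L.smoothing(1)[OF f\<eta>] L'.smoothing(1)[OF f\<eta>], use al \<alpha> in simp)+
  have diff0: "L f - L' f \<in> fourier_space 0" by (rule fourier_space_diff[OF mem0])
  have g_eq: "g = of_real s *\<^sub>C (L f - L' f)" unfolding g_def V_def ev[symmetric] by simp
  have g0: "g \<in> fourier_space 0" unfolding g_eq by (rule fourier_space_scaleC(1)[OF diff0])
  have "ennreal (fourier_sum 0 (L f - L' f)) \<le> D * ennreal (fourier_sum \<alpha> f)"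
    unfolding D_def
  proof (rule op_norm_bound[OF f(1) Na diff0])
    let ?u = "inverse (complex_of_real (fourier_sum \<alpha> f))"
    show "L (?u *\<^sub>C f) - L' (?u *\<^sub>C f) = ?u *\<^sub>C (L f - L' f)"
      unfolding L.linear_scale[OF f\<eta>] L'.linear_scale[OF f\<eta>] circle_L1.scale_right_diff_distrib ..
  qed
  then have "fourier_sum 0 (L f - L' f) \<le> d * fourier_sum \<alpha> f"
    using d Na by (simp flip: ennreal_mult)
  also have "\<dots> \<le> d * (r * fourier_sum 0 f)" using lr d(1) by (rule mult_left_mono)
  also have "\<dots> \<le> \<delta> * fourier_sum 0 f" using rd N0 mult_right_mono[OF rd, of "fourier_sum 0 f"] by (simp add: mult_ac)
  finally have "fourier_sum 0 (L f - L' f) \<le> \<delta> * fourier_sum 0 f" .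
  moreover have "fourier_sum 0 g \<le> fourier_sum 0 (L f - L' f)"
    unfolding g_eq fourier_space_scaleC(2)[OF diff0]
    using s mult_right_mono[of s 1 "fourier_sum 0 (L f - L' f)"] fourier_sum_nonneg[of 0 "L f - L' f"] by simp
  ultimately have gle: "fourier_sum 0 g \<le> \<delta> * fourier_sum 0 f" by simp
  define J where "J = inv_into (fourier_space 0) V"
  define E where "E = op_norm (fourier_space 0) (fourier_norm 0) (fourier_norm 0) J"
  \<comment> \<open>Outside the pseudospectrum the resolvent norm is strictly below
    \<open>1 / \<delta>\<close>. This strictness produces the contradiction, since
    \<open>gle\<close> is a weak inequality.\<close>
  have inv: "boundedly_invertible (fourier_space 0) (fourier_norm 0) V" and E: "E < ennreal (1 / \<delta>)"
    using z unfolding pseudospectrum_def op_spectrum_def E_def J_def V_def by (auto simp: not_le)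
  have inj: "inj_on V (fourier_space 0)" using inv unfolding boundedly_invertible_def bij_betw_def by simp
  have Vscale: "V (c *\<^sub>C f) = c *\<^sub>C g" for c
    unfolding g_def V_def L'.linear_scale[OF f\<eta>] circle_L1.scale_right_diff_distrib by (simp add: mult.commute)
  have J: "J (c *\<^sub>C g) = c *\<^sub>C f" for c
    unfolding J_def by (rule inv_into_f_eq[OF inj fourier_space_scaleC(1)[OF f0] Vscale])
  \<comment> \<open>Otherwise \<open>f\<close> and 0 would both be preimages of 0 under the
    injective map \<open>V\<close>. This also settles \<open>s = 0\<close>, where
    \<open>g_eq\<close> forces \<open>g = 0\<close>.\<close>
  have "g \<noteq> 0"
  proof
    assume "g = 0"
    then have "f = 0" using J[of 1] J[of 0] by simp
    then show False using f(2) by simp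
  qed
  then have gpos: "fourier_sum 0 g > 0" by (intro fourier_sum_pos g0) simp_all
  obtain e where e: "e \<ge> 0" "E = ennreal e" using E by (cases E) auto
  have e\<delta>: "e < 1 / \<delta>" using E \<delta> unfolding e(2) by (simp add: ennreal_less_iff e(1))
  have "ennreal (fourier_sum 0 f) \<le> E * ennreal (fourier_sum 0 g)"
    unfolding E_def
  proof (rule op_norm_bound[OF g0 gpos f0])
    show "J (inverse (of_real (fourier_sum 0 g)) *\<^sub>C g) = inverse (of_real (fourier_sum 0 g)) *\<^sub>C f"
      by (rule J)
  qed
  then have "fourier_sum 0 f \<le> e * fourier_sum 0 g"
    using e gpos by (simp flip: ennreal_mult)
  also have "\<dots> < 1 / \<delta> * fourier_sum 0 g" using e\<delta> gpos by (rule mult_strict_right_mono)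
  also have "\<dots> \<le> 1 / \<delta> * (\<delta> * fourier_sum 0 f)" using gle \<delta> by (intro mult_left_mono) simp_all
  also have "\<dots> = fourier_sum 0 f" using \<delta> by simp
  finally show False by simp
qed

section \<open>Stability of the spectrum\<close>

definition transfer_kernel :: "(complex \<Rightarrow> complex) \<Rightarrow> int \<Rightarrow> int \<Rightarrow> complex" where
  "transfer_kernel T k n = (\<integral>z. z powi n * T z powi (- k) \<partial>circle_measure)"

text \<open>Galerkin truncation replaces the entries outside the square
  \<open>\<bar>k\<bar> \<le> K\<close>, \<open>\<bar>n\<bar> \<le> K\<close> by 0, so the
  contour-shift bound holds for both operators with the same \<eta> and \<rho>.\<close>

lemma fourier_kernel_transfer_operator:
  assumes \<eta>: "0 < \<eta>" and \<rho>: "0 < \<rho>" and q: "q > exp (2 * pi * \<eta>)"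
    and hol: "T holomorphic_on annulus q" and T: "uniformly_expanding T"
    and dis: "annulus (exp (2 * pi * \<rho>)) \<inter> T ` frontier (annulus (exp (2 * pi * \<eta>))) = {}"
  shows "fourier_kernel \<eta> \<rho> (transfer_kernel T) (transfer_operator T)"
    and "fourier_kernel \<eta> \<rho> (\<lambda>k n. if \<bar>k\<bar> \<le> int K \<and> \<bar>n\<bar> \<le> int K then transfer_kernel T k n else 0)
      (galerkin_transfer T K)"
proof -
  have "1 < exp (2 * pi * \<eta>)" using \<eta> by simp
  then have "q > 1" using q by (rule less_trans)
  then have Tc: "continuous_on (sphere 0 1) T"
    by (intro continuous_on_subset[OF holomorphic_on_imp_continuous_on[OF hol]] circle_subset_annulus)
  have T1: "T \<in> sphere 0 1 \<rightarrow> sphere 0 1"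
    using T unfolding uniformly_expanding_def C1_circle_map_def by (elim conjE)
  note series = fourier_coeff_transfer_operator_series[OF T Tc, folded transfer_kernel_def]
  have bnd: "cmod (transfer_kernel T k n) \<le> fourier_weight \<eta> n / fourier_weight \<rho> k" for k n
    using transfer_matrix_bound[OF \<eta> \<rho> q hol T1 dis, of n k]
    by (simp only: transfer_kernel_def fourier_weight_def exp_minus divide_inverse)
  have smm: "(\<lambda>n. cmod (fourier_coeff f n)) summable_on UNIV" if "f \<in> fourier_space \<eta>" for f
    by (rule fourier_space_coeff_summable[OF less_imp_le[OF \<eta>] that])
  show "fourier_kernel \<eta> \<rho> (transfer_kernel T) (transfer_operator T)"
    by (intro fourier_kernel.intro \<eta> bnd series smm)
  show "fourier_kernel \<eta> \<rho> (\<lambda>k n. if \<bar>k\<bar> \<le> int K \<and> \<bar>n\<bar> \<le> int K then transfer_kernel T k n else 0)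
      (galerkin_transfer T K)"
  proof (rule fourier_kernel.intro)
    show "0 < \<eta>" by (rule \<eta>)
    fix k n
    show "cmod (if \<bar>k\<bar> \<le> int K \<and> \<bar>n\<bar> \<le> int K then transfer_kernel T k n else 0) \<le>
        fourier_weight \<eta> n / fourier_weight \<rho> k"
      using bnd[of k n] by simp
  next
    fix f k assume f: "f \<in> fourier_space \<eta>"
    have s: "(\<lambda>n. cmod (fourier_coeff (galerkin_proj K f) n)) summable_on UNIV"
      by (rule summable_on_comparison_test[OF smm[OF f]]) (simp_all add: fourier_coeff_galerkin_proj)
    have "fourier_coeff (galerkin_transfer T K f) k =
        (if \<bar>k\<bar> \<le> int K then (\<Sum>\<^sub>\<infinity>n. fourier_coeff (galerkin_proj K f) n * transfer_kernel T k n) else 0)"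
      by (simp only: galerkin_transfer_def o_apply fourier_coeff_galerkin_proj[of K "transfer_operator T (galerkin_proj K f)"] series[OF s])
    also have "\<dots> = (\<Sum>\<^sub>\<infinity>n. fourier_coeff f n * (if \<bar>k\<bar> \<le> int K \<and> \<bar>n\<bar> \<le> int K then transfer_kernel T k n else 0))"
    proof (cases "\<bar>k\<bar> \<le> int K")
      case True
      show ?thesis unfolding if_P[OF True]
        by (rule infsum_cong) (simp add: fourier_coeff_galerkin_proj True)
    qed simp
    finally show "fourier_coeff (galerkin_transfer T K f) k =
        (\<Sum>\<^sub>\<infinity>n. fourier_coeff f n * (if \<bar>k\<bar> \<le> int K \<and> \<bar>n\<bar> \<le> int K then transfer_kernel T k n else 0))" .
  qed
qed

lemma total_mult_fourier_kernel:
  assumes m: "fourier_kernel \<eta> \<rho> m L" and \<alpha>: "\<eta> < \<alpha>" "\<alpha> < \<rho>" and D: "bounded D" "0 \<notin> closure D"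
  shows "total_mult (fourier_space \<alpha>) L D =
    enat (nat (\<Sum>z | z \<in> D \<and> char_det (weighted_kernel \<alpha> m) z = 0. zorder (char_det (weighted_kernel \<alpha> m)) z))"
proof -
  interpret L: fourier_kernel \<eta> \<rho> m L by (rule m)
  interpret A: l1_coordinates "fourier_space \<alpha>" "weighted_coeff \<alpha>"
    by (rule l1_coordinates_fourier_space) (use L.eta \<alpha> in simp)
  have nuc: "nuclear (weighted_kernel \<alpha> m)" by (rule L.nuclear_weighted_kernel[OF \<alpha>])
  have "compact (closure D)" using D(1) by (simp add: compact_closure)
  moreover have "closure D \<subseteq> - {0}" using D(2) by auto
  ultimately have "finite {z \<in> closure D. char_det (weighted_kernel \<alpha> m) z = 0}"
    by (rule char_det_not_constant_zero[OF nuc])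
  then have "finite {z \<in> D. char_det (weighted_kernel \<alpha> m) z = 0}"
    by (rule finite_subset[rotated]) (use closure_subset[of D] in auto)
  moreover have "0 \<notin> D" using D(2) closure_subset[of D] by auto
  ultimately show ?thesis
    using A.total_mult_eq_zero_count[OF nuc L.represents_weighted_kernel[OF less_imp_le[OF \<alpha>(1)] \<alpha>(2)]] by simp
qed

theorem proposition3p14:
  fixes T :: "complex \<Rightarrow> complex" and \<eta> \<rho> \<epsilon> \<alpha> \<rr> r \<delta> :: real and K k :: nat
    and \<gamma> :: "nat \<Rightarrow> real \<Rightarrow> complex"
  assumes "0 < \<eta>" and "\<eta> < \<rho>" and "\<epsilon> > 0"
    and "T analytic_on sphere 0 1" and "uniformly_expanding T"
    and "T holomorphic_on annulus (exp (2 * pi * \<eta>) + \<epsilon>)"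
    and "annulus (exp (2 * pi * \<rho>)) \<inter> T ` frontier (annulus (exp (2 * pi * \<eta>))) = {}"
    and "\<alpha> \<in> {\<eta><..<\<rho>}" and "\<rr> > 0"
    and "r = (1 / \<rr>) powr (\<alpha> / (\<alpha> - \<eta>)) *
             (1 + 2 / (exp (2 * pi * (\<rho> - \<alpha>)) - 1)) powr (\<alpha> / (\<alpha> - \<eta>))"
    and "K \<ge> 1" and "\<delta> > 0"
    and "ennreal \<delta> \<ge> ennreal r *
           op_norm (fourier_space \<alpha>) (fourier_norm \<alpha>) (fourier_norm 0)
             (\<lambda>f. transfer_operator T f - galerkin_transfer T K f)"
    and "\<gamma> 0 = circlepath 0 \<rr>"
    and "\<And>i. i \<in> {1..k} \<Longrightarrow> simple_path (\<gamma> i) \<and> pathfinish (\<gamma> i) = pathstart (\<gamma> i)"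
    and "disjoint_family_on (\<lambda>i. closure (inside (path_image (\<gamma> i)))) {0..k}"
    and "pseudospectrum \<delta> (fourier_space 0) (fourier_norm 0) (galerkin_transfer T K)
           \<subseteq> (\<Union>j\<in>{0..k}. inside (path_image (\<gamma> j)))"
  shows "(\<forall>\<beta>\<in>{\<eta>, \<alpha>}. op_spectrum (fourier_space \<beta>) (fourier_norm \<beta>) (transfer_operator T)
                        \<subseteq> (\<Union>j\<in>{0..k}. inside (path_image (\<gamma> j)))) \<and>
         (\<forall>j\<in>{1..k}. total_mult (fourier_space \<alpha>) (transfer_operator T) (inside (path_image (\<gamma> j))) =
                       total_mult (fourier_space \<alpha>) (galerkin_transfer T K) (inside (path_image (\<gamma> j))))"
proof -
  let ?D = "\<lambda>j. inside (path_image (\<gamma> j))"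
  define m where "m = transfer_kernel T"
  define m' where "m' = (\<lambda>k n. if \<bar>k\<bar> \<le> int K \<and> \<bar>n\<bar> \<le> int K then transfer_kernel T k n else 0)"
  have \<alpha>: "\<eta> < \<alpha>" "\<alpha> < \<rho>" using assms(8) by simp_all
  have \<rho>: "0 < \<rho>" using assms(1,2) by simp
  have q: "exp (2 * pi * \<eta>) + \<epsilon> > exp (2 * pi * \<eta>)" using assms(3) by simp
  have K: "fourier_kernel \<eta> \<rho> m (transfer_operator T)" "fourier_kernel \<eta> \<rho> m' (galerkin_transfer T K)"
    unfolding m_def m'_def by (rule fourier_kernel_transfer_operator[OF assms(1) \<rho> q assms(6,5,7)])+
  interpret L: fourier_kernel \<eta> \<rho> m "transfer_operator T" by (rule K(1))
  interpret L': fourier_kernel \<eta> \<rho> m' "galerkin_transfer T K" by (rule K(2))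
  have D0: "?D 0 = ball 0 \<rr>"
  proof -
    have "?D 0 = inside (frontier (cball 0 \<rr>))" using assms(9,14) by simp
    also have "\<dots> = interior (cball 0 \<rr>)" by (rule inside_frontier_eq_interior) simp_all
    finally show ?thesis by simp
  qed
  \<comment> \<open>Exclusion from the disk \<open>?D 0\<close> gives
    \<open>\<rr> \<le> cmod z\<close>, and exclusion from the union keeps \<open>z\<close> out of
    the pseudospectrum. The case \<open>s = 1\<close> serves the inclusion of the spectrum, boundary
    points of the regions serve the homotopy.\<close>
  have nz: "char_det (weighted_kernel \<alpha> (\<lambda>k n. m' k n + of_real s * (m k n - m' k n))) z \<noteq> 0"
    if s: "s \<in> {0..1}" and z: "z \<notin> (\<Union>j\<in>{0..k}. ?D j)" for s z
  proof (rule homotopy_char_det_nonzero[OF K \<alpha> assms(9) _ assms(12) assms(10)[folded decay_const_def] assms(13) _ s])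
    show "z \<notin> pseudospectrum \<delta> (fourier_space 0) (fourier_norm 0) (galerkin_transfer T K)"
      using z assms(17) by (rule contra_subsetD[rotated])
    have "z \<notin> ?D 0" using z by simp
    then show "\<rr> \<le> cmod z" unfolding D0 by simp
  qed
  have spec: "op_spectrum (fourier_space \<beta>) (fourier_norm \<beta>) (transfer_operator T) \<subseteq> (\<Union>j\<in>{0..k}. ?D j)"
    if \<beta>: "\<eta> \<le> \<beta>" "\<beta> \<le> \<alpha>" for \<beta>
  proof (rule subsetI, rule ccontr)
    fix z
    assume sp: "z \<in> op_spectrum (fourier_space \<beta>) (fourier_norm \<beta>) (transfer_operator T)"
      and z: "z \<notin> (\<Union>j\<in>{0..k}. ?D j)"
    have "z \<notin> ?D 0" using z by simp
    then have "z \<noteq> 0" unfolding D0 using assms(9) by auto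
    moreover have "char_det (weighted_kernel \<alpha> m) z \<noteq> 0" using nz[OF _ z, of 1] by simp
    ultimately show False using L.not_in_op_spectrum[OF \<beta> \<alpha>] sp by simp
  qed
  have mult: "total_mult (fourier_space \<alpha>) (transfer_operator T) (?D j) =
      total_mult (fourier_space \<alpha>) (galerkin_transfer T K) (?D j)" if j: "j \<in> {1..k}" for j
  proof -
    have "path (\<gamma> j)" using assms(15)[OF j] simple_path_imp_path by auto
    then have cp: "compact (path_image (\<gamma> j))" by (rule compact_path_image)
    have op: "open (?D j)" by (rule open_inside[OF compact_imp_closed[OF cp]])
    have bd: "bounded (?D j)" by (rule bounded_inside[OF compact_imp_bounded[OF cp]])
    have disj: "closure (?D i) \<inter> closure (?D j) = {}" if "i \<in> {0..k}" "i \<noteq> j" for i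
      using disjoint_family_onD[OF assms(16) that(1) _ that(2)] j by simp
    \<comment> \<open>The determinants are holomorphic only off 0. The origin lies in the disk,
      whose closure is disjoint from the other closures.\<close>
    have "0 \<in> closure (?D 0)" unfolding D0 using assms(9) closure_subset[of "ball 0 \<rr>"] by auto
    then have z0: "0 \<notin> closure (?D j)" using disj[of 0] j by auto
    \<comment> \<open>A boundary point of the open set \<open>?D j\<close> is not in
      \<open>?D j\<close>, and disjointness of the closures keeps it out of the other
      regions.\<close>
    have fr: "z \<notin> (\<Union>i\<in>{0..k}. ?D i)" if z: "z \<in> frontier (?D j)" for z
    proof
      assume "z \<in> (\<Union>i\<in>{0..k}. ?D i)"
      then obtain i where i: "i \<in> {0..k}" "z \<in> ?D i" by auto
      have zc: "z \<in> closure (?D j)" "z \<notin> ?D j"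
        using z op by (auto simp: frontier_def interior_open)
      have "i \<noteq> j" using i(2) zc(2) by auto
      then show False using disj[OF i(1)] i(2) zc(1) closure_subset[of "?D i"] by auto
    qed
    \<comment> \<open>\<open>weighted_kernel\<close> is linear in the kernel, so the segment between
      the two matrices represents the segment between the two operators.\<close>
    have comb: "(\<lambda>i j. weighted_kernel \<alpha> m' i j + of_real s * (weighted_kernel \<alpha> m i j - weighted_kernel \<alpha> m' i j)) =
        weighted_kernel \<alpha> (\<lambda>k n. m' k n + of_real s * (m k n - m' k n))" for s :: real
      by (intro ext) (simp add: weighted_kernel_def algebra_simps add_divide_distrib diff_divide_distrib)
    have "(\<Sum>z | z \<in> ?D j \<and> char_det (weighted_kernel \<alpha> m) z = 0. zorder (char_det (weighted_kernel \<alpha> m)) z) =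
        (\<Sum>z | z \<in> ?D j \<and> char_det (weighted_kernel \<alpha> m') z = 0. zorder (char_det (weighted_kernel \<alpha> m')) z)"
      by (rule char_det_zero_count_homotopy[OF L.nuclear_weighted_kernel[OF \<alpha>] L'.nuclear_weighted_kernel[OF \<alpha>] op bd z0])
         (unfold comb, rule nz[OF _ fr])
    then show ?thesis
      unfolding total_mult_fourier_kernel[OF K(1) \<alpha> bd z0] total_mult_fourier_kernel[OF K(2) \<alpha> bd z0] by simp
  qed
  show ?thesis
  proof (intro conjI ballI)
    fix \<beta> assume "\<beta> \<in> {\<eta>, \<alpha>}"
    then have "\<eta> \<le> \<beta>" "\<beta> \<le> \<alpha>" using \<alpha> by auto
    then show "op_spectrum (fourier_space \<beta>) (fourier_norm \<beta>) (transfer_operator T) \<subseteq> (\<Union>j\<in>{0..k}. ?D j)"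
      by (rule spec)
  qed (rule mult)
qed

end
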